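(* Suppose that $\mathcal I_t$ is a positive operator on $L^2(\partial X,\nu_o)$ for all $0<t\le\frac12$. Then the group $\Gamma$ satisfies the Haagerup property.
   Context: Setting. $(X,d)$ is a proper metric space with basepoint $o$; the Gromov product is $(x,y)_p=\frac12(d(x,p)+d(y,p)-d(x,y))$. It is assumed that $(X,d)$ is: $\delta$-hyperbolic (for some $\delta\ge0$, $(x,y)_o\ge\min\{(x,z)_o,(z,y)_o\}-\delta$ for all $x,y,z$); roughly geodesic (there is $C_X>0$ such that any $x,y\in X$ are joined by a map $r:[a,b]\to X$, $r(a)=x$, $r(b)=y$, with $|t-s|-C_X\le d(r(t),r(s))\le|t-s|+C_X$); and $\epsilon$-good for some $\epsilon>0$ (for every basepoint $p$ the Gromov product $(\cdot,\cdot)_p$ extends continuously to $\overline X=X\cup\partial X$, where $\partial X$ is the Gromov boundary, and $d_{p,\epsilon}(\xi,\eta)=e^{-\epsilon(\xi,\eta)_p}$ is a metric on $\partial X$). $\Gamma$ is a non-elementary discrete (Gromov hyperbolic) group acting on $X$ by isometries, properly discontinuously and cocompactly. $Q=\limsup_{r\to\infty}\frac1r\log|\Gamma o\cap B(o,r)|$, $D=Q/\epsilon$, and $\nu_o$ is the $D$-dimensional Hausdorff measure of $(\partial X,d_{o,\epsilon})$ normalized to be a probability. For $t>0$, $\mathcal I_t(v)(\xi)=\int_{\partial X}\frac{v(\eta)}{d_{o,\epsilon}(\xi,\eta)^{(1-2t)D}}d\nu_o(\eta)$, a bounded self-adjoint operator on $L^2(\partial X,\nu_o)$. Haagerup property: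 there exists a proper conditionally negative function on $\Gamma$, i.e. a proper $\psi:\Gamma\to\mathbb R_+$ with $\sum_{i,j}\lambda_i\lambda_j\psi(\gamma_j^{-1}\gamma_i)\le0$ for all $n\ge1$, $\gamma_1,\dots,\gamma_n\in\Gamma$ and real $\lambda_i$ with $\sum\lambda_i=0$ (equivalently, there is a sequence of positive definite functions on $\Gamma$ vanishing at infinity, equal to $1$ at $e$, and converging pointwise to $1$). *)

theory Defs
  imports "HOL-Analysis.Analysis" "HOL-Algebra.Group_Action" "HOL-Algebra.Generated_Groups"
begin

section \<open>Gromov products and hyperbolicity\<close>

definition gromov_product :: "('p \<Rightarrow> 'p \<Rightarrow> real) \<Rightarrow> 'p \<Rightarrow> 'p \<Rightarrow> 'p \<Rightarrow> real" where
  "gromov_product d p x y = (d x p + d y p - d x y) / 2"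

abbreviation gprod :: "'a::metric_space \<Rightarrow> 'a \<Rightarrow> 'a \<Rightarrow> real" where
  "gprod \<equiv> gromov_product dist"

definition gromov_hyperbolic_at :: "'p set \<Rightarrow> ('p \<Rightarrow> 'p \<Rightarrow> real) \<Rightarrow> 'p \<Rightarrow> real \<Rightarrow> bool" where
  "gromov_hyperbolic_at S d p \<delta> \<longleftrightarrow>
     (\<forall>x\<in>S. \<forall>y\<in>S. \<forall>z\<in>S.
        gromov_product d p x y \<ge> min (gromov_product d p x z) (gromov_product d p z y) - \<delta>)"

definition roughly_geodesic :: "'a::metric_space itself \<Rightarrow> bool" where
  "roughly_geodesic _ \<longleftrightarrow>
     (\<exists>C>0. \<forall>x y :: 'a. \<exists>a b :: real. \<exists>r :: real \<Rightarrow> 'a.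
        a \<le> b \<and> r a = x \<and> r b = y \<and>
        (\<forall>s\<in>{a..b}. \<forall>t\<in>{a..b}.
           \<bar>t - s\<bar> - C \<le> dist (r t) (r s) \<and> dist (r t) (r s) \<le> \<bar>t - s\<bar> + C))"


section \<open>The Gromov boundary and the bordification\<close>

definition gromov_sequences :: "'a::metric_space \<Rightarrow> (nat \<Rightarrow> 'a) set" where
  "gromov_sequences p =
     {x. LIM (i, j) (sequentially \<times>\<^sub>F sequentially). gprod p (x i) (x j) :> at_top}"

definition gromov_equiv :: "'a::metric_space \<Rightarrow> ((nat \<Rightarrow> 'a) \<times> (nat \<Rightarrow> 'a)) set" where
  "gromov_equiv p =
     {(x, y). x \<in> gromov_sequences p \<and> y \<in> gromov_sequences p \<and>
        (LIM (i, j) (sequentially \<times>\<^sub>F sequentially). gprod p (x i) (y j) :> at_top)}"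

definition gromov_boundary :: "'a::metric_space \<Rightarrow> (nat \<Rightarrow> 'a) set set" where
  "gromov_boundary p = gromov_sequences p // gromov_equiv p"

text \<open>
  Points of the bordification \<open>X \<union> \<partial>X\<close> are tagged: \<open>Inl x\<close> for \<open>x\<close> in the space, \<open>Inr \<xi>\<close> for \<open>\<xi>\<close> in
  the boundary. A boundary point is an equivalence class of sequences of the space, so the
  sequences converging to it are its elements.
\<close>

type_synonym 'a bord = "'a + (nat \<Rightarrow> 'a) set"

definition bordification :: "'a::metric_space \<Rightarrow> 'a bord set" where
  "bordification p = UNIV <+> gromov_boundary p"

definition seq_tends_to :: "(nat \<Rightarrow> 'a::metric_space) \<Rightarrow> 'a bord \<Rightarrow> bool" where
  "seq_tends_to x c = (case c of Inl z \<Rightarrow> x \<longlonglongrightarrow> z | Inr \<xi> \<Rightarrow> x \<in> \<xi>)"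

text \<open>
  The basic neighbourhood \<open>{y. (\<xi>,y)\<^sub>p > R}\<close> of a boundary point, for the usual extension
  of the Gromov product, the supremum of \<open>liminf\<^sub>i\<^sub>,\<^sub>j (x\<^sub>i,y\<^sub>j)\<^sub>p\<close> over sequences
  \<open>x\<^sub>i \<rightarrow> \<xi>\<close> and \<open>y\<^sub>j \<rightarrow> y\<close>. This extension need not be continuous; it only serves to
  define the topology of the bordification.
\<close>

definition boundary_nhd :: "'a::metric_space \<Rightarrow> (nat \<Rightarrow> 'a) set \<Rightarrow> real \<Rightarrow> 'a bord set" where
  "boundary_nhd p \<xi> R =
     {c \<in> bordification p. \<exists>x y. seq_tends_to x (Inr \<xi>) \<and> seq_tends_to y c \<and>
        Liminf (sequentially \<times>\<^sub>F sequentially) (\<lambda>(i, j). ereal (gprod p (x i) (y j))) > ereal R}"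

definition bord_topology :: "'a::metric_space \<Rightarrow> 'a bord topology" where
  "bord_topology p = topology (\<lambda>U. U \<subseteq> bordification p \<and> open (Inl -` U) \<and>
     (\<forall>\<xi>. Inr \<xi> \<in> U \<longrightarrow> (\<exists>R. boundary_nhd p \<xi> R \<subseteq> U)))"

lemma boundary_nhd_antimono:
  assumes "R \<le> R'"
  shows "boundary_nhd p \<xi> R' \<subseteq> boundary_nhd p \<xi> R"
  using assms unfolding boundary_nhd_def
  by (smt (verit) Collect_mono ereal_less_eq(3) order_le_less_trans)

lemma openin_bord_topology:
  "openin (bord_topology p) U \<longleftrightarrow> U \<subseteq> bordification p \<and> open (Inl -` U) \<and>
     (\<forall>\<xi>. Inr \<xi> \<in> U \<longrightarrow> (\<exists>R. boundary_nhd p \<xi> R \<subseteq> U))"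
proof -
  let ?L = "\<lambda>U. U \<subseteq> bordification p \<and> open (Inl -` U) \<and>
     (\<forall>\<xi>. Inr \<xi> \<in> U \<longrightarrow> (\<exists>R. boundary_nhd p \<xi> R \<subseteq> U))"
  have "istopology ?L"
    unfolding istopology_def
  proof (intro conjI allI impI)
    fix S T assume S: "?L S" and T: "?L T"
    show "S \<inter> T \<subseteq> bordification p" "open (Inl -` (S \<inter> T))"
      using S T by auto
    fix \<xi> assume "Inr \<xi> \<in> S \<inter> T"
    then obtain R R' where "boundary_nhd p \<xi> R \<subseteq> S" "boundary_nhd p \<xi> R' \<subseteq> T"
      using S T by blast
    moreover have "boundary_nhd p \<xi> (max R R') \<subseteq> boundary_nhd p \<xi> R"
      "boundary_nhd p \<xi> (max R R') \<subseteq> boundary_nhd p \<xi> R'"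
      by (intro boundary_nhd_antimono; simp)+
    ultimately show "\<exists>R. boundary_nhd p \<xi> R \<subseteq> S \<inter> T" by blast
  next
    fix K :: "'a bord set set" assume K: "\<forall>U\<in>K. ?L U"
    then show "\<Union>K \<subseteq> bordification p" by blast
    show "open (Inl -` \<Union>K)" using K by (auto simp: vimage_Union)
    fix \<xi> assume "Inr \<xi> \<in> \<Union>K"
    then show "\<exists>R. boundary_nhd p \<xi> R \<subseteq> \<Union>K" using K by (meson Union_iff Union_upper order_trans)
  qed
  then show ?thesis unfolding bord_topology_def by simp
qed

definition continuous_extension ::
    "'a::metric_space \<Rightarrow> 'a \<Rightarrow> ('a bord \<times> 'a bord \<Rightarrow> ereal) \<Rightarrow> bool" where
  "continuous_extension p q F \<longleftrightarrow>
     continuous_map (prod_topology (bord_topology p) (bord_topology p)) euclidean F \<and>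
     (\<forall>x y. F (Inl x, Inl y) = ereal (gprod q x y))"

text \<open>
  The space is dense in its bordification, so the values of a continuous extension on the
  bordification are unique and the choice below is harmless.
\<close>

definition extended_gprod :: "'a::metric_space \<Rightarrow> 'a \<Rightarrow> 'a bord \<Rightarrow> 'a bord \<Rightarrow> ereal" where
  "extended_gprod p q c c' = (SOME F. continuous_extension p q F) (c, c')"

text \<open>
  The distance \<open>d\<^sub>q\<^sub>,\<^sub>\<epsilon>(\<xi>,\<eta>) = exp (-\<epsilon> (\<xi>,\<eta>)\<^sub>q)\<close>, with \<open>exp (-\<infinity>) = 0\<close>. The boundary and its
  topology are formed with the basepoint \<open>p\<close>, while \<open>q\<close> is the basepoint of the Gromov product.
  The value \<open>0\<close> outside the boundary is a dummy.
\<close>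

definition visual_dist ::
    "'a::metric_space \<Rightarrow> real \<Rightarrow> 'a \<Rightarrow> (nat \<Rightarrow> 'a) set \<Rightarrow> (nat \<Rightarrow> 'a) set \<Rightarrow> real" where
  "visual_dist p \<epsilon> q \<xi> \<eta> =
     (if \<xi> \<in> gromov_boundary p \<and> \<eta> \<in> gromov_boundary p
      then (let g = extended_gprod p q (Inr \<xi>) (Inr \<eta>)
            in if g = \<infinity> then 0 else exp (- \<epsilon> * real_of_ereal g))
      else 0)"

definition good_space :: "'a::metric_space \<Rightarrow> real \<Rightarrow> bool" where
  "good_space p \<epsilon> \<longleftrightarrow>
     (\<forall>q. (\<exists>F. continuous_extension p q F) \<and>
          Metric_space (gromov_boundary p) (visual_dist p \<epsilon> q))"


section \<open>Hausdorff measure\<close>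

text \<open>
  Since \<open>0 powr s = 0\<close>, the formula is the usual Hausdorff measure for \<open>s > 0\<close> only.
\<close>

definition set_diam :: "('p \<Rightarrow> 'p \<Rightarrow> real) \<Rightarrow> 'p set \<Rightarrow> real" where
  "set_diam d A = (if A = {} then 0 else SUP z\<in>A \<times> A. d (fst z) (snd z))"

definition hausdorff_outer ::
    "'p set \<Rightarrow> ('p \<Rightarrow> 'p \<Rightarrow> real) \<Rightarrow> real \<Rightarrow> 'p set \<Rightarrow> ennreal" where
  "hausdorff_outer M d s A =
     (SUP \<delta>\<in>{0::real<..}. INF U\<in>{U :: nat \<Rightarrow> 'p set. A \<subseteq> (\<Union>i. U i) \<and>
           (\<forall>i. U i \<subseteq> M \<and> (\<forall>x\<in>U i. \<forall>y\<in>U i. d x y \<le> \<delta>))}.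
        (\<Sum>i. ennreal (set_diam d (U i) powr s)))"

definition hausdorff_measure :: "'p set \<Rightarrow> ('p \<Rightarrow> 'p \<Rightarrow> real) \<Rightarrow> real \<Rightarrow> 'p measure" where
  "hausdorff_measure M d s =
     measure_of M {U. openin (Metric_space.mtopology M d) U} (hausdorff_outer M d s)"


section \<open>The group and its action\<close>

definition properly_discontinuous ::
    "('g, 'm) monoid_scheme \<Rightarrow> ('g \<Rightarrow> 'a::topological_space \<Rightarrow> 'a) \<Rightarrow> bool" where
  "properly_discontinuous G \<phi> \<longleftrightarrow>
     (\<forall>K. compact K \<longrightarrow> finite {g \<in> carrier G. \<phi> g ` K \<inter> K \<noteq> {}})"

definition cocompact ::
    "('g, 'm) monoid_scheme \<Rightarrow> ('g \<Rightarrow> 'a::topological_space \<Rightarrow> 'a) \<Rightarrow> bool" where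
  "cocompact G \<phi> \<longleftrightarrow> (\<exists>K. compact K \<and> (\<Union>g\<in>carrier G. \<phi> g ` K) = UNIV)"

definition word_length :: "('g, 'm) monoid_scheme \<Rightarrow> 'g set \<Rightarrow> 'g \<Rightarrow> nat" where
  "word_length G S g =
     (LEAST n. \<exists>w. length w = n \<and> set w \<subseteq> S \<union> m_inv G ` S \<and>
        g = foldr (\<lambda>a b. a \<otimes>\<^bsub>G\<^esub> b) w \<one>\<^bsub>G\<^esub>)"

definition hyperbolic_group :: "('g, 'm) monoid_scheme \<Rightarrow> bool" where
  "hyperbolic_group G \<longleftrightarrow> group G \<and>
     (\<exists>S \<delta>. finite S \<and> S \<subseteq> carrier G \<and> generate G S = carrier G \<and> \<delta> \<ge> 0 \<and>
        gromov_hyperbolic_at (carrier G)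
          (\<lambda>g h. real (word_length G S (inv\<^bsub>G\<^esub> g \<otimes>\<^bsub>G\<^esub> h))) \<one>\<^bsub>G\<^esub> \<delta>)"

text \<open>A hyperbolic group is non-elementary if it is not virtually cyclic (finite groups are).\<close>

definition non_elementary :: "('g, 'm) monoid_scheme \<Rightarrow> bool" where
  "non_elementary G \<longleftrightarrow> \<not> (\<exists>a\<in>carrier G. finite (rcosets\<^bsub>G\<^esub> (generate G {a})))"

definition growth_exponent ::
    "('g, 'm) monoid_scheme \<Rightarrow> ('g \<Rightarrow> 'a::metric_space \<Rightarrow> 'a) \<Rightarrow> 'a \<Rightarrow> real" where
  "growth_exponent G \<phi> p =
     real_of_ereal (Limsup at_top (\<lambda>r::real. ereal (ln (real (card (orbit G \<phi> p \<inter> ball p r))) / r)))"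

definition boundary_dim ::
    "('g, 'm) monoid_scheme \<Rightarrow> ('g \<Rightarrow> 'a::metric_space \<Rightarrow> 'a) \<Rightarrow> 'a \<Rightarrow> real \<Rightarrow> real" where
  "boundary_dim G \<phi> p \<epsilon> = growth_exponent G \<phi> p / \<epsilon>"

definition boundary_measure ::
    "('g, 'm) monoid_scheme \<Rightarrow> ('g \<Rightarrow> 'a::metric_space \<Rightarrow> 'a) \<Rightarrow> 'a \<Rightarrow> real
      \<Rightarrow> (nat \<Rightarrow> 'a) set measure" where
  "boundary_measure G \<phi> p \<epsilon> =
     uniform_measure
       (hausdorff_measure (gromov_boundary p) (visual_dist p \<epsilon> p) (boundary_dim G \<phi> p \<epsilon>))
       (gromov_boundary p)"


section \<open>The intertwining operators\<close>

text \<open>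
  On the diagonal \<open>\<xi> = \<eta>\<close> the integrand below is \<open>v \<xi> / 0 = 0\<close>; in the intended setting the
  dimension is positive and the measure has no atoms, so this does not affect the integral.
\<close>

definition riesz_operator ::
    "('g, 'm) monoid_scheme \<Rightarrow> ('g \<Rightarrow> 'a::metric_space \<Rightarrow> 'a) \<Rightarrow> 'a \<Rightarrow> real \<Rightarrow> real
      \<Rightarrow> ((nat \<Rightarrow> 'a) set \<Rightarrow> complex) \<Rightarrow> ((nat \<Rightarrow> 'a) set \<Rightarrow> complex)" where
  "riesz_operator G \<phi> p \<epsilon> t v \<xi> =
     (\<integral>\<eta>. v \<eta> / complex_of_real (visual_dist p \<epsilon> p \<xi> \<eta> powr ((1 - 2 * t) * boundary_dim G \<phi> p \<epsilon>))
        \<partial>(boundary_measure G \<phi> p \<epsilon>))"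

definition square_integrable :: "'p measure \<Rightarrow> ('p \<Rightarrow> complex) \<Rightarrow> bool" where
  "square_integrable M v \<longleftrightarrow> v \<in> borel_measurable M \<and> integrable M (\<lambda>x. (cmod (v x))\<^sup>2)"

text \<open>
  Positivity \<open>\<langle>T v, v\<rangle> \<ge> 0\<close> of an operator on complex \<open>L\<^sup>2(M)\<close>, stated on representatives.
\<close>

definition positive_operator_L2 :: "'p measure \<Rightarrow> (('p \<Rightarrow> complex) \<Rightarrow> 'p \<Rightarrow> complex) \<Rightarrow> bool" where
  "positive_operator_L2 M T \<longleftrightarrow>
     (\<forall>v. square_integrable M v \<longrightarrow> (\<integral>x. T v x * cnj (v x) \<partial>M) \<in> \<real>\<^sub>\<ge>\<^sub>0)"


section \<open>The Haagerup property\<close>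

definition conditionally_negative :: "('g, 'm) monoid_scheme \<Rightarrow> ('g \<Rightarrow> real) \<Rightarrow> bool" where
  "conditionally_negative G \<psi> \<longleftrightarrow>
     (\<forall>n\<ge>1. \<forall>(\<gamma> :: nat \<Rightarrow> 'g) (c :: nat \<Rightarrow> real).
        (\<forall>i<n. \<gamma> i \<in> carrier G) \<longrightarrow> (\<Sum>i<n. c i) = 0 \<longrightarrow>
        (\<Sum>i<n. \<Sum>j<n. c i * c j * \<psi> (inv\<^bsub>G\<^esub> (\<gamma> j) \<otimes>\<^bsub>G\<^esub> \<gamma> i)) \<le> 0)"

definition haagerup :: "('g, 'm) monoid_scheme \<Rightarrow> bool" where
  "haagerup G \<longleftrightarrow>
     (\<exists>\<psi> :: 'g \<Rightarrow> real. (\<forall>g\<in>carrier G. \<psi> g \<ge> 0) \<and>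
        (\<forall>R. finite {g \<in> carrier G. \<psi> g \<le> R}) \<and> conditionally_negative G \<psi>)"

end

theory Submission
  imports Defs "HOL-Real_Asymp.Real_Asymp" "HOL-Library.Diagonal_Subsequence"
    "HOL-Probability.Probability_Measure"
begin

text \<open>
  Let \<open>\<nu>\<close> be the normalised Hausdorff measure of the boundary, \<open>d\<close> the visual metric at the basepoint,
  and consider the logarithmic energy \<open>I(\<mu>, \<mu>') = - \<integral>\<integral> ln d(\<xi>, \<eta>) d\<mu>(\<xi>) d\<mu>'(\<eta>)\<close>. The hypothesis says
  that the kernels \<open>d\<^sup>-\<^sup>s\<close> with \<open>0 < s < D\<close> are positive. On functions of mean zero the constant kernel
  \<open>d\<^sup>0\<close> vanishes, so the derivative \<open>- ln d\<close> at \<open>s = 0\<close> is positive too: \<open>I(\<mu>, \<mu>) \<ge> 0\<close> for all signed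
  measures of mass zero with bounded density (\<open>log_kernel_positive\<close>).

  An isometry \<open>g\<close> acts conformally on the boundary, \<open>d(g \<xi>, g \<eta>) = d(\<xi>, \<eta>) e\<^sup>-\<^sup>\<kappa>\<^sup>(\<^sup>\<xi>\<^sup>)\<^sup>-\<^sup>\<kappa>\<^sup>(\<^sup>\<eta>\<^sup>)\<close>. It
  therefore changes \<open>- ln d\<close> by a sum of functions of one variable, which are invisible to signed
  measures of mass zero, and \<open>I\<close> is an invariant positive form on these. As \<open>g \<mapsto> \<nu> - g \<nu>\<close> is a
  cocycle, \<open>\<psi>(g) = I(\<nu> - g \<nu>, \<nu> - g \<nu>)\<close> is conditionally negative. It is proper: the mixed energies
  \<open>I(\<nu>, g \<nu>)\<close> are bounded because \<open>\<nu>\<close> has a bounded logarithmic potential, while \<open>I(g \<nu>, g \<nu>)\<close> grows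
  like \<open>\<epsilon> |g|\<close>, because \<open>g\<close> contracts most of the boundary by the factor \<open>e\<^sup>-\<^sup>\<epsilon>\<^sup>|\<^sup>g\<^sup>|\<close>
  (\<open>haagerup_conformal_action\<close>).

  This uses that the Hausdorff measure of the boundary is positive and finite, and that a ball of
  radius \<open>r\<close> has measure \<open>O(r\<^sup>D)\<close>. Both follow from counting orbit points: when \<open>Q > 0\<close>, the number of
  group elements of length at most \<open>r\<close> lies between constant multiples of \<open>e\<^sup>Q\<^sup>r\<close>. The lower bound is
  submultiplicativity (\<open>growth_lower\<close>). For the upper bound one needs almost geodesic products \<open>g f h\<close>
  with \<open>f\<close> from a fixed finite set; if no such \<open>f\<close> existed, a whole ball of the group would
  translate along one geodesic and would grow linearly only (\<open>branching\<close>, \<open>growth_upper\<close>). The shadow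
  count which results bounds the measure of balls from above by explicit covers
  (\<open>hausdorff_ball_upper\<close>), and it bounds the total measure from below because the sets of a cover
  with small total content would miss a limit point of the orbit (\<open>hausdorff_boundary_pos\<close>).

  When \<open>Q = 0\<close>, the balls of the group contain a Foelner sequence, and such groups have the
  Haagerup property (\<open>haagerup_if_subexponential\<close>).
\<close>

section \<open>Hausdorff measures\<close>

context Metric_space
begin

text \<open>
  Caratheodory's criterion. To see that an open set \<open>U\<close> splits a test set \<open>X\<close> additively, exhaust
  \<open>X \<inter> U\<close> by the sets \<open>A n\<close> at distance at least \<open>1/(n+1)\<close> from the complement of \<open>U\<close>, on which
  additivity is assumed. The shells \<open>A (n+1) - A n\<close> of even index are mutually separated, and so are
  those of odd index, so the measures of all shells have a finite sum; the shells beyond \<open>A n\<close>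
  therefore contribute arbitrarily little.
\<close>

lemma metric_outer_measure_lambda_system:
  fixes f :: "'a set \<Rightarrow> ennreal"
  assumes empty: "f {} = 0"
    and mono: "\<And>A B. A \<subseteq> B \<Longrightarrow> B \<subseteq> M \<Longrightarrow> f A \<le> f B"
    and csub: "\<And>A :: nat \<Rightarrow> 'a set. (\<And>n. A n \<subseteq> M) \<Longrightarrow> f (\<Union>n. A n) \<le> (\<Sum>n. f (A n))"
    and sep: "\<And>A B r. A \<subseteq> M \<Longrightarrow> B \<subseteq> M \<Longrightarrow> r > 0 \<Longrightarrow> (\<And>x y. x \<in> A \<Longrightarrow> y \<in> B \<Longrightarrow> r \<le> d x y) \<Longrightarrow>
      f A + f B \<le> f (A \<union> B)"
    and U: "openin mtopology U"
  shows "U \<in> lambda_system M (Pow M) f"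
proof -
  have UM: "U \<subseteq> M" using U by (simp add: openin_mtopology)
  have sub2: "f (A \<union> B) \<le> f A + f B" if "A \<subseteq> M" "B \<subseteq> M" for A B
  proof -
    have "f (\<Union>n. if n = 0 then A else if n = Suc 0 then B else {}) \<le> (\<Sum>n. f (if n = 0 then A else if n = Suc 0 then B else {}))"
      using that by (intro csub) auto
    also have "\<dots> = (\<Sum>n<2. f (if n = 0 then A else if n = Suc 0 then B else {}))"
      by (rule suminf_finite) (auto simp: empty)
    also have "\<dots> = f A + f B" by (simp add: numeral_2_eq_2)
    also have "(\<Union>n. if n = 0 then A else if n = Suc 0 then B else {}) = A \<union> B"
      by (auto split: if_splits)
    finally show ?thesis .
  qed
  have "f (U \<inter> X) + f ((M - U) \<inter> X) = f X" if X: "X \<subseteq> M" for X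
  proof (rule antisym)
    let ?X1 = "U \<inter> X" and ?X2 = "(M - U) \<inter> X"
    have "X = ?X1 \<union> ?X2" using X by auto
    then show "f X \<le> f ?X1 + f ?X2" using sub2[of ?X1 ?X2] X by auto
    show "f ?X1 + f ?X2 \<le> f X"
    proof (cases "f X = \<infinity>")
      case False
      define A where "A n = {x \<in> ?X1. \<forall>y\<in>M - U. 1 / (real n + 1) \<le> d x y}" for n :: nat
      define S where "S n = A (Suc n) - A n" for n
      have AM: "A n \<subseteq> M" "A n \<subseteq> X" for n using X by (auto simp: A_def)
      have SM: "S n \<subseteq> M" "S n \<subseteq> X" for n using AM by (auto simp: S_def)
      have Amono: "A m \<subseteq> A n" if "m \<le> n" for m n
      proof -
        have "1 / (real n + 1) \<le> 1 / (real m + 1)" using that by (simp add: frac_le)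
        then show ?thesis unfolding A_def by (force intro: order_trans)
      qed
      have AU: "(\<Union>n. A n) = ?X1"
      proof (rule antisym)
        show "?X1 \<subseteq> (\<Union>n. A n)"
        proof
          fix x assume x: "x \<in> ?X1"
          then obtain r where r: "r > 0" "mball x r \<subseteq> U" using U unfolding openin_mtopology by blast
          obtain n where n: "1 / (real n + 1) < r"
            using reals_Archimedean[OF r(1)] by (auto simp: inverse_eq_divide add.commute)
          have "1 / (real n + 1) \<le> d x y" if "y \<in> M - U" for y
          proof (rule ccontr)
            assume "\<not> 1 / (real n + 1) \<le> d x y"
            then have "y \<in> mball x r" using that n x UM by auto
            then show False using that r(2) by blast
          qed
          then have "x \<in> A n" using x by (simp add: A_def)
          then show "x \<in> (\<Union>n. A n)" by blast
        qed
      qed (auto simp: A_def)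
      have pos: "1 / (real j + 1) - 1 / (real j + 2) > 0" for j :: nat
        by (simp add: frac_less2)
      have SX: "S n \<subseteq> ?X1" for n by (auto simp: S_def A_def)
      have alt: "(\<Sum>k<N. f (S (2 * k + p))) \<le> f X" for N p
      proof -
        have "(\<Sum>k<Suc N. f (S (2 * k + p))) \<le> f (\<Union>k<Suc N. S (2 * k + p))" for N
        proof (induction N)
          case (Suc N)
          let ?B = "\<Union>k<Suc N. S (2 * k + p)" and ?C = "S (2 * Suc N + p)"
          have BA: "?B \<subseteq> A (2 * N + p + 1)"
          proof
            fix x assume "x \<in> ?B"
            then obtain k where k: "k < Suc N" "x \<in> S (2 * k + p)" by blast
            then have "x \<in> A (Suc (2 * k + p))" by (simp add: S_def)
            then show "x \<in> A (2 * N + p + 1)" using Amono[of "Suc (2 * k + p)" "2 * N + p + 1"] k by auto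
          qed
          have B_C: "f ?B + f ?C \<le> f (?B \<union> ?C)"
          proof (rule sep)
            show "?B \<subseteq> M" "?C \<subseteq> M" using SM by auto
            let ?j = "2 * N + p + 1"
            show "1 / (real ?j + 1) - 1 / (real ?j + 2) > 0" by (rule pos)
            fix x z assume xz: "x \<in> ?B" "z \<in> ?C"
            then have "z \<in> ?X1" "z \<notin> A (Suc ?j)" using SX by (auto simp: S_def)
            then obtain y where y: "y \<in> M - U" "d z y < 1 / (real ?j + 2)"
              by (auto simp: A_def not_le add_ac)
            have "x \<in> A ?j" using BA xz by blast
            then have "1 / (real ?j + 1) \<le> d x y" using y by (auto simp: A_def)
            also have "\<dots> \<le> d x z + d z y" using xz SM y by (intro triangle) auto
            finally show "1 / (real ?j + 1) - 1 / (real ?j + 2) \<le> d x z" using y by simp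
          qed
          have "(\<Sum>k<Suc (Suc N). f (S (2 * k + p))) = (\<Sum>k<Suc N. f (S (2 * k + p))) + f ?C"
            by (rule sum.lessThan_Suc)
          also have "\<dots> \<le> f ?B + f ?C" using Suc by (rule add_right_mono)
          also note B_C
          also have "?B \<union> ?C = (\<Union>k<Suc (Suc N). S (2 * k + p))"
            by (simp only: lessThan_Suc UN_insert Un_ac)
          finally show ?case .
        qed (simp add: lessThan_Suc)
        also have "f (\<Union>k<Suc N. S (2 * k + p)) \<le> f X" for N using SM X by (intro mono) auto
        finally have "(\<Sum>k<Suc N. f (S (2 * k + p))) \<le> f X" .
        moreover have "(\<Sum>k<N. f (S (2 * k + p))) \<le> (\<Sum>k<Suc N. f (S (2 * k + p)))"
          by (rule sum_mono2) auto
        ultimately show ?thesis by (rule order_trans[rotated])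
      qed
      have split: "(\<Sum>n<2 * N. f (S n)) = (\<Sum>k<N. f (S (2 * k + 0))) + (\<Sum>k<N. f (S (2 * k + 1)))" for N
        by (induction N) (simp_all add: add_ac)
      have partial: "(\<Sum>n<N. f (S n)) \<le> f X + f X" for N
      proof -
        have "(\<Sum>n<N. f (S n)) \<le> (\<Sum>n<2 * N. f (S n))" by (intro sum_mono2) auto
        also have "\<dots> \<le> f X + f X" unfolding split by (intro add_mono alt)
        finally show ?thesis .
      qed
      let ?T = "\<Sum>n. f (S n)"
      have "?T \<le> f X + f X" by (intro suminf_le_const summableI partial)
      also have "\<dots> < \<infinity>" using False by (simp add: less_top)
      finally have T: "?T < \<infinity>" .
      have bound: "f ?X1 + f ?X2 + (\<Sum>n<N. f (S n)) \<le> f X + ?T" for N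
      proof -
        have "?X1 \<subseteq> A N \<union> (\<Union>k. S (k + N))"
        proof
          fix x assume "x \<in> ?X1"
          then obtain n where n: "x \<in> A n" using AU by blast
          show "x \<in> A N \<union> (\<Union>k. S (k + N))"
          proof (cases "x \<in> A N")
            case xN: False
            define m where "m = (LEAST n. x \<in> A n)"
            have m: "x \<in> A m" unfolding m_def by (rule LeastI[of _ n]) (rule n)
            have mN: "N < m" using xN Amono[of m N] m by (metis in_mono not_less)
            then obtain m' where m': "m = Suc m'" "N \<le> m'" by (cases m) auto
            have "x \<notin> A m'" using not_less_Least[of m' "\<lambda>n. x \<in> A n"] m' by (simp add: m_def)
            then have "x \<in> S m'" using m m' by (simp add: S_def)
            then have "x \<in> S ((m' - N) + N)" using m' by simp
            then show ?thesis by blast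
          qed simp
        qed
        then have "f ?X1 \<le> f (A N \<union> (\<Union>k. S (k + N)))" by (rule mono) (use AM SM in blast)
        also have "\<dots> \<le> f (A N) + f (\<Union>k. S (k + N))" by (rule sub2) (use AM SM in blast)+
        also have "f (\<Union>k. S (k + N)) \<le> (\<Sum>k. f (S (k + N)))" using SM by (intro csub) auto
        finally have 1: "f ?X1 \<le> f (A N) + (\<Sum>k. f (S (k + N)))" by (simp add: add_left_mono)
        have 2: "f (A N) + f ?X2 \<le> f X"
        proof -
          have "f (A N) + f ?X2 \<le> f (A N \<union> ?X2)"
            by (rule sep[of _ _ "1 / (real N + 1)"]) (use AM in \<open>auto simp: A_def\<close>)
          also have "\<dots> \<le> f X" using AM X by (intro mono) auto
          finally show ?thesis .
        qed
        have "f ?X1 + f ?X2 + (\<Sum>n<N. f (S n)) \<le> (f (A N) + (\<Sum>k. f (S (k + N)))) + f ?X2 + (\<Sum>n<N. f (S n))"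
          using 1 by (intro add_right_mono)
        also have "\<dots> = (f (A N) + f ?X2) + ((\<Sum>k. f (S (k + N))) + (\<Sum>n<N. f (S n)))" by (simp add: add_ac)
        also have "(\<Sum>k. f (S (k + N))) + (\<Sum>n<N. f (S n)) = ?T"
          by (rule suminf_offset[OF summableI, symmetric])
        also have "(f (A N) + f ?X2) + ?T \<le> f X + ?T" using 2 by (rule add_right_mono)
        finally show ?thesis .
      qed
      have "(\<lambda>N. f ?X1 + f ?X2 + (\<Sum>n<N. f (S n))) \<longlonglongrightarrow> f ?X1 + f ?X2 + ?T"
        by (intro tendsto_add tendsto_const summable_LIMSEQ summableI)
      then have "f ?X1 + f ?X2 + ?T \<le> f X + ?T"
        by (rule LIMSEQ_le_const2) (use bound in auto)
      moreover have "?T \<noteq> \<infinity>" using T by auto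
      ultimately show ?thesis by (simp add: ennreal_add_left_cancel_le add.commute[of _ ?T])
    qed simp
  qed
  then show ?thesis using UM by (auto simp: lambda_system_def)
qed

text \<open>
  The Hausdorff premeasure of dimension \<open>s\<close> at the scale \<open>r\<close>.
\<close>

definition hausdorff_content :: "real \<Rightarrow> real \<Rightarrow> 'a set \<Rightarrow> ennreal" where
  "hausdorff_content s r A = (INF U\<in>{U :: nat \<Rightarrow> 'a set. A \<subseteq> (\<Union>i. U i) \<and>
     (\<forall>i. U i \<subseteq> M \<and> (\<forall>x\<in>U i. \<forall>y\<in>U i. d x y \<le> r))}. (\<Sum>i. ennreal (set_diam d (U i) powr s)))"

lemma hausdorff_outer_content: "hausdorff_outer M d s A = (SUP r\<in>{0<..}. hausdorff_content s r A)"
  by (simp add: hausdorff_outer_def hausdorff_content_def)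

lemma hausdorff_content_le:
  fixes U :: "nat \<Rightarrow> 'a set"
  assumes "A \<subseteq> (\<Union>i. U i)" "\<And>i. U i \<subseteq> M" "\<And>i x y. x \<in> U i \<Longrightarrow> y \<in> U i \<Longrightarrow> d x y \<le> r"
  shows "hausdorff_content s r A \<le> (\<Sum>i. ennreal (set_diam d (U i) powr s))"
  unfolding hausdorff_content_def by (rule INF_lower) (use assms in blast)

lemma hausdorff_content_lessE:
  assumes "hausdorff_content s r A < c"
  obtains U :: "nat \<Rightarrow> 'a set" where "A \<subseteq> (\<Union>i. U i)" "\<And>i. U i \<subseteq> M"
    "\<And>i x y. x \<in> U i \<Longrightarrow> y \<in> U i \<Longrightarrow> d x y \<le> r" "(\<Sum>i. ennreal (set_diam d (U i) powr s)) < c"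
  using assms unfolding hausdorff_content_def INF_less_iff by blast

lemma le_hausdorff_content:
  assumes "\<And>U :: nat \<Rightarrow> 'a set. A \<subseteq> (\<Union>i. U i) \<Longrightarrow> (\<And>i. U i \<subseteq> M) \<Longrightarrow>
    (\<And>i x y. x \<in> U i \<Longrightarrow> y \<in> U i \<Longrightarrow> d x y \<le> r) \<Longrightarrow> c \<le> (\<Sum>i. ennreal (set_diam d (U i) powr s))"
  shows "c \<le> hausdorff_content s r A"
  unfolding hausdorff_content_def by (rule INF_greatest) (use assms in blast)

lemma set_diam_empty [simp]: "set_diam d {} = 0"
  by (simp add: set_diam_def)

lemma dist_le_set_diam:
  assumes "x \<in> A" "y \<in> A" "\<And>x y. x \<in> A \<Longrightarrow> y \<in> A \<Longrightarrow> d x y \<le> r"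
  shows "d x y \<le> set_diam d A"
proof -
  have "d (fst (x, y)) (snd (x, y)) \<le> (SUP z\<in>A \<times> A. d (fst z) (snd z))"
    using assms by (intro cSUP_upper bdd_aboveI[of _ r]) auto
  then show ?thesis using assms by (auto simp: set_diam_def)
qed

lemma set_diam_le:
  assumes "r \<ge> 0" "\<And>x y. x \<in> A \<Longrightarrow> y \<in> A \<Longrightarrow> d x y \<le> r"
  shows "set_diam d A \<le> r"
  using assms by (auto simp: set_diam_def intro!: cSUP_least)

lemma set_diam_nonneg:
  assumes "\<And>x y. x \<in> A \<Longrightarrow> y \<in> A \<Longrightarrow> d x y \<le> r"
  shows "set_diam d A \<ge> 0"
proof (cases "A = {}")
  case False
  then obtain x where "x \<in> A" by blast
  then have "d x x \<le> set_diam d A" using assms by (intro dist_le_set_diam[of x A x r]) blast+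
  then show ?thesis using nonneg[of x x] by linarith
qed simp

lemma hausdorff_content_empty [simp]: "hausdorff_content s r {} = 0"
proof -
  have "hausdorff_content s r {} \<le> (\<Sum>i::nat. ennreal (set_diam d {} powr s))"
    by (rule hausdorff_content_le) auto
  then show ?thesis by simp
qed

lemma hausdorff_content_mono: "A \<subseteq> B \<Longrightarrow> hausdorff_content s r A \<le> hausdorff_content s r B"
  unfolding hausdorff_content_def by (rule INF_superset_mono) auto

lemma hausdorff_content_antimono: "r \<le> r' \<Longrightarrow> hausdorff_content s r' A \<le> hausdorff_content s r A"
  unfolding hausdorff_content_def by (rule INF_superset_mono) (force intro: order_trans)+

lemma hausdorff_content_countably_subadditive:
  fixes A :: "nat \<Rightarrow> 'a set"
  shows "hausdorff_content s r (\<Union>n. A n) \<le> (\<Sum>n. hausdorff_content s r (A n))"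
proof (rule ennreal_le_epsilon, unfold infinity_ennreal_def[symmetric])
  fix e :: real assume fin: "(\<Sum>n. hausdorff_content s r (A n)) < \<infinity>" and e: "0 < e"
  have *: "hausdorff_content s r (A n) < hausdorff_content s r (A n) + e * (1/2) ^ Suc n" for n
    using e fin by (auto simp add: less_top dest!: ennreal_suminf_lessD)
  have "\<exists>U :: nat \<Rightarrow> 'a set. A n \<subseteq> (\<Union>i. U i) \<and> (\<forall>i. U i \<subseteq> M) \<and> (\<forall>i. \<forall>x\<in>U i. \<forall>y\<in>U i. d x y \<le> r) \<and>
    (\<Sum>i. ennreal (set_diam d (U i) powr s)) \<le> hausdorff_content s r (A n) + e * (1/2) ^ Suc n" for n
    using hausdorff_content_lessE[OF *[of n]] by (metis less_imp_le)
  then obtain U :: "nat \<Rightarrow> nat \<Rightarrow> 'a set" where U: "\<And>n. A n \<subseteq> (\<Union>i. U n i)" "\<And>n i. U n i \<subseteq> M"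
    "\<And>n i x y. x \<in> U n i \<Longrightarrow> y \<in> U n i \<Longrightarrow> d x y \<le> r"
    "\<And>n. (\<Sum>i. ennreal (set_diam d (U n i) powr s)) \<le> hausdorff_content s r (A n) + e * (1/2) ^ Suc n"
    by metis
  define V where "V = case_prod U \<circ> prod_decode"
  have "(\<Union>n. A n) \<subseteq> (\<Union>i. V i)"
    using U(1) by (auto simp add: V_def subset_eq) (metis prod.case prod_encode_inverse)
  then have "hausdorff_content s r (\<Union>n. A n) \<le> (\<Sum>i. ennreal (set_diam d (V i) powr s))"
    by (rule hausdorff_content_le) (use U in \<open>auto simp: V_def split_def\<close>)
  also have "\<dots> = (\<Sum>n. \<Sum>i. ennreal (set_diam d (U n i) powr s))"
    unfolding V_def comp_def
    by (rule suminf_ennreal_2dimen[where f = "\<lambda>p. ennreal (set_diam d (case_prod U p) powr s)"]) simp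
  also have "\<dots> \<le> (\<Sum>n. hausdorff_content s r (A n) + e * (1/2) ^ Suc n)"
    by (intro suminf_le allI U(4)) auto
  also have "\<dots> = (\<Sum>n. hausdorff_content s r (A n)) + (\<Sum>n. ennreal e * ennreal ((1/2) ^ Suc n))"
    using e by (subst suminf_add[symmetric])
      (auto simp del: ennreal_suminf_cmult simp add: ennreal_mult[symmetric])
  also have "\<dots> = (\<Sum>n. hausdorff_content s r (A n)) + e"
    unfolding ennreal_suminf_cmult
    by (subst suminf_ennreal_eq[OF zero_le_power power_half_series]) auto
  finally show "hausdorff_content s r (\<Union>n. A n) \<le> (\<Sum>n. hausdorff_content s r (A n)) + ennreal e" .
qed

lemma hausdorff_content_le_outer: "r > 0 \<Longrightarrow> hausdorff_content s r A \<le> hausdorff_outer M d s A"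
  unfolding hausdorff_outer_content by (rule SUP_upper) simp

lemma hausdorff_outer_mono: "A \<subseteq> B \<Longrightarrow> hausdorff_outer M d s A \<le> hausdorff_outer M d s B"
  unfolding hausdorff_outer_content by (intro SUP_mono) (auto intro: hausdorff_content_mono)

lemma hausdorff_outer_countably_subadditive:
  fixes A :: "nat \<Rightarrow> 'a set"
  shows "hausdorff_outer M d s (\<Union>n. A n) \<le> (\<Sum>n. hausdorff_outer M d s (A n))"
  unfolding hausdorff_outer_content[of s "\<Union>n. A n"]
proof (rule SUP_least)
  fix r :: real assume "r \<in> {0<..}"
  then show "hausdorff_content s r (\<Union>n. A n) \<le> (\<Sum>n. hausdorff_outer M d s (A n))"
    by (intro order_trans[OF hausdorff_content_countably_subadditive] suminf_le hausdorff_content_le_outer) auto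
qed

text \<open>
  A set of diameter below the gap \<open>t\<close> meets at most one of \<open>A\<close> and \<open>B\<close>, so a fine cover of the union
  splits into covers of the two parts.
\<close>

lemma hausdorff_outer_separated:
  assumes "t > 0" and sep: "\<And>x y. x \<in> A \<Longrightarrow> y \<in> B \<Longrightarrow> t \<le> d x y"
  shows "hausdorff_outer M d s A + hausdorff_outer M d s B \<le> hausdorff_outer M d s (A \<union> B)"
proof -
  have "hausdorff_content s r A + hausdorff_content s r B \<le> hausdorff_outer M d s (A \<union> B)"
    if r: "0 < r" "r < t" for r
  proof -
    have "hausdorff_content s r A + hausdorff_content s r B \<le> hausdorff_content s r (A \<union> B)"
    proof (rule le_hausdorff_content)
      fix U :: "nat \<Rightarrow> 'a set"
      assume U: "A \<union> B \<subseteq> (\<Union>i. U i)" "\<And>i. U i \<subseteq> M" "\<And>i x y. x \<in> U i \<Longrightarrow> y \<in> U i \<Longrightarrow> d x y \<le> r"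
      define V where "V C i = (if U i \<inter> C = {} then {} else U i)" for C i
      have V: "hausdorff_content s r C \<le> (\<Sum>i. ennreal (set_diam d (V C i) powr s))" if "C \<subseteq> A \<union> B" for C
      proof (rule hausdorff_content_le)
        show "C \<subseteq> (\<Union>i. V C i)"
        proof
          fix x assume x: "x \<in> C"
          then obtain i where "x \<in> U i" using U(1) \<open>C \<subseteq> A \<union> B\<close> by blast
          then have "x \<in> V C i" using x by (auto simp: V_def)
          then show "x \<in> (\<Union>i. V C i)" by blast
        qed
      qed (use U in \<open>auto simp: V_def split: if_splits\<close>)
      have "U i \<inter> A = {} \<or> U i \<inter> B = {}" for i
        using U(3)[of _ i] sep r by (meson disjoint_iff leD order_le_less_trans)
      then have le: "ennreal (set_diam d (V A i) powr s) + ennreal (set_diam d (V B i) powr s)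
          \<le> ennreal (set_diam d (U i) powr s)" for i
        by (auto simp: V_def)
      have "hausdorff_content s r A + hausdorff_content s r B \<le>
          (\<Sum>i. ennreal (set_diam d (V A i) powr s)) + (\<Sum>i. ennreal (set_diam d (V B i) powr s))"
        by (intro add_mono V) auto
      also have "\<dots> = (\<Sum>i. ennreal (set_diam d (V A i) powr s) + ennreal (set_diam d (V B i) powr s))"
        by (intro suminf_add summableI)
      also have "\<dots> \<le> (\<Sum>i. ennreal (set_diam d (U i) powr s))"
        using le by (intro suminf_le summableI)
      finally show "hausdorff_content s r A + hausdorff_content s r B \<le> (\<Sum>i. ennreal (set_diam d (U i) powr s))" .
    qed
    then show ?thesis using hausdorff_content_le_outer[OF r(1)] by (rule order_trans)
  qed
  note small = this
  have outer: "hausdorff_outer M d s C = (SUP r\<in>{0<..<t}. hausdorff_content s r C)" for C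
    unfolding hausdorff_outer_content
  proof (rule SUP_eq)
    fix r :: real assume r: "r \<in> {0<..}"
    have "hausdorff_content s r C \<le> hausdorff_content s (min r (t / 2)) C"
      by (rule hausdorff_content_antimono) simp
    moreover have "min r (t / 2) \<in> {0<..<t}" using r \<open>t > 0\<close> by auto
    ultimately show "\<exists>r'\<in>{0<..<t}. hausdorff_content s r C \<le> hausdorff_content s r' C" by blast
  qed auto
  have "(SUP r\<in>{0<..<t}. hausdorff_content s r A) + (SUP r\<in>{0<..<t}. hausdorff_content s r B) =
      (SUP r\<in>{0<..<t}. hausdorff_content s r A + hausdorff_content s r B)"
  proof (rule SUP_add_directed_ennreal[symmetric])
    fix r r' assume "r \<in> {0<..<t}" "r' \<in> {0<..<t}"
    then show "\<exists>k\<in>{0<..<t}. hausdorff_content s r A + hausdorff_content s r' B \<le>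
        hausdorff_content s k A + hausdorff_content s k B"
      by (intro bexI[of _ "min r r'"] add_mono hausdorff_content_antimono) auto
  qed
  also have "\<dots> \<le> hausdorff_outer M d s (A \<union> B)" by (rule SUP_least) (use small in auto)
  finally show ?thesis by (simp add: outer)
qed

lemma space_hausdorff_measure [simp]: "space (hausdorff_measure M d s) = M"
  unfolding hausdorff_measure_def
  by (rule space_measure_of) (auto simp: openin_mtopology)

lemma sets_hausdorff_measure: "sets (hausdorff_measure M d s) = sigma_sets M {U. openin mtopology U}"
  unfolding hausdorff_measure_def
  by (rule sets_measure_of) (auto simp: openin_mtopology)

text \<open>
  Since \<open>measure_of\<close> yields the zero measure when it is given a set function that is not a measure, it
  is Caratheodory's criterion that ties the Hausdorff measure to the outer measure.
\<close>

theorem emeasure_hausdorff_measure: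
  assumes "A \<in> sets (hausdorff_measure M d s)"
  shows "emeasure (hausdorff_measure M d s) A = hausdorff_outer M d s A"
proof -
  let ?f = "hausdorff_outer M d s"
  have "outer_measure_space (Pow M) ?f"
    unfolding outer_measure_space_def positive_def increasing_def countably_subadditive_def
    by (auto simp: hausdorff_outer_content[of s "{}"] intro: hausdorff_outer_mono
        hausdorff_outer_countably_subadditive)
  then have ms: "measure_space M (lambda_system M (Pow M) ?f) ?f"
    by (rule sigma_algebra.caratheodory_lemma[OF sigma_algebra_Pow])
  then have sa: "sigma_algebra M (lambda_system M (Pow M) ?f)" by (simp add: measure_space_def)
  have "{U. openin mtopology U} \<subseteq> lambda_system M (Pow M) ?f"
    by (auto intro!: metric_outer_measure_lambda_system hausdorff_outer_mono
        hausdorff_outer_countably_subadditive hausdorff_outer_separated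
        simp: hausdorff_outer_content[of s "{}"])
  then have sub: "sigma_sets M {U. openin mtopology U} \<subseteq> lambda_system M (Pow M) ?f"
    by (rule sigma_algebra.sigma_sets_subset[OF sa])
  have "measure_space M (sigma_sets M {U. openin mtopology U}) ?f"
    by (rule measure_down[OF ms _ sub], rule sigma_algebra_sigma_sets) (auto simp: openin_mtopology)
  then have "countably_additive (sets (hausdorff_measure M d s)) ?f"
    "positive (sets (hausdorff_measure M d s)) ?f"
    by (simp_all add: measure_space_def sets_hausdorff_measure)
  then show ?thesis
    using assms by (intro emeasure_measure_of[OF hausdorff_measure_def]) (auto simp: openin_mtopology)
qed

lemma hausdorff_outer_Lipschitz_image:
  assumes A: "A \<subseteq> M" and f: "\<And>x. x \<in> A \<Longrightarrow> f x \<in> M" and L: "L > 0"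
    and lip: "\<And>x y. x \<in> A \<Longrightarrow> y \<in> A \<Longrightarrow> d (f x) (f y) \<le> L * d x y" and s: "s > 0"
  shows "hausdorff_outer M d s (f ` A) \<le> ennreal (L powr s) * hausdorff_outer M d s A"
  unfolding hausdorff_outer_content[of s "f ` A"]
proof (rule SUP_least)
  fix r :: real assume "r \<in> {0<..}"
  then have r: "r > 0" by simp
  have "hausdorff_content s r (f ` A) \<le> ennreal (L powr s) * hausdorff_content s (r / L) A"
  proof -
    let ?c = "ennreal (L powr s)"
    have c: "?c > 0" "?c < \<infinity>" using L by auto
    have "hausdorff_content s r (f ` A) / ?c \<le> hausdorff_content s (r / L) A"
    proof (rule le_hausdorff_content)
      fix U :: "nat \<Rightarrow> 'a set"
      assume U: "A \<subseteq> (\<Union>i. U i)" "\<And>i. U i \<subseteq> M" "\<And>i x y. x \<in> U i \<Longrightarrow> y \<in> U i \<Longrightarrow> d x y \<le> r / L"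
      have dl: "d (f x) (f y) \<le> L * set_diam d (U i)" if "x \<in> U i \<inter> A" "y \<in> U i \<inter> A" for x y i
      proof -
        have "d x y \<le> set_diam d (U i)" by (rule dist_le_set_diam[of _ _ _ "r / L"]) (use that U in auto)
        then have "L * d x y \<le> L * set_diam d (U i)" using L by simp
        then show ?thesis using lip[of x y] that by auto
      qed
      have sd: "set_diam d (U i) \<le> r / L" "set_diam d (U i) \<ge> 0" for i
        using set_diam_le[of "r / L" "U i"] set_diam_nonneg[of "U i"] U(3) r L by auto
      have "hausdorff_content s r (f ` A) \<le> (\<Sum>i. ennreal (set_diam d (f ` (U i \<inter> A)) powr s))"
      proof (rule hausdorff_content_le)
        show "f ` A \<subseteq> (\<Union>i. f ` (U i \<inter> A))" using U(1) by blast
        show "f ` (U i \<inter> A) \<subseteq> M" for i using f by auto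
        fix i x y assume "x \<in> f ` (U i \<inter> A)" "y \<in> f ` (U i \<inter> A)"
        then have "d x y \<le> L * set_diam d (U i)" using dl by blast
        also have "\<dots> \<le> L * (r / L)" using sd L by (intro mult_left_mono) auto
        finally show "d x y \<le> r" using L by simp
      qed
      also have "\<dots> \<le> (\<Sum>i. ennreal (L powr s) * ennreal (set_diam d (U i) powr s))"
      proof (intro suminf_le summableI)
        fix i
        have *: "set_diam d (f ` (U i \<inter> A)) \<le> L * set_diam d (U i)"
          by (rule set_diam_le) (use dl sd L in auto)
        have "set_diam d (f ` (U i \<inter> A)) \<ge> 0"
          by (rule set_diam_nonneg[of _ "L * set_diam d (U i)"]) (use dl in auto)
        then have "set_diam d (f ` (U i \<inter> A)) powr s \<le> (L * set_diam d (U i)) powr s"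
          using * s by (intro powr_mono2) auto
        also have "\<dots> = L powr s * set_diam d (U i) powr s" using L sd by (simp add: powr_mult)
        finally have "ennreal (set_diam d (f ` (U i \<inter> A)) powr s) \<le> ennreal (L powr s * set_diam d (U i) powr s)"
          by (rule ennreal_leI)
        also have "\<dots> = ennreal (L powr s) * ennreal (set_diam d (U i) powr s)"
          by (rule ennreal_mult) auto
        finally show "ennreal (set_diam d (f ` (U i \<inter> A)) powr s) \<le> ennreal (L powr s) * ennreal (set_diam d (U i) powr s)" .
      qed
      also have "\<dots> = ennreal (L powr s) * (\<Sum>i. ennreal (set_diam d (U i) powr s))" by (rule ennreal_suminf_cmult)
      finally have *: "hausdorff_content s r (f ` A) \<le> ?c * (\<Sum>i. ennreal (set_diam d (U i) powr s))" .
      show "hausdorff_content s r (f ` A) / ?c \<le> (\<Sum>i. ennreal (set_diam d (U i) powr s))"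
        by (rule divide_le_posI_ennreal[OF c(1) *])
    qed
    then have "hausdorff_content s r (f ` A) / ?c * ?c \<le> hausdorff_content s (r / L) A * ?c"
      by (rule mult_right_mono) simp
    moreover have "hausdorff_content s r (f ` A) / ?c * ?c = hausdorff_content s r (f ` A)"
      using c unfolding ennreal_divide_times by (simp add: less_top)
    ultimately show ?thesis by (simp add: mult.commute)
  qed
  also have "\<dots> \<le> ennreal (L powr s) * hausdorff_outer M d s A"
    using r L by (intro mult_left_mono hausdorff_content_le_outer) auto
  finally show "hausdorff_content s r (f ` A) \<le> ennreal (L powr s) * hausdorff_outer M d s A" .
qed

lemma hausdorff_content_finite_cover:
  assumes Z: "finite Z" and cover: "A \<subseteq> (\<Union>z\<in>Z. B z)" and B: "\<And>z. z \<in> Z \<Longrightarrow> B z \<subseteq> M"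
    and t: "\<And>z x y. z \<in> Z \<Longrightarrow> x \<in> B z \<Longrightarrow> y \<in> B z \<Longrightarrow> d x y \<le> t" and tr: "0 \<le> t" "t \<le> r" and s: "s > 0"
  shows "hausdorff_content s r A \<le> ennreal (real (card Z) * t powr s)"
proof -
  obtain e where e: "bij_betw e {..<card Z} Z"
    using ex_bij_betw_nat_finite[OF Z] by (auto simp: atLeast0LessThan)
  define U where "U i = (if i < card Z then B (e i) else {})" for i
  have eZ: "e i \<in> Z" if "i < card Z" for i using e that by (auto simp: bij_betw_def)
  have "hausdorff_content s r A \<le> (\<Sum>i. ennreal (set_diam d (U i) powr s))"
  proof (rule hausdorff_content_le)
    show "A \<subseteq> (\<Union>i. U i)"
    proof
      fix x assume "x \<in> A"
      then obtain z where z: "z \<in> Z" "x \<in> B z" using cover by blast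
      then have "z \<in> e ` {..<card Z}" using e by (simp add: bij_betw_def)
      then obtain i where "i < card Z" "e i = z" by blast
      then have "x \<in> U i" using z by (simp add: U_def)
      then show "x \<in> (\<Union>i. U i)" by blast
    qed
    show "U i \<subseteq> M" for i using B eZ by (auto simp: U_def)
    show "d x y \<le> r" if "x \<in> U i" "y \<in> U i" for i x y
      using that t[OF eZ] tr by (force simp: U_def split: if_splits)
  qed
  also have "\<dots> = (\<Sum>i<card Z. ennreal (set_diam d (U i) powr s))"
    by (rule suminf_finite) (auto simp: U_def)
  also have "\<dots> \<le> (\<Sum>i<card Z. ennreal (t powr s))"
  proof (rule sum_mono)
    fix i assume i: "i \<in> {..<card Z}"
    have "set_diam d (U i) \<le> t" "set_diam d (U i) \<ge> 0"
      using i t[OF eZ] tr by (auto simp: U_def intro!: set_diam_le set_diam_nonneg[of _ t])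
    then show "ennreal (set_diam d (U i) powr s) \<le> ennreal (t powr s)"
      using s by (intro ennreal_leI powr_mono2) auto
  qed
  also have "\<dots> = ennreal (real (card Z) * t powr s)"
    by (simp add: ennreal_mult ennreal_of_nat_eq_real_of_nat)
  finally show ?thesis .
qed

end

section \<open>Orbits in roughly geodesic hyperbolic spaces\<close>

lemma gprod_commute: "gprod p x y = gprod p y x"
  by (simp add: gromov_product_def dist_commute)

lemma gprod_nonneg: "gprod p x y \<ge> 0"
  using dist_triangle2[of x y p] by (simp add: gromov_product_def)

lemma gprod_le_dist: "gprod p x y \<le> dist p x"
  using dist_triangle[of y p x] by (simp add: gromov_product_def dist_commute)

lemma gprod_le_dist': "gprod p x y \<le> dist p y"
  using gprod_le_dist[of p y x] by (simp add: gprod_commute)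

lemma dist_eq_gprod: "dist x y = dist p x + dist p y - 2 * gprod p x y"
  by (simp add: gromov_product_def dist_commute field_simps)

lemma gprod_add_gprod: "gprod p x y + gprod x p y = dist p x"
  by (simp add: gromov_product_def dist_commute field_simps)

text \<open>
  The two products differ by a constant and by functions of one variable. This separation of variables
  is the reason why isometries act conformally on the boundary.
\<close>

lemma gprod_change_base: "gprod q x y = gprod p x y + dist p q - gprod p x q - gprod p y q"
  by (simp add: gromov_product_def dist_commute field_simps)

locale geometric_hyperbolic_action = group G for G :: "('g, 'm) monoid_scheme" (structure) +
  fixes \<phi> :: "'g \<Rightarrow> 'a::metric_space \<Rightarrow> 'a" and x0 :: 'a and \<delta> :: real
  assumes proper: "\<And>(x::'a) r. compact (cball x r)"
    and delta_nonneg: "\<delta> \<ge> 0"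
    and hyperbolic: "gromov_hyperbolic_at (UNIV :: 'a set) dist x0 \<delta>"
    and rough: "roughly_geodesic TYPE('a)"
    and action: "group_action G (UNIV :: 'a set) \<phi>"
    and isometric: "\<And>g x y. g \<in> carrier G \<Longrightarrow> dist (\<phi> g x) (\<phi> g y) = dist x y"
    and discontinuous: "properly_discontinuous G \<phi>"
    and cocompact: "cocompact G \<phi>"
begin

lemma act_mult: "g \<in> carrier G \<Longrightarrow> h \<in> carrier G \<Longrightarrow> \<phi> (g \<otimes> h) x = \<phi> g (\<phi> h x)"
  using group_action.composition_rule[OF action] by simp

lemma act_one [simp]: "\<phi> \<one> x = x"
  using group_action.id_eq_one[OF action] by (metis UNIV_I restrict_apply')

lemma act_inv_cancel [simp]:
  "g \<in> carrier G \<Longrightarrow> \<phi> (inv g) (\<phi> g x) = x" "g \<in> carrier G \<Longrightarrow> \<phi> g (\<phi> (inv g) x) = x"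
  using act_mult[of "inv g" g x] act_mult[of g "inv g" x] by simp_all

lemma inv_mult_cancel: "g \<in> carrier G \<Longrightarrow> h \<in> carrier G \<Longrightarrow> inv g \<otimes> (g \<otimes> h) = h"
  by (simp add: m_assoc[symmetric])

abbreviation pt :: "'g \<Rightarrow> 'a" where "pt g \<equiv> \<phi> g x0"

definition len :: "'g \<Rightarrow> real" where "len g = dist x0 (pt g)"

definition ball_G :: "real \<Rightarrow> 'g set" where "ball_G r = {g \<in> carrier G. len g \<le> r}"

definition growth :: "real \<Rightarrow> real" where "growth r = real (card (ball_G r))"

lemma len_nonneg [simp]: "len g \<ge> 0" by (simp add: len_def)

lemma len_one [simp]: "len \<one> = 0" by (simp add: len_def)

lemma dist_act: "g \<in> carrier G \<Longrightarrow> dist (\<phi> g x) y = dist x (\<phi> (inv g) y)"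
  using isometric[of g x "\<phi> (inv g) y"] by simp

lemma dist_pt: "g \<in> carrier G \<Longrightarrow> h \<in> carrier G \<Longrightarrow> dist (pt g) (pt h) = len (inv g \<otimes> h)"
  by (simp add: len_def act_mult dist_act)

lemma len_inv [simp]: "g \<in> carrier G \<Longrightarrow> len (inv g) = len g"
  using dist_act[of "inv g" x0 x0] by (simp add: len_def dist_commute)

lemma len_mult_le: "g \<in> carrier G \<Longrightarrow> h \<in> carrier G \<Longrightarrow> len (g \<otimes> h) \<le> len g + len h"
  using dist_triangle[of x0 "pt (g \<otimes> h)" "pt g"] by (simp add: len_def act_mult isometric)

lemma gprod_act:
  "g \<in> carrier G \<Longrightarrow> gprod (\<phi> g p) (\<phi> g x) (\<phi> g y) = gprod p x y"
  by (simp add: gromov_product_def isometric)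

lemma hyp: "min (gprod x0 x z) (gprod x0 z y) - \<delta> \<le> gprod x0 x y"
  using hyperbolic by (auto simp: gromov_hyperbolic_at_def)

lemma hyp_ge: "gprod x0 x z \<ge> r \<Longrightarrow> gprod x0 z y \<ge> r \<Longrightarrow> gprod x0 x y \<ge> r - \<delta>"
  using hyp[of x z y] by linarith

text \<open>Orbit points see the same hyperbolicity constant as the basepoint.\<close>

lemma hyp_pt:
  assumes g: "g \<in> carrier G"
  shows "min (gprod (pt g) x z) (gprod (pt g) z y) - \<delta> \<le> gprod (pt g) x y"
  using hyp[of "\<phi> (inv g) x" "\<phi> (inv g) z" "\<phi> (inv g) y"]
    gprod_act[of "inv g" "pt g" x y] gprod_act[of "inv g" "pt g" x z] gprod_act[of "inv g" "pt g" z y] g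
  by simp

lemma finite_ball_G [simp]: "finite (ball_G r)"
proof -
  have "ball_G r \<subseteq> {g \<in> carrier G. \<phi> g ` cball x0 r \<inter> cball x0 r \<noteq> {}}"
  proof
    fix g assume "g \<in> ball_G r"
    then have "g \<in> carrier G" "dist x0 (pt g) \<le> r" by (auto simp: ball_G_def len_def)
    moreover have "0 \<le> r" using \<open>dist x0 (pt g) \<le> r\<close> zero_le_dist[of x0 "pt g"] by linarith
    ultimately have "pt g \<in> \<phi> g ` cball x0 r \<inter> cball x0 r" by auto
    then show "g \<in> {g \<in> carrier G. \<phi> g ` cball x0 r \<inter> cball x0 r \<noteq> {}}"
      using \<open>g \<in> carrier G\<close> by blast
  qed
  then show ?thesis
    using discontinuous proper[of x0 r] unfolding properly_discontinuous_def
    by (meson finite_subset)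
qed

lemma ball_G_mono: "r \<le> s \<Longrightarrow> ball_G r \<subseteq> ball_G s" by (auto simp: ball_G_def)

lemma growth_mono: "r \<le> s \<Longrightarrow> growth r \<le> growth s"
  unfolding growth_def by (simp add: card_mono ball_G_mono)

lemma one_in_ball_G: "r \<ge> 0 \<Longrightarrow> \<one> \<in> ball_G r" by (simp add: ball_G_def)

lemma growth_ge_1: "r \<ge> 0 \<Longrightarrow> growth r \<ge> 1"
  unfolding growth_def using one_in_ball_G[of r] finite_ball_G[of r]
  by (metis One_nat_def Suc_leI card_gt_0_iff empty_iff of_nat_1 of_nat_mono)

lemma growth_nonneg [simp]: "growth r \<ge> 0" by (simp add: growth_def)

text \<open>
  The orbit is coarsely dense, so a rough geodesic can be replaced by a chain of orbit points.
  The constant is taken to be at least one so that annuli of this width at integer radii cover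
  the group.
\<close>

lemma ex_rough_constant:
  "\<exists>c\<ge>1. \<forall>x y t. 0 \<le> t \<longrightarrow> t \<le> dist x y \<longrightarrow>
     (\<exists>g\<in>carrier G. \<bar>dist x (pt g) - t\<bar> \<le> c \<and> \<bar>dist (pt g) y - (dist x y - t)\<bar> \<le> c)"
proof -
  obtain C where C: "C > 0" "\<And>x y :: 'a. \<exists>a b :: real. \<exists>r :: real \<Rightarrow> 'a.
        a \<le> b \<and> r a = x \<and> r b = y \<and>
        (\<forall>s\<in>{a..b}. \<forall>t\<in>{a..b}. \<bar>t - s\<bar> - C \<le> dist (r t) (r s) \<and> dist (r t) (r s) \<le> \<bar>t - s\<bar> + C)"
    using rough unfolding roughly_geodesic_def by blast
  obtain K where K: "compact K" "(\<Union>g\<in>carrier G. \<phi> g ` K) = UNIV"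
    using cocompact unfolding cocompact_def by blast
  obtain B where B: "\<And>y. y \<in> K \<Longrightarrow> dist x0 y \<le> B"
    using compact_imp_bounded[OF K(1)] bounded_any_center[of K x0] by blast
  have near: "\<exists>g\<in>carrier G. dist (pt g) z \<le> B" for z
  proof -
    have "z \<in> (\<Union>g\<in>carrier G. \<phi> g ` K)" using K(2) by simp
    then obtain g y where g: "g \<in> carrier G" "y \<in> K" "z = \<phi> g y" by blast
    then show ?thesis using B[of y] isometric[of g x0 y] by (intro bexI[of _ g]) auto
  qed
  have "\<exists>g\<in>carrier G. \<bar>dist x (pt g) - t\<bar> \<le> 3 * C + \<bar>B\<bar> + 1 \<and>
      \<bar>dist (pt g) y - (dist x y - t)\<bar> \<le> 3 * C + \<bar>B\<bar> + 1"
    if t: "0 \<le> t" "t \<le> dist x y" for x y :: 'a and t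
  proof -
    obtain a b r where r: "a \<le> b" "r a = x" "r b = y"
      "\<And>s t. s\<in>{a..b} \<Longrightarrow> t\<in>{a..b} \<Longrightarrow> \<bar>t - s\<bar> - C \<le> dist (r t) (r s) \<and> dist (r t) (r s) \<le> \<bar>t - s\<bar> + C"
      using C(2)[of x y] by blast
    define u where "u = a + min t (b - a)"
    have u: "u \<in> {a..b}" using t r(1) by (auto simp: u_def)
    have ab: "b - a - C \<le> dist x y" "dist x y \<le> b - a + C"
      using r(4)[of a b] r(1-3) by (auto simp: dist_commute)
    have 1: "u - a - C \<le> dist x (r u)" "dist x (r u) \<le> u - a + C"
      using r(4)[of a u] u r(1,2) by (auto simp: dist_commute)
    have 2: "b - u - C \<le> dist (r u) y" "dist (r u) y \<le> b - u + C"
      using r(4)[of b u] u r(1,3) by (auto simp: dist_commute)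
    obtain g where g: "g \<in> carrier G" "dist (pt g) (r u) \<le> B" using near by blast
    have 3: "dist x (pt g) \<le> dist x (r u) + B" "dist x (r u) \<le> dist x (pt g) + B"
      using dist_triangle[of x "pt g" "r u"] dist_triangle[of x "r u" "pt g"] g
      by (simp_all add: dist_commute)
    have 4: "dist (pt g) y \<le> dist (r u) y + B" "dist (r u) y \<le> dist (pt g) y + B"
      using dist_triangle[of "pt g" y "r u"] dist_triangle[of "r u" y "pt g"] g
      by (simp_all add: dist_commute)
    have u': "u - a \<le> t" "t - C \<le> u - a"
      using t ab r(1) C(1) by (auto simp: u_def min_def)
    show ?thesis
      using g(1) by (rule bexI[rotated]) (use 1 2 3 4 u' ab C(1) in linarith)
  qed
  then show ?thesis using C(1) by (intro exI[of _ "3 * C + \<bar>B\<bar> + 1"]) auto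
qed

definition rc :: real where
  "rc = (SOME c. c \<ge> 1 \<and> (\<forall>x y t. 0 \<le> t \<longrightarrow> t \<le> dist x y \<longrightarrow>
     (\<exists>g\<in>carrier G. \<bar>dist x (pt g) - t\<bar> \<le> c \<and> \<bar>dist (pt g) y - (dist x y - t)\<bar> \<le> c)))"

lemma rc_ge_1: "rc \<ge> 1" and rc:
  "0 \<le> t \<Longrightarrow> t \<le> dist x y \<Longrightarrow>
     \<exists>g\<in>carrier G. \<bar>dist x (pt g) - t\<bar> \<le> rc \<and> \<bar>dist (pt g) y - (dist x y - t)\<bar> \<le> rc"
  using someI_ex[OF ex_rough_constant] unfolding rc_def[symmetric] by blast+

lemma between:
  assumes "0 \<le> t" "t \<le> dist x0 y"
  obtains g where "g \<in> carrier G" "\<bar>len g - t\<bar> \<le> rc" "\<bar>dist (pt g) y - (dist x0 y - t)\<bar> \<le> rc"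
    "gprod x0 (pt g) y \<ge> t - rc"
proof -
  obtain g where g: "g \<in> carrier G" "\<bar>len g - t\<bar> \<le> rc" "\<bar>dist (pt g) y - (dist x0 y - t)\<bar> \<le> rc"
    using rc[OF assms] by (auto simp: len_def)
  moreover have "gprod x0 (pt g) y \<ge> t - rc"
    using g by (simp add: gromov_product_def len_def dist_commute field_simps)
  ultimately show ?thesis using that by blast
qed

lemma between_G:
  assumes "k \<in> carrier G" "0 \<le> t" "t \<le> len k"
  obtains g h where "g \<in> carrier G" "h \<in> carrier G" "k = g \<otimes> h"
    "\<bar>len g - t\<bar> \<le> rc" "\<bar>len h - (len k - t)\<bar> \<le> rc"
proof -
  obtain g where g: "g \<in> carrier G" "\<bar>len g - t\<bar> \<le> rc" "\<bar>dist (pt g) (pt k) - (len k - t)\<bar> \<le> rc"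
    using between[of t "pt k"] assms by (metis len_def)
  show ?thesis
    by (rule that[of g "inv g \<otimes> k"]) (use g assms dist_pt[of g k] in \<open>auto simp: inv_solve_left m_assoc[symmetric]\<close>)
qed

text \<open>
  Cut a rough geodesic from \<open>x0\<close> to \<open>k x0\<close> at distance \<open>m\<close>.
\<close>

lemma growth_submult:
  assumes "m \<ge> 0" "n \<ge> 0"
  shows "growth (m + n) \<le> growth (m + rc) * growth (n + rc)"
proof -
  have "ball_G (m + n) \<subseteq> (\<lambda>(g, h). g \<otimes> h) ` (ball_G (m + rc) \<times> ball_G (n + rc))"
  proof
    fix k assume k: "k \<in> ball_G (m + n)"
    obtain g h where gh: "g \<in> carrier G" "h \<in> carrier G" "k = g \<otimes> h"
      "\<bar>len g - min m (len k)\<bar> \<le> rc" "\<bar>len h - (len k - min m (len k))\<bar> \<le> rc"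
      using between_G[of k "min m (len k)"] k assms by (auto simp: ball_G_def)
    then have "(g, h) \<in> ball_G (m + rc) \<times> ball_G (n + rc)"
      using k assms by (auto simp: ball_G_def min_def split: if_splits)
    then show "k \<in> (\<lambda>(g, h). g \<otimes> h) ` (ball_G (m + rc) \<times> ball_G (n + rc))"
      using gh(3) by force
  qed
  then have "card (ball_G (m + n)) \<le> card (ball_G (m + rc) \<times> ball_G (n + rc))"
    by (intro order_trans[OF card_mono card_image_le]) auto
  then show ?thesis unfolding growth_def by (simp add: card_cartesian_product flip: of_nat_mult)
qed

text \<open>
  If \<open>g0\<close> is one of the elements, then \<open>(g0 k)\<^sup>-\<^sup>1 g k\<close> is short for all the others.
\<close>

lemma card_near_le:
  assumes "k \<in> carrier G"
  shows "finite {g \<in> carrier G. dist (\<phi> g (pt k)) y \<le> C}"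
    and "real (card {g \<in> carrier G. dist (\<phi> g (pt k)) y \<le> C}) \<le> growth (2 * C)"
proof -
  let ?S = "{g \<in> carrier G. dist (\<phi> g (pt k)) y \<le> C}"
  have "finite ?S \<and> real (card ?S) \<le> growth (2 * C)"
  proof (cases "?S = {}")
    case False
    then obtain g0 where g0: "g0 \<in> carrier G" "dist (\<phi> g0 (pt k)) y \<le> C" by blast
    let ?f = "\<lambda>g. inv (g0 \<otimes> k) \<otimes> (g \<otimes> k)"
    have sub: "?f ` ?S \<subseteq> ball_G (2 * C)"
    proof clarify
      fix g assume g: "g \<in> carrier G" "dist (\<phi> g (pt k)) y \<le> C"
      have "len (?f g) = dist (\<phi> g0 (pt k)) (\<phi> g (pt k))"
        using g g0 assms dist_pt[of "g0 \<otimes> k" "g \<otimes> k"] by (simp add: act_mult)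
      also have "\<dots> \<le> 2 * C"
        using dist_triangle[of "\<phi> g0 (pt k)" "\<phi> g (pt k)" y] g g0 by (simp add: dist_commute)
      finally show "?f g \<in> ball_G (2 * C)" using g g0 assms by (simp add: ball_G_def)
    qed
    have inj: "inj_on ?f ?S"
      using g0 assms by (intro inj_onI) (simp add: inv_mult_group)
    have "finite ?S" using finite_imageD[OF finite_subset[OF sub finite_ball_G] inj] .
    moreover have "card ?S \<le> card (ball_G (2 * C))"
      using card_inj_on_le[OF inj sub finite_ball_G] .
    ultimately show ?thesis by (simp add: growth_def)
  next
    case True
    then show ?thesis by (simp only: True) simp
  qed
  then show "finite ?S" "real (card ?S) \<le> growth (2 * C)" by blast+
qed

lemma card_near_pt_le:
  "finite {g \<in> carrier G. dist (pt g) y \<le> C}"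
  "real (card {g \<in> carrier G. dist (pt g) y \<le> C}) \<le> growth (2 * C)"
  using card_near_le[of \<one> y C] by auto

end

section \<open>The exponential lower bound for the growth\<close>

lemma exp_beats_linear:
  fixes a b q :: real
  assumes "q > 0"
  shows "filterlim (\<lambda>r. exp (q * (r - a)) / (2 * r + b)) at_top at_top"
  using assms by real_asymp

context geometric_hyperbolic_action
begin

definition orbit_growth :: "real \<Rightarrow> nat" where
  "orbit_growth r = card (orbit G \<phi> x0 \<inter> ball x0 r)"

lemma orbit_Int_ball: "orbit G \<phi> x0 \<inter> ball x0 r = pt ` {g \<in> carrier G. len g < r}"
  by (auto simp: orbit_def len_def)

lemma finite_orbit_ball [simp]: "finite (orbit G \<phi> x0 \<inter> ball x0 r)"
  unfolding orbit_Int_ball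
  by (rule finite_imageI, rule finite_subset[OF _ finite_ball_G[of r]]) (auto simp: ball_G_def)

lemma orbit_growth_le: "real (orbit_growth r) \<le> growth r"
proof -
  have "orbit_growth r \<le> card (pt ` ball_G r)"
    unfolding orbit_growth_def orbit_Int_ball
    by (rule card_mono[OF finite_imageI[OF finite_ball_G]]) (auto simp: ball_G_def)
  also have "\<dots> \<le> card (ball_G r)" by (rule card_image_le) simp
  finally show ?thesis by (simp add: growth_def)
qed

text \<open>
  An orbit point comes from at most \<open>growth 0\<close> elements, the order of the stabiliser of \<open>x0\<close>. This
  passes from the orbit count, which defines the exponent, to the count of group elements.
\<close>

lemma growth_le_orbit_growth: "growth r \<le> growth 0 * real (orbit_growth (r + 1))"
proof -
  let ?I = "orbit G \<phi> x0 \<inter> ball x0 (r + 1)"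
  have "ball_G r \<subseteq> (\<Union>y\<in>?I. {g \<in> carrier G. dist (pt g) y \<le> 0})"
    by (auto simp: ball_G_def len_def orbit_def)
  then have "card (ball_G r) \<le> card (\<Union>y\<in>?I. {g \<in> carrier G. dist (pt g) y \<le> 0})"
    by (intro card_mono finite_UN_I card_near_pt_le) auto
  also have "\<dots> \<le> (\<Sum>y\<in>?I. card {g \<in> carrier G. dist (pt g) y \<le> 0})"
    by (rule card_UN_le) simp
  finally have "growth r \<le> (\<Sum>y\<in>?I. real (card {g \<in> carrier G. dist (pt g) y \<le> 0}))"
    unfolding growth_def by (simp flip: of_nat_sum)
  also have "\<dots> \<le> (\<Sum>y\<in>?I. growth 0)"
    using card_near_pt_le(2)[of _ 0] by (intro sum_mono) simp
  finally show ?thesis by (simp add: orbit_growth_def mult.commute)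
qed

lemma orbit_growth_pos: "r > 0 \<Longrightarrow> orbit_growth r \<ge> 1"
proof -
  assume "r > 0"
  then have "x0 \<in> orbit G \<phi> x0 \<inter> ball x0 r" by (force simp: orbit_def intro!: exI[of _ \<one>])
  then show ?thesis
    unfolding orbit_growth_def by (metis One_nat_def Suc_leI card_gt_0_iff empty_iff finite_orbit_ball)
qed

definition Q :: real where "Q = growth_exponent G \<phi> x0"

lemma growth_power_le:
  assumes "n \<ge> 0"
  shows "growth (real (Suc k) * n + 2 * rc) \<le> growth (n + 2 * rc) ^ Suc k"
proof (induction k)
  case (Suc k)
  have "growth (real (Suc (Suc k)) * n + 2 * rc) = growth ((real (Suc k) * n + rc) + (n + rc))"
    by (simp add: algebra_simps)
  also have "\<dots> \<le> growth (real (Suc k) * n + rc + rc) * growth (n + rc + rc)"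
    using assms rc_ge_1 by (intro growth_submult) auto
  also have "\<dots> = growth (real (Suc k) * n + 2 * rc) * growth (n + 2 * rc)"
    by (simp add: algebra_simps)
  also have "\<dots> \<le> growth (n + 2 * rc) ^ Suc k * growth (n + 2 * rc)"
    by (intro mult_right_mono Suc) simp
  finally show ?case by (simp add: mult_ac)
qed simp

text \<open>
  The exponential rate of a submultiplicative function is at most its rate at any single radius.
\<close>

lemma growth_exponent_le:
  assumes n: "n > 0"
  shows "Limsup at_top (\<lambda>r. ereal (ln (real (orbit_growth r)) / r)) \<le> ereal (ln (growth (n + 2 * rc)) / n)"
proof -
  define a where "a = ln (growth (n + 2 * rc))"
  have u1: "growth (n + 2 * rc) \<ge> 1" using n rc_ge_1 by (intro growth_ge_1) simp
  then have a0: "a \<ge> 0" by (simp add: a_def)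
  have "eventually (\<lambda>r. ereal (ln (real (orbit_growth r)) / r) \<le> ereal (a / n + a / r)) at_top"
    using eventually_gt_at_top[of 0]
  proof eventually_elim
    case (elim r)
    define k where "k = nat \<lfloor>r / n\<rfloor>"
    have kr: "real k \<le> r / n" "r / n \<le> real k + 1"
      using elim n by (auto simp: k_def)
    have "r \<le> real (Suc k) * n + 2 * rc"
      using kr(2) n rc_ge_1 by (simp add: field_simps)
    then have "real (orbit_growth r) \<le> growth (n + 2 * rc) ^ Suc k"
      using orbit_growth_le[of r] growth_mono growth_power_le[of n k] n by (meson less_imp_le order_trans)
    then have "ln (real (orbit_growth r)) \<le> ln (growth (n + 2 * rc) ^ Suc k)"
      using orbit_growth_pos[OF elim] by (intro ln_mono) auto
    also have "\<dots> = real (Suc k) * a" unfolding a_def using u1 by (simp add: ln_realpow del: power_Suc of_nat_Suc)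
    also have "\<dots> \<le> (r / n + 1) * a" using kr(1) a0 by (intro mult_right_mono) auto
    finally have "ln (real (orbit_growth r)) / r \<le> (r / n + 1) * a / r"
      using elim by (simp add: divide_right_mono)
    also have "\<dots> = a / n + a / r" using elim n by (simp add: field_simps)
    finally show ?case by simp
  qed
  then have "Limsup at_top (\<lambda>r. ereal (ln (real (orbit_growth r)) / r))
      \<le> Limsup at_top (\<lambda>r. ereal (a / n + a / r))" by (rule Limsup_mono)
  also have "((\<lambda>r. ereal (a / n + a / r)) \<longlongrightarrow> ereal (a / n + 0)) at_top"
    unfolding lim_ereal
    by (intro tendsto_add tendsto_const real_tendsto_divide_at_top[OF tendsto_const] filterlim_ident)
  then have "Limsup at_top (\<lambda>r. ereal (a / n + a / r)) = ereal (a / n)"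
    by (simp add: lim_imp_Limsup)
  finally show ?thesis by (simp add: a_def)
qed

lemma ereal_Q: "ereal Q = Limsup at_top (\<lambda>r. ereal (ln (real (orbit_growth r)) / r))"
  and Q_nonneg: "Q \<ge> 0"
proof -
  let ?L = "Limsup at_top (\<lambda>r. ereal (ln (real (orbit_growth r)) / r))"
  have "eventually (\<lambda>r. 0 \<le> ereal (ln (real (orbit_growth r)) / r)) at_top"
    using eventually_gt_at_top[of 0]
    by eventually_elim (use orbit_growth_pos in force)
  then have 0: "0 \<le> ?L" by (rule le_Limsup[rotated]) simp
  moreover have "?L \<noteq> \<infinity>" using growth_exponent_le[of 1] by auto
  ultimately have fin: "\<bar>?L\<bar> \<noteq> \<infinity>" by auto
  then show *: "ereal Q = ?L"
    by (simp add: Q_def growth_exponent_def orbit_growth_def ereal_real')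
  show "Q \<ge> 0" using 0 unfolding *[symmetric] by simp
qed

text \<open>
  The exponent bounds the rates \<open>ln (growth (n + 2 * rc)) / n\<close> from below at every radius, and not only
  in the limit, so there is no subexponential error.
\<close>

theorem growth_lower:
  assumes "r \<ge> 0" shows "exp (Q * (r - 2 * rc)) \<le> growth r"
proof (cases "r > 2 * rc")
  case True
  define n where "n = r - 2 * rc"
  have n: "n > 0" "n + 2 * rc = r" using True by (auto simp: n_def)
  have "ereal Q \<le> ereal (ln (growth r) / n)"
    using growth_exponent_le[OF n(1)] unfolding ereal_Q n(2) .
  then have "Q * n \<le> ln (growth r)" using n by (simp add: field_simps)
  then show ?thesis
    using growth_ge_1[OF assms] unfolding n_def
    by (metis exp_le_cancel_iff exp_ln less_le_trans zero_less_one)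
next
  case False
  then have "Q * (r - 2 * rc) \<le> 0" using Q_nonneg by (simp add: mult_nonneg_nonpos)
  then have "exp (Q * (r - 2 * rc)) \<le> 1" by simp
  then show ?thesis using growth_ge_1[OF assms] by linarith
qed

lemma eventually_growth_le:
  assumes "q > Q"
  shows "eventually (\<lambda>r. growth r \<le> growth 0 * exp (q * (r + 1))) at_top"
proof -
  have "eventually (\<lambda>r. ereal (ln (real (orbit_growth r)) / r) < ereal q) at_top"
    by (rule Limsup_lessD) (use assms in \<open>simp flip: ereal_Q\<close>)
  then have "eventually (\<lambda>r. ereal (ln (real (orbit_growth (r + 1))) / (r + 1)) < ereal q) at_top"
    by (rule eventually_compose_filterlim)
      (intro filterlim_at_top_mono[OF filterlim_ident] always_eventually allI, simp)
  with eventually_gt_at_top[of 0] show ?thesis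
  proof eventually_elim
    case (elim r)
    then have "ln (real (orbit_growth (r + 1))) \<le> q * (r + 1)" by (simp add: field_simps)
    then have "real (orbit_growth (r + 1)) \<le> exp (q * (r + 1))"
      using orbit_growth_pos[of "r + 1"] elim
      by (metis add_pos_pos exp_le_cancel_iff exp_ln of_nat_0_less_iff less_le_trans zero_less_one)
    then show ?case
      using growth_le_orbit_growth[of r] mult_left_mono[of _ _ "growth 0"] order_trans growth_nonneg
      by blast
  qed
qed

text \<open>
  If \<open>v k\<close> exceeded \<open>M exp (Q k)\<close>, its powers would force the growth at the multiples of \<open>k\<close> above
  \<open>exp (q r)\<close> for some \<open>q > Q\<close>.
\<close>

lemma supermultiplicative_le_exp:
  assumes M: "M > 0" and v: "\<And>k l. k \<ge> 0 \<Longrightarrow> l \<ge> 0 \<Longrightarrow> v k * v l \<le> M * v (k + l)"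
    and le: "\<And>k. k \<ge> 0 \<Longrightarrow> v k \<le> growth (k + B)" and v0: "\<And>k. v k \<ge> 0" and k: "k > 0"
  shows "v k \<le> M * exp (Q * k)"
proof (rule ccontr)
  assume "\<not> v k \<le> M * exp (Q * k)"
  then have vk: "v k / M > exp (Q * k)" using M by (simp add: field_simps)
  define z where "z = v k / M"
  have z0: "z > 0" using vk unfolding z_def by (meson exp_gt_zero less_trans)
  have "Q * k < ln z" using vk z0 by (metis exp_less_cancel_iff exp_ln z_def)
  then have "Q < ln z / k" using k by (simp add: field_simps)
  then obtain q where q: "Q < q" "q < ln z / k" using dense by blast
  define y where "y = exp (q * k)"
  have "q * k < ln z" using q k by (simp add: field_simps)
  then have yz: "0 < y" "y < z" using z0 unfolding y_def by (auto, metis exp_less_cancel_iff exp_ln)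
  have pow: "z ^ Suc j \<le> v (real (Suc j) * k) / M" for j
  proof (induction j)
    case (Suc j)
    have "z ^ Suc (Suc j) \<le> v (real (Suc j) * k) / M * z"
      using mult_right_mono[OF Suc, of z] z0 by (simp add: mult_ac)
    also have "\<dots> = v (real (Suc j) * k) * v k / M / M" by (simp add: z_def)
    also have "\<dots> \<le> M * v (real (Suc j) * k + k) / M / M"
      using M k by (intro divide_right_mono v) auto
    also have "\<dots> = v (real (Suc (Suc j)) * k) / M" using M by (simp add: algebra_simps)
    finally show ?case .
  qed (simp add: z_def)
  define A where "A = growth 0 * exp (q * (B + 1)) / M"
  have "filterlim (\<lambda>j. real (Suc j) * k + B) at_top sequentially"
    using k by real_asymp
  then have "eventually (\<lambda>j. growth (real (Suc j) * k + B) \<le> growth 0 * exp (q * (real (Suc j) * k + B + 1))) sequentially"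
    using eventually_compose_filterlim[OF eventually_growth_le[OF q(1)]] by blast
  then have "eventually (\<lambda>j. 1 \<le> A * (y / z) ^ Suc j) sequentially"
  proof eventually_elim
    case (elim j)
    have "z ^ Suc j \<le> growth (real (Suc j) * k + B) / M"
      using pow[of j] divide_right_mono[OF le[of "real (Suc j) * k"], of M] k M by simp
    also have "\<dots> \<le> growth 0 * exp (q * (real (Suc j) * k + B + 1)) / M"
      using elim M by (intro divide_right_mono) auto
    also have "exp (q * (real (Suc j) * k + B + 1)) = y ^ Suc j * exp (q * (B + 1))"
      unfolding y_def by (simp add: exp_of_nat_mult[symmetric] exp_add[symmetric] algebra_simps flip: power_Suc)
    finally have "z ^ Suc j \<le> A * y ^ Suc j" by (simp add: A_def mult_ac)
    then show ?case using z0 by (simp add: power_divide field_simps)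
  qed
  moreover have "(\<lambda>j. A * (y / z) ^ Suc j) \<longlonglongrightarrow> A * 0"
    using yz z0 by (intro tendsto_mult tendsto_const LIMSEQ_Suc LIMSEQ_realpow_zero) auto
  ultimately have "1 \<le> A * 0" by (intro tendsto_lowerbound[of _ _ sequentially]) auto
  then show False by simp
qed

text \<open>
  If \<open>(x, f y) > R\<close> for every \<open>f\<close> in a ball of radius \<open>\<rho>\<close>, then all these \<open>f\<close> move a long
  initial segment of a geodesic from \<open>x0\<close> to \<open>y\<close> along itself up to a bounded error, and \<open>f\<close> is
  determined up to boundedly many choices by the distance of translation. Then the ball has only
  linearly many elements, which exponential growth excludes.
\<close>

lemma branching:
  assumes Q: "Q > 0"
  obtains \<rho> R where "\<rho> \<ge> 0" "R \<ge> 0" "\<And>x y. \<exists>f\<in>ball_G \<rho>. gprod x0 x (\<phi> f y) \<le> R"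
proof -
  define C where "C = 1 + 3 * rc + 6 * \<delta>"
  have "filterlim (\<lambda>\<rho>. exp (Q * (\<rho> - 2 * rc)) / (2 * \<rho> + 2 * rc + 4)) at_top at_top"
    using exp_beats_linear[OF Q, of "2 * rc" "2 * rc + 4"] by (simp add: add.assoc)
  then have "eventually (\<lambda>\<rho>. exp (Q * (\<rho> - 2 * rc)) / (2 * \<rho> + 2 * rc + 4) > growth (2 * C)) at_top"
    by (simp add: filterlim_at_top_dense)
  then have "eventually (\<lambda>\<rho>. \<rho> \<ge> 0 \<and> exp (Q * (\<rho> - 2 * rc)) / (2 * \<rho> + 2 * rc + 4) > growth (2 * C)) at_top"
    using eventually_ge_at_top[of 0] by eventually_elim auto
  then obtain \<rho> where \<rho>: "\<rho> \<ge> 0" "exp (Q * (\<rho> - 2 * rc)) / (2 * \<rho> + 2 * rc + 4) > growth (2 * C)"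
    unfolding eventually_at_top_linorder by blast
  then have big: "growth \<rho> > (2 * \<rho> + 2 * rc + 4) * growth (2 * C)"
    using growth_lower[OF \<rho>(1)] rc_ge_1 by (simp add: field_simps)
  \<comment> \<open>\<open>T\<close> is so large that, seen from the translate of a point at distance \<open>T\<close>, all \<open>f x0\<close> with \<open>f\<close> in the ball lie in the direction of \<open>x0\<close>; \<open>R\<close> exceeds the distance of this translate from \<open>x0\<close>.\<close>
  define T where "T = \<rho> + 2 * rc + \<delta> + 1"
  define R where "R = T + \<rho> + rc + \<delta>"
  have cs: "0 \<le> T" "0 \<le> R" "T \<le> R" "T + rc + \<rho> \<le> R" using \<rho>(1) rc_ge_1 delta_nonneg by (auto simp: T_def R_def)
  have "\<exists>f\<in>ball_G \<rho>. gprod x0 x (\<phi> f y) \<le> R" for x y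
  proof (rule ccontr)
    assume "\<not> (\<exists>f\<in>ball_G \<rho>. gprod x0 x (\<phi> f y) \<le> R)"
    then have far: "\<And>f. f \<in> ball_G \<rho> \<Longrightarrow> gprod x0 x (\<phi> f y) > R" by force
    have xy: "gprod x0 x y > R" using far[OF one_in_ball_G[OF \<rho>(1)]] by simp
    then have y: "dist x0 y > R" using gprod_le_dist'[of x0 x y] by linarith
    obtain k where k: "k \<in> carrier G" "\<bar>len k - T\<bar> \<le> rc" "\<bar>dist (pt k) y - (dist x0 y - T)\<bar> \<le> rc"
      using between[of T y] cs y by auto
    have "\<forall>t. \<exists>p. 0 \<le> t \<and> t \<le> dist x0 y \<longrightarrow> dist x0 p \<le> t + rc \<and> gprod x0 p y \<ge> t - rc"
    proof
      fix t show "\<exists>p. 0 \<le> t \<and> t \<le> dist x0 y \<longrightarrow> dist x0 p \<le> t + rc \<and> gprod x0 p y \<ge> t - rc"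
      proof (cases "0 \<le> t \<and> t \<le> dist x0 y")
        case True
        then obtain g where "\<bar>len g - t\<bar> \<le> rc" "gprod x0 (pt g) y \<ge> t - rc" using between[of t y] by auto
        then show ?thesis by (intro exI[of _ "pt g"]) (auto simp: len_def)
      qed auto
    qed
    then obtain p where p: "\<And>t. 0 \<le> t \<Longrightarrow> t \<le> dist x0 y \<Longrightarrow> dist x0 (p t) \<le> t + rc \<and> gprod x0 (p t) y \<ge> t - rc"
      by metis
    define J where "J = {nat \<lfloor>T - rc - \<rho>\<rfloor>..nat \<lfloor>T + rc + \<rho>\<rfloor>}"
    have "ball_G \<rho> \<subseteq> (\<Union>j\<in>J. {f \<in> carrier G. dist (\<phi> f (pt k)) (p (real j)) \<le> C})"
    proof
      fix f assume f: "f \<in> ball_G \<rho>"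
      then have fG: "f \<in> carrier G" "len f \<le> \<rho>" by (auto simp: ball_G_def)
      define w where "w = \<phi> f (pt k)"
      have w_pt: "w = pt (f \<otimes> k)" using fG k by (simp add: w_def act_mult)
      have d1: "dist (pt f) w = len k" using fG by (simp add: w_def isometric len_def)
      have d2: "dist w (\<phi> f y) = dist (pt k) y" using fG by (simp add: w_def isometric)
      have d3: "dist (pt f) (\<phi> f y) = dist x0 y" using fG by (simp add: isometric)
      have d4: "dist x0 w \<le> len k + len f" "len k \<le> dist x0 w + len f"
        using dist_triangle[of x0 w "pt f"] dist_triangle[of "pt f" w x0] d1
        by (auto simp: len_def dist_commute)
      \<comment> \<open>\<open>w\<close> lies near a geodesic from \<open>f x0\<close> to \<open>f y\<close>, hence near one from \<open>x0\<close> to \<open>f y\<close>, hence near one from \<open>x0\<close> to \<open>y\<close>.\<close>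
      have "gprod w (pt f) (\<phi> f y) \<le> rc"
        using d1 d2 d3 k(2,3) by (simp add: gromov_product_def dist_commute)
      moreover have "gprod w (pt f) x0 \<ge> T - rc - \<rho>"
        using d1 d4 k(2) fG(2) by (simp add: gromov_product_def dist_commute len_def field_simps)
      moreover have "min (gprod w (pt f) x0) (gprod w x0 (\<phi> f y)) - \<delta> \<le> gprod w (pt f) (\<phi> f y)"
        unfolding w_pt by (rule hyp_pt) (use fG k in auto)
      ultimately have "gprod w x0 (\<phi> f y) \<le> rc + \<delta>" by (auto simp: T_def min_def split: if_splits)
      then have a: "gprod x0 w (\<phi> f y) \<ge> dist x0 w - rc - \<delta>"
        using gprod_add_gprod[of x0 w "\<phi> f y"] by linarith
      have "gprod x0 y (\<phi> f y) \<ge> R - \<delta>"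
        using hyp_ge[of R y x "\<phi> f y"] far[OF f] xy gprod_commute[of x0 x y] by simp
      then have b: "gprod x0 (\<phi> f y) y \<ge> R - \<delta>" by (simp add: gprod_commute)
      have wR: "dist x0 w \<le> R" "dist x0 w \<le> T + rc + \<rho>" "dist x0 w \<ge> T - rc - \<rho>"
        using d4 k(2) fG(2) cs by auto
      have c: "gprod x0 w y \<ge> dist x0 w - rc - 2 * \<delta>"
        using hyp_ge[of "dist x0 w - rc - \<delta>" w "\<phi> f y" y] a b wR(1) rc_ge_1 delta_nonneg by linarith
      define j where "j = nat \<lfloor>dist x0 w\<rfloor>"
      have j: "real j \<le> dist x0 w" "dist x0 w \<le> real j + 1" by (simp_all add: j_def)
      have jJ: "j \<in> J" using wR by (auto simp: J_def j_def intro!: nat_mono floor_mono)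
      have jp: "dist x0 (p (real j)) \<le> real j + rc" "gprod x0 (p (real j)) y \<ge> real j - rc"
        using p[of "real j"] j(1) wR(1) y by auto
      have "gprod x0 w (p (real j)) \<ge> real j - rc - 3 * \<delta>"
        using hyp_ge[of "real j - rc - 2 * \<delta>" w y "p (real j)"] c jp(2) j delta_nonneg
        by (simp add: gprod_commute)
      then have "dist w (p (real j)) \<le> C"
        using dist_eq_gprod[of w "p (real j)" x0] j jp(1) by (simp add: C_def)
      then show "f \<in> (\<Union>j\<in>J. {f \<in> carrier G. dist (\<phi> f (pt k)) (p (real j)) \<le> C})"
        using jJ fG by (auto simp: w_def)
    qed
    then have "card (ball_G \<rho>) \<le> card (\<Union>j\<in>J. {f \<in> carrier G. dist (\<phi> f (pt k)) (p (real j)) \<le> C})"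
      by (intro card_mono finite_UN_I card_near_le k) (auto simp: J_def)
    also have "\<dots> \<le> (\<Sum>j\<in>J. card {f \<in> carrier G. dist (\<phi> f (pt k)) (p (real j)) \<le> C})"
      by (rule card_UN_le) (simp add: J_def)
    finally have "growth \<rho> \<le> (\<Sum>j\<in>J. real (card {f \<in> carrier G. dist (\<phi> f (pt k)) (p (real j)) \<le> C}))"
      unfolding growth_def by (simp flip: of_nat_sum)
    also have "\<dots> \<le> (\<Sum>j\<in>J. growth (2 * C))" by (intro sum_mono card_near_le k)
    also have "\<dots> = real (card J) * growth (2 * C)" by simp
    also have "\<dots> \<le> (2 * \<rho> + 2 * rc + 4) * growth (2 * C)"
    proof (rule mult_right_mono)
      have "T - rc - \<rho> \<ge> 0" using delta_nonneg rc_ge_1 by (simp add: T_def)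
      then have "\<lfloor>T - rc - \<rho>\<rfloor> \<ge> 0" by simp
      moreover have "real_of_int \<lfloor>T + rc + \<rho>\<rfloor> \<le> T + rc + \<rho>" "real_of_int \<lfloor>T - rc - \<rho>\<rfloor> \<ge> T - rc - \<rho> - 1"
        by linarith+
      moreover have "\<lfloor>T - rc - \<rho>\<rfloor> \<le> \<lfloor>T + rc + \<rho>\<rfloor>" using \<rho>(1) rc_ge_1 by (intro floor_mono) simp
      moreover have "\<lfloor>T + rc + \<rho>\<rfloor> \<ge> 0" using calculation by linarith
      ultimately have "real (card J) = real_of_int \<lfloor>T + rc + \<rho>\<rfloor> + 1 - real_of_int \<lfloor>T - rc - \<rho>\<rfloor>"
        by (simp add: J_def of_nat_diff)
      then show "real (card J) \<le> 2 * \<rho> + 2 * rc + 4" by linarith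
    qed simp
    finally show False using big by linarith
  qed
  then show ?thesis using that \<rho>(1) cs(2) by blast
qed

end

section \<open>The exponential upper bound for the growth\<close>

lemma card_le_fibres:
  assumes "finite S" and "\<And>x. x \<in> S \<Longrightarrow> real (card {y \<in> S. f y = f x}) \<le> M"
  shows "real (card S) \<le> M * real (card (f ` S))"
proof -
  have "S = (\<Union>z\<in>f ` S. {y \<in> S. f y = z})" by auto
  then have "card S \<le> (\<Sum>z\<in>f ` S. card {y \<in> S. f y = z})"
    using card_UN_le[of "f ` S" "\<lambda>z. {y \<in> S. f y = z}"] assms(1) by simp
  then have "real (card S) \<le> (\<Sum>z\<in>f ` S. real (card {y \<in> S. f y = z}))"
    by (simp flip: of_nat_sum)
  also have "\<dots> \<le> (\<Sum>z\<in>f ` S. M)" using assms(2) by (intro sum_mono) auto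
  finally show ?thesis by (simp add: mult.commute)
qed

lemma sum_exp_le:
  fixes a :: real
  assumes "a > 0"
  shows "(\<Sum>j\<le>n. exp (a * real j)) \<le> exp a / (exp a - 1) * exp (a * real n)"
proof (induction n)
  case 0
  have "exp a > 1" using assms by simp
  then show ?case by (simp add: field_simps)
next
  case (Suc n)
  have e: "exp a > 1" using assms by simp
  have E: "exp (a * real (Suc n)) = exp a * exp (a * real n)"
    by (simp add: algebra_simps exp_add)
  have "(\<Sum>j\<le>Suc n. exp (a * real j)) \<le> exp a / (exp a - 1) * exp (a * real n) + exp a * exp (a * real n)"
    using Suc E by simp
  also have "\<dots> = exp a / (exp a - 1) * exp (a * real (Suc n))"
    unfolding E using e by (simp add: field_simps)
  finally show ?case .
qed

context geometric_hyperbolic_action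
begin

definition annulus :: "real \<Rightarrow> real \<Rightarrow> 'g set" where
  "annulus w r = {g \<in> carrier G. \<bar>len g - r\<bar> \<le> w}"

lemma annulus_subset: "annulus w r \<subseteq> ball_G (r + w)"
  by (auto simp: annulus_def ball_G_def)

lemma finite_annulus [simp]: "finite (annulus w r)"
  using finite_subset[OF annulus_subset finite_ball_G] .

lemma card_annulus_le: "real (card (annulus w r)) \<le> growth (r + w)"
  unfolding growth_def using card_mono[OF finite_ball_G annulus_subset] by simp

text \<open>Pulling the elements of a wide annulus back along geodesics to its inner boundary.\<close>

lemma card_wide_annulus_le:
  assumes "r - w \<ge> 0" "w \<ge> 0"
  shows "real (card (annulus w r)) \<le> growth (2 * w + rc) * real (card (annulus rc (r - w)))"
proof -
  have "annulus w r \<subseteq> (\<lambda>(g, h). g \<otimes> h) ` (annulus rc (r - w) \<times> ball_G (2 * w + rc))"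
  proof
    fix k assume k: "k \<in> annulus w r"
    then obtain g h where gh: "g \<in> carrier G" "h \<in> carrier G" "k = g \<otimes> h"
      "\<bar>len g - (r - w)\<bar> \<le> rc" "\<bar>len h - (len k - (r - w))\<bar> \<le> rc"
      using between_G[of k "r - w"] assms k unfolding annulus_def
      by (metis (no_types, lifting) abs_diff_le_iff mem_Collect_eq)
    then have "(g, h) \<in> annulus rc (r - w) \<times> ball_G (2 * w + rc)"
      using k by (auto simp: annulus_def ball_G_def)
    then show "k \<in> (\<lambda>(g, h). g \<otimes> h) ` (annulus rc (r - w) \<times> ball_G (2 * w + rc))"
      using gh(3) by force
  qed
  then have "card (annulus w r) \<le> card (annulus rc (r - w) \<times> ball_G (2 * w + rc))"
    by (intro order_trans[OF card_mono card_image_le]) auto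
  then have "real (card (annulus w r)) \<le> real (card (annulus rc (r - w) \<times> ball_G (2 * w + rc)))"
    by (rule of_nat_mono)
  then show ?thesis unfolding growth_def card_cartesian_product of_nat_mult by (simp only: mult.commute)
qed

text \<open>
  Inserting a suitable bounded element \<open>f\<close> between \<open>g\<close> and \<open>h\<close> makes \<open>g f h\<close> almost as long as
  possible. Then \<open>g x0\<close> lies near a geodesic from \<open>x0\<close> to \<open>g f h x0\<close>, at a known distance, so that
  the product determines \<open>g\<close>, and then \<open>h\<close>, up to boundedly many choices.
\<close>

lemma annulus_supermult:
  assumes "Q > 0"
  obtains M w where "M > 0" "w \<ge> 0"
    "\<And>m n. m \<ge> 0 \<Longrightarrow> n \<ge> 0 \<Longrightarrow>
      real (card (annulus rc m)) * real (card (annulus rc n)) \<le> M * real (card (annulus w (m + n)))"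
proof -
  obtain \<rho> R where \<rho>: "\<rho> \<ge> 0" "R \<ge> 0" and br: "\<And>x y. \<exists>f\<in>ball_G \<rho>. gprod x0 x (\<phi> f y) \<le> R"
    using branching[OF assms] by metis
  define w where "w = 2 * rc + \<rho> + 2 * R"
  define C where "C = 4 * rc + 2 * R + 2 * \<delta>"
  define M where "M = growth (2 * C) * growth \<rho>"
  have C0: "C \<ge> 0" using rc_ge_1 \<rho> delta_nonneg by (simp add: C_def)
  have M: "M > 0" unfolding M_def using growth_ge_1[of "2 * C"] growth_ge_1[of \<rho>] C0 \<rho> by simp
  have "\<forall>g h. \<exists>f. f \<in> ball_G \<rho> \<and> gprod x0 (pt (inv g)) (\<phi> f (pt h)) \<le> R" using br by blast
  then obtain F where F: "\<And>g h. F g h \<in> ball_G \<rho>" "\<And>g h. gprod x0 (pt (inv g)) (\<phi> (F g h) (pt h)) \<le> R"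
    by metis
  have FG: "F g h \<in> carrier G" "len (F g h) \<le> \<rho>" for g h using F(1)[of g h] by (auto simp: ball_G_def)
  define P where "P = (\<lambda>(g, h). g \<otimes> F g h \<otimes> h)"
  have key: "len (g \<otimes> F g h \<otimes> h) \<ge> len g + len (F g h \<otimes> h) - 2 * R"
    "len (g \<otimes> F g h \<otimes> h) \<le> len g + len (F g h \<otimes> h)"
    "gprod x0 (pt g) (pt (g \<otimes> F g h \<otimes> h)) \<ge> len g - R"
    "len (F g h \<otimes> h) \<le> \<rho> + len h" "len h \<le> len (F g h \<otimes> h) + \<rho>"
    if gh: "g \<in> carrier G" "h \<in> carrier G" for g h
  proof -
    let ?f = "F g h"
    have a: "dist (pt (inv g)) (pt (?f \<otimes> h)) = len (g \<otimes> ?f \<otimes> h)"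
      using gh FG by (simp add: dist_pt m_assoc)
    have "gprod x0 (pt (inv g)) (pt (?f \<otimes> h)) \<le> R" using F(2)[of g h] gh FG by (simp add: act_mult)
    then show 1: "len (g \<otimes> ?f \<otimes> h) \<ge> len g + len (?f \<otimes> h) - 2 * R"
      using a gh len_inv[of g] by (simp add: gromov_product_def len_def dist_commute[of _ x0])
    show "len (g \<otimes> ?f \<otimes> h) \<le> len g + len (?f \<otimes> h)"
      using len_mult_le[of g "?f \<otimes> h"] gh FG by (simp add: m_assoc)
    have "dist (pt g) (pt (g \<otimes> ?f \<otimes> h)) = len (?f \<otimes> h)"
      using gh FG dist_pt[of g "g \<otimes> ?f \<otimes> h"] by (simp add: m_assoc inv_mult_cancel)
    then show "gprod x0 (pt g) (pt (g \<otimes> ?f \<otimes> h)) \<ge> len g - R"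
      using 1 by (simp add: gromov_product_def len_def dist_commute[of _ x0] field_simps)
    show "len (?f \<otimes> h) \<le> \<rho> + len h"
      using len_mult_le[of ?f h] gh FG[of g h] by simp
    have "inv ?f \<otimes> (?f \<otimes> h) = h" using gh FG by (simp add: m_assoc[symmetric])
    then show "len h \<le> len (?f \<otimes> h) + \<rho>"
      using len_mult_le[of "inv ?f" "?f \<otimes> h"] gh FG[of g h] by simp
  qed
  have "real (card (annulus rc m)) * real (card (annulus rc n)) \<le> M * real (card (annulus w (m + n)))"
    if mn: "m \<ge> 0" "n \<ge> 0" for m n
  proof -
    let ?S = "annulus rc m \<times> annulus rc n"
    have sub: "P ` ?S \<subseteq> annulus w (m + n)"
    proof clarify
      fix g h assume gh: "g \<in> annulus rc m" "h \<in> annulus rc n"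
      then have G: "g \<in> carrier G" "h \<in> carrier G" by (auto simp: annulus_def)
      show "P (g, h) \<in> annulus w (m + n)"
        using gh key[OF G] FG[of g h] \<rho> by (auto simp: P_def annulus_def w_def)
    qed
    have fib: "real (card {y \<in> ?S. P y = P x}) \<le> M" if x: "x \<in> ?S" for x
    proof -
      obtain g0 h0 where x': "x = (g0, h0)" "g0 \<in> annulus rc m" "h0 \<in> annulus rc n" using x by auto
      let ?N = "{g \<in> carrier G. dist (pt g) (pt g0) \<le> C}"
      let ?i = "\<lambda>(g, h). (g, F g h)"
      have "?i ` {y \<in> ?S. P y = P x} \<subseteq> ?N \<times> ball_G \<rho>"
      proof (rule image_subsetI)
        fix y assume "y \<in> {y \<in> ?S. P y = P x}"
        then obtain g h where y: "y = (g, h)" and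
          gh: "g \<in> annulus rc m" "h \<in> annulus rc n" "P (g, h) = P x" by auto
        let ?k = "P (g, h)"
        have "gprod x0 (pt g) (pt ?k) \<ge> m - rc - R" "gprod x0 (pt g0) (pt ?k) \<ge> m - rc - R"
          using key(3)[of g h] key(3)[of g0 h0] gh x'
          by (auto simp: P_def annulus_def)
        then have "gprod x0 (pt g) (pt g0) \<ge> m - rc - R - \<delta>"
          using hyp_ge[of "m - rc - R" "pt g" "pt ?k" "pt g0"] by (simp add: gprod_commute)
        then have "dist (pt g) (pt g0) \<le> C"
          using dist_eq_gprod[of "pt g" "pt g0" x0] gh(1) x'(2)
          by (auto simp: annulus_def C_def len_def)
        then show "?i y \<in> ?N \<times> ball_G \<rho>" using y gh F(1) by (auto simp: annulus_def)
      qed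
      moreover have "inj_on ?i {y \<in> ?S. P y = P x}"
      proof (rule inj_onI)
        fix y y' assume yy: "y \<in> {y \<in> ?S. P y = P x}" "y' \<in> {y \<in> ?S. P y = P x}" "?i y = ?i y'"
        then obtain g h h' where y: "y = (g, h)" "y' = (g, h')" and a: "F g h = F g h'" by auto
        then have "g \<otimes> F g h \<otimes> h = g \<otimes> F g h \<otimes> h'" using yy(1,2) by (simp add: P_def)
        then show "y = y'" using y yy(1,2) FG[of g h] by (auto simp: annulus_def)
      qed
      moreover have "finite (?N \<times> ball_G \<rho>)" using card_near_pt_le(1) by auto
      ultimately have "card {y \<in> ?S. P y = P x} \<le> card (?N \<times> ball_G \<rho>)" by (intro card_inj_on_le)
      then have "real (card {y \<in> ?S. P y = P x}) \<le> real (card (?N \<times> ball_G \<rho>))" by (rule of_nat_mono)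
      also have "\<dots> = real (card ?N) * growth \<rho>"
        unfolding growth_def card_cartesian_product by (rule of_nat_mult)
      also have "\<dots> \<le> M" unfolding M_def by (intro mult_right_mono card_near_pt_le) simp
      finally show ?thesis .
    qed
    have "real (card ?S) \<le> M * real (card (P ` ?S))"
      by (rule card_le_fibres) (use fib in auto)
    also have "\<dots> \<le> M * real (card (annulus w (m + n)))"
      using M sub by (intro mult_left_mono) (auto intro: card_mono)
    finally show ?thesis by (simp add: card_cartesian_product)
  qed
  moreover have "w \<ge> 0" using \<rho> rc_ge_1 by (simp add: w_def)
  ultimately show ?thesis using that M by blast
qed

text \<open>
  Supermultiplicativity of the annuli bounds them from above by \<open>supermultiplicative_le_exp\<close>.
\<close>

lemma annulus_upper:
  assumes Q: "Q > 0"
  obtains C where "C > 0" "\<And>r. r \<ge> 0 \<Longrightarrow> real (card (annulus rc r)) \<le> C * exp (Q * r)"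
proof -
  obtain M w where M: "M > 0" "w \<ge> 0" and sm: "\<And>m n. m \<ge> 0 \<Longrightarrow> n \<ge> 0 \<Longrightarrow>
      real (card (annulus rc m)) * real (card (annulus rc n)) \<le> M * real (card (annulus w (m + n)))"
    using annulus_supermult[OF Q] by metis
  \<comment> \<open>The shift by \<open>w\<close> makes up for the loss of \<open>w\<close> in pulling a wide annulus back to its inner boundary.\<close>
  define v where "v k = real (card (annulus rc (k + w)))" for k
  define M' where "M' = M * growth (2 * w + rc)"
  have M': "M' > 0" unfolding M'_def using M growth_ge_1[of "2 * w + rc"] rc_ge_1 by simp
  have "v k * v l \<le> M' * v (k + l)" if kl: "k \<ge> 0" "l \<ge> 0" for k l
  proof -
    have "v k * v l \<le> M * real (card (annulus w ((k + w) + (l + w))))"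
      unfolding v_def using M kl by (intro sm) auto
    also have "\<dots> \<le> M * (growth (2 * w + rc) * real (card (annulus rc ((k + w) + (l + w) - w))))"
      using M kl by (intro mult_left_mono card_wide_annulus_le) auto
    also have "\<dots> = M' * v (k + l)" by (simp add: M'_def v_def add_ac)
    finally show ?thesis .
  qed
  moreover have "v k \<le> growth (k + (w + rc))" for k
    unfolding v_def using card_annulus_le[of rc "k + w"] by (simp add: add_ac)
  ultimately have v: "v k \<le> M' * exp (Q * k)" if "k > 0" for k
    using supermultiplicative_le_exp[OF M', of v "w + rc" k] that by (simp add: v_def)
  define C where "C = M' + growth (w + rc)"
  have "real (card (annulus rc r)) \<le> C * exp (Q * r)" if r: "r \<ge> 0" for r
  proof (cases "r > w")
    case True
    have "real (card (annulus rc r)) \<le> M' * exp (Q * (r - w))" using v[of "r - w"] True by (simp add: v_def)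
    also have "\<dots> \<le> C * exp (Q * r)"
      using M M' Q by (intro mult_mono) (auto simp: C_def)
    finally show ?thesis .
  next
    case False
    have "real (card (annulus rc r)) \<le> growth (w + rc) * 1"
      using card_annulus_le[of rc r] growth_mono[of "r + rc" "w + rc"] False by simp
    also have "\<dots> \<le> C * exp (Q * r)"
      using M' Q r by (intro mult_mono) (auto simp: C_def)
    finally show ?thesis .
  qed
  moreover have "C > 0" using M' by (simp add: C_def add_pos_nonneg)
  ultimately show ?thesis using that by blast
qed

theorem growth_upper:
  assumes Q: "Q > 0"
  obtains C where "C > 0" "\<And>r. r \<ge> 0 \<Longrightarrow> growth r \<le> C * exp (Q * r)"
proof -
  obtain C where C: "C > 0" "\<And>r. r \<ge> 0 \<Longrightarrow> real (card (annulus rc r)) \<le> C * exp (Q * r)"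
    using annulus_upper[OF Q] by metis
  define K where "K = exp Q / (exp Q - 1)"
  have K: "K > 0" using Q by (simp add: K_def)
  have "growth r \<le> C * K * exp (Q * r)" if r: "r \<ge> 0" for r
  proof -
    let ?n = "nat \<lfloor>r\<rfloor>"
    have "ball_G r \<subseteq> (\<Union>j\<le>?n. annulus rc (real j))"
    proof
      fix g assume g: "g \<in> ball_G r"
      let ?j = "nat \<lfloor>len g\<rfloor>"
      have "real ?j \<le> len g" "len g \<le> real ?j + 1" using len_nonneg[of g] by linarith+
      then have "\<bar>len g - real ?j\<bar> \<le> rc" using rc_ge_1 by linarith
      moreover have "?j \<le> ?n" using g by (intro nat_mono floor_mono) (auto simp: ball_G_def)
      ultimately show "g \<in> (\<Union>j\<le>?n. annulus rc (real j))"
        using g by (intro UN_I[of ?j]) (auto simp: annulus_def ball_G_def simp del: of_nat_nat)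
    qed
    then have "card (ball_G r) \<le> card (\<Union>j\<le>?n. annulus rc (real j))" by (intro card_mono) auto
    also have "\<dots> \<le> (\<Sum>j\<le>?n. card (annulus rc (real j)))" by (rule card_UN_le) simp
    finally have "growth r \<le> (\<Sum>j\<le>?n. real (card (annulus rc (real j))))"
      unfolding growth_def by (simp flip: of_nat_sum)
    also have "\<dots> \<le> (\<Sum>j\<le>?n. C * exp (Q * real j))" by (intro sum_mono C) simp
    also have "\<dots> = C * (\<Sum>j\<le>?n. exp (Q * real j))" by (simp add: sum_distrib_left)
    also have "\<dots> \<le> C * (K * exp (Q * real ?n))"
      using C(1) sum_exp_le[OF Q] unfolding K_def by (intro mult_left_mono) auto
    also have "\<dots> \<le> C * (K * exp (Q * r))"
      using C(1) K Q r by (intro mult_left_mono) auto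
    finally show ?thesis by (simp add: mult.assoc)
  qed
  then show ?thesis using that[of "C * K"] C(1) K by simp
qed

text \<open>
  An element counted here factors as \<open>g = h k\<close>, where \<open>h x0\<close> lies at distance about \<open>m\<close> on a geodesic from
  \<open>x0\<close> to \<open>g x0\<close>. All these \<open>h x0\<close> are close to a geodesic from \<open>x0\<close> to \<open>z\<close>, which leaves boundedly many \<open>h\<close>,
  and the length of \<open>k\<close> is at most \<open>n - m\<close> up to a constant.
\<close>

theorem shadow_count:
  assumes Q: "Q > 0"
  obtains C where "C > 0" "\<And>n m z. n \<ge> 0 \<Longrightarrow>
    real (card {g \<in> ball_G n. gprod x0 (pt g) z \<ge> m}) \<le> C * exp (Q * (n - m))"
proof -
  obtain C where C: "C > 0" "\<And>r. r \<ge> 0 \<Longrightarrow> growth r \<le> C * exp (Q * r)"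
    using growth_upper[OF Q] by metis
  define B where "B = 4 * rc + 4 * \<delta>"
  have B0: "B \<ge> 0" using rc_ge_1 delta_nonneg by (simp add: B_def)
  define C' where "C' = growth (2 * B) * C * exp (Q * rc)"
  have C': "C' \<ge> C" "C' > 0"
  proof -
    have "1 * C * 1 \<le> C'" unfolding C'_def
      using growth_ge_1[of "2 * B"] B0 C Q rc_ge_1 by (intro mult_mono) auto
    then show "C' \<ge> C" by simp
    then show "C' > 0" using C by simp
  qed
  have "real (card {g \<in> ball_G n. gprod x0 (pt g) z \<ge> m}) \<le> C' * exp (Q * (n - m))" (is "real (card ?S) \<le> _")
    if n: "n \<ge> 0" for n m z
  proof (cases "m \<ge> 0")
    case False
    have "real (card ?S) \<le> growth n" unfolding growth_def by (simp add: card_mono)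
    also have "\<dots> \<le> C * exp (Q * n)" using C(2) n .
    also have "\<dots> \<le> C' * exp (Q * (n - m))" using C' C False Q by (intro mult_mono) auto
    finally show ?thesis .
  next
    case m: True
    show ?thesis
    proof (cases "?S = {}")
      case True
      then show ?thesis using C' by (simp only: True) simp
    next
      case False
      have len_ge: "len g \<ge> m" if "g \<in> ?S" for g
        using that gprod_le_dist[of x0 "pt g" z] by (auto simp: len_def)
      have "\<exists>p. fst p \<in> carrier G \<and> snd p \<in> carrier G \<and> g = fst p \<otimes> snd p \<and> len (fst p) \<le> m + rc \<and>
        len (snd p) \<le> n - m + rc \<and> gprod x0 (pt (fst p)) z \<ge> m - rc - \<delta>" if g: "g \<in> ?S" for g
      proof -
        obtain h k where hk: "h \<in> carrier G" "k \<in> carrier G" "g = h \<otimes> k"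
            "\<bar>len h - m\<bar> \<le> rc" "\<bar>len k - (len g - m)\<bar> \<le> rc"
          using between_G[of g m] g m len_ge[OF g] by (auto simp: ball_G_def)
        have "dist (pt h) (pt g) = len k"
          using dist_pt[of h g] hk by (simp add: m_assoc[symmetric])
        then have "gprod x0 (pt h) (pt g) \<ge> m - rc"
          using hk(4,5) by (simp add: gromov_product_def len_def dist_commute[of _ x0] abs_le_iff)
        then have "gprod x0 (pt h) z \<ge> m - rc - \<delta>"
          using hyp_ge[of "m - rc" "pt h" "pt g" z] g rc_ge_1 by simp
        then show ?thesis using hk g by (intro exI[of _ "(h, k)"]) (auto simp: ball_G_def)
      qed
      then have "\<exists>p. \<forall>g\<in>?S. fst (p g) \<in> carrier G \<and> snd (p g) \<in> carrier G \<and> g = fst (p g) \<otimes> snd (p g) \<and>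
          len (fst (p g)) \<le> m + rc \<and> len (snd (p g)) \<le> n - m + rc \<and> gprod x0 (pt (fst (p g))) z \<ge> m - rc - \<delta>"
        by (intro bchoice ballI)
      then obtain p where p: "\<forall>g\<in>?S. fst (p g) \<in> carrier G \<and> snd (p g) \<in> carrier G \<and> g = fst (p g) \<otimes> snd (p g) \<and>
          len (fst (p g)) \<le> m + rc \<and> len (snd (p g)) \<le> n - m + rc \<and> gprod x0 (pt (fst (p g))) z \<ge> m - rc - \<delta>" ..
      define h where "h g = fst (p g)" for g
      define k where "k g = snd (p g)" for g
      have hk: "h g \<in> carrier G \<and> k g \<in> carrier G \<and> g = h g \<otimes> k g \<and> len (h g) \<le> m + rc \<and>
        len (k g) \<le> n - m + rc \<and> gprod x0 (pt (h g)) z \<ge> m - rc - \<delta>" if "g \<in> ?S" for g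
        using p that unfolding h_def k_def by (rule bspec)
      obtain g0 where g0: "g0 \<in> ?S" using False by blast
      let ?N = "{u \<in> carrier G. dist (pt u) (pt (h g0)) \<le> B}"
      have "(\<lambda>g. (h g, k g)) ` ?S \<subseteq> ?N \<times> ball_G (n - m + rc)"
      proof (rule image_subsetI)
        fix g assume g: "g \<in> ?S"
        have "gprod x0 (pt (h g)) (pt (h g0)) \<ge> m - rc - 2 * \<delta>"
          using hyp_ge[of "m - rc - \<delta>" "pt (h g)" z "pt (h g0)"] hk[OF g] hk[OF g0]
          by (simp add: gprod_commute)
        then have "dist (pt (h g)) (pt (h g0)) \<le> B"
          using dist_eq_gprod[of "pt (h g)" "pt (h g0)" x0] hk[OF g] hk[OF g0]
          by (simp add: B_def len_def)
        then show "(h g, k g) \<in> ?N \<times> ball_G (n - m + rc)" using hk[OF g] by (simp add: ball_G_def)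
      qed
      moreover have "inj_on (\<lambda>g. (h g, k g)) ?S"
      proof (rule inj_onI)
        fix g g' assume "g \<in> ?S" "g' \<in> ?S" "(h g, k g) = (h g', k g')"
        then show "g = g'" using hk[of g] hk[of g'] by (metis prod.inject)
      qed
      moreover have "finite (?N \<times> ball_G (n - m + rc))" using card_near_pt_le(1) by auto
      ultimately have "card ?S \<le> card (?N \<times> ball_G (n - m + rc))" by (intro card_inj_on_le)
      then have "real (card ?S) \<le> real (card (?N \<times> ball_G (n - m + rc)))" by (rule of_nat_mono)
      also have "\<dots> = real (card ?N) * growth (n - m + rc)"
        unfolding growth_def card_cartesian_product by (rule of_nat_mult)
      also have "\<dots> \<le> growth (2 * B) * (C * exp (Q * (n - m + rc)))"
      proof (intro mult_mono card_near_pt_le C)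
        show "0 \<le> n - m + rc" using g0 len_ge[OF g0] rc_ge_1 by (auto simp: ball_G_def)
      qed (use C in auto)
      also have "\<dots> = C' * exp (Q * (n - m))"
        by (simp add: C'_def mult_ac flip: exp_add) (simp add: algebra_simps)
      finally show ?thesis .
    qed
  qed
  then show ?thesis using that C'(2) by blast
qed

end

section \<open>Conditionally negative functions from groups of subexponential growth\<close>

text \<open>
  When \<open>E\<close> is read as an inner product of vectors attached to the group elements, \<open>\<psi> (h\<^sup>-\<^sup>1 g)\<close> is the squared
  distance of the vectors of \<open>g\<close> and \<open>h\<close>. The diagonal terms cancel against coefficients of sum zero,
  which leaves \<open>-2\<close> times a positive form.
\<close>

lemma (in group) conditionally_negative_cocycle_form:
  fixes E :: "'a \<Rightarrow> 'a \<Rightarrow> real"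
  assumes \<psi>: "\<And>g h. g \<in> carrier G \<Longrightarrow> h \<in> carrier G \<Longrightarrow>
      \<psi> (inv h \<otimes> g) = E g g + E h h - E g h - E h g"
    and E: "\<And>(n :: nat) \<gamma> c. (\<And>i. i < n \<Longrightarrow> \<gamma> i \<in> carrier G) \<Longrightarrow> (\<Sum>i<n. c i) = 0 \<Longrightarrow>
      (\<Sum>i<n. \<Sum>j<n. c i * c j * E (\<gamma> i) (\<gamma> j)) \<ge> 0"
  shows "conditionally_negative G \<psi>"
  unfolding conditionally_negative_def
proof (intro allI impI)
  fix n :: nat and \<gamma> :: "nat \<Rightarrow> 'a" and c :: "nat \<Rightarrow> real"
  assume \<gamma>: "\<forall>i<n. \<gamma> i \<in> carrier G" and c: "(\<Sum>i<n. c i) = 0"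
  have "(\<Sum>i<n. \<Sum>j<n. c i * c j * \<psi> (inv (\<gamma> j) \<otimes> \<gamma> i)) =
      (\<Sum>i<n. \<Sum>j<n. c i * c j * E (\<gamma> i) (\<gamma> i) + c i * c j * E (\<gamma> j) (\<gamma> j)
        - c i * c j * E (\<gamma> i) (\<gamma> j) - c i * c j * E (\<gamma> j) (\<gamma> i))"
    by (intro sum.cong refl) (use \<gamma> in \<open>simp add: \<psi> algebra_simps\<close>)
  also have "\<dots> = (\<Sum>i<n. \<Sum>j<n. c i * c j * E (\<gamma> i) (\<gamma> i)) + (\<Sum>i<n. \<Sum>j<n. c i * c j * E (\<gamma> j) (\<gamma> j))
      - (\<Sum>i<n. \<Sum>j<n. c i * c j * E (\<gamma> i) (\<gamma> j)) - (\<Sum>i<n. \<Sum>j<n. c i * c j * E (\<gamma> j) (\<gamma> i))"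
    by (simp add: sum.distrib sum_subtractf)
  also have "(\<Sum>i<n. \<Sum>j<n. c i * c j * E (\<gamma> i) (\<gamma> i)) = (\<Sum>i<n. (c i * E (\<gamma> i) (\<gamma> i)) * (\<Sum>j<n. c j))"
    by (simp only: sum_distrib_left) (simp only: mult_ac)
  also have "\<dots> = 0" by (simp add: c)
  also have "(\<Sum>i<n. \<Sum>j<n. c i * c j * E (\<gamma> j) (\<gamma> j)) = (\<Sum>i<n. c i * (\<Sum>j<n. c j * E (\<gamma> j) (\<gamma> j)))"
    by (simp add: sum_distrib_left mult_ac)
  also have "\<dots> = (\<Sum>i<n. c i) * (\<Sum>j<n. c j * E (\<gamma> j) (\<gamma> j))" by (rule sum_distrib_right[symmetric])
  also have "\<dots> = 0" by (simp add: c)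
  also have "(\<Sum>i<n. \<Sum>j<n. c i * c j * E (\<gamma> j) (\<gamma> i)) = (\<Sum>i<n. \<Sum>j<n. c i * c j * E (\<gamma> i) (\<gamma> j))"
    by (subst sum.swap) (simp add: mult_ac)
  finally show "(\<Sum>i<n. \<Sum>j<n. c i * c j * \<psi> (inv (\<gamma> j) \<otimes> \<gamma> i)) \<le> 0"
    using E[of n \<gamma> c] \<gamma> c by simp
qed

context geometric_hyperbolic_action
begin

text \<open>
  Otherwise the growth would be multiplied by \<open>1 + e\<close> over every interval of length \<open>k\<close>.
\<close>

lemma slow_growth_step:
  assumes Q0: "Q = 0" and k: "k > 0" and e: "e > 0"
  obtains r where "r \<ge> 0" "growth (r + k) \<le> (1 + e) * growth r"
proof -
  have "\<exists>r\<ge>0. growth (r + k) \<le> (1 + e) * growth r"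
  proof (rule ccontr)
    assume "\<not> (\<exists>r\<ge>0. growth (r + k) \<le> (1 + e) * growth r)"
    then have step: "\<And>r. r \<ge> 0 \<Longrightarrow> growth (r + k) \<ge> (1 + e) * growth r" by force
    have pow: "(1 + e) ^ n \<le> growth (real n * k)" for n
    proof (induction n)
      case (Suc n)
      have "(1 + e) ^ Suc n \<le> (1 + e) * growth (real n * k)" using Suc e by (simp add: mult_left_mono)
      also have "\<dots> \<le> growth (real n * k + k)" using k by (intro step) simp
      finally show ?case by (simp add: algebra_simps)
    qed (simp add: growth_ge_1)
    define q where "q = ln (1 + e) / (2 * k)"
    have q: "q > 0" "q * k = ln (1 + e) / 2" using e k by (auto simp: q_def)
    define y where "y = exp (ln (1 + e) / 2)"
    have y: "y > 1" "y * y = 1 + e" using e by (auto simp: y_def simp flip: exp_add)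
    have "filterlim (\<lambda>n. real n * k) at_top sequentially"
      by (intro filterlim_at_top_mult_tendsto_pos[of _ k] tendsto_const k filterlim_real_sequentially)
    then have "eventually (\<lambda>n. growth (real n * k) \<le> growth 0 * exp (q * (real n * k + 1))) sequentially"
      using eventually_compose_filterlim[OF eventually_growth_le[of q]] Q0 q(1) by simp
    then have "eventually (\<lambda>n. y ^ n \<le> growth 0 * exp q) sequentially"
    proof eventually_elim
      case (elim n)
      have "y ^ n * y ^ n \<le> growth 0 * exp (q * (real n * k + 1))"
        using pow[of n] elim by (simp add: y(2)[symmetric] power_mult_distrib)
      also have "exp (q * (real n * k + 1)) = y ^ n * exp q"
        unfolding y_def exp_of_nat_mult[symmetric] q(2)[symmetric] by (simp add: algebra_simps flip: exp_add)
      finally have "y ^ n * y ^ n \<le> y ^ n * (growth 0 * exp q)" by (simp add: mult_ac)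
      then show ?case using y(1) by simp
    qed
    moreover obtain N where N: "growth 0 * exp q < y ^ N" using real_arch_pow[OF y(1)] by blast
    moreover have "eventually (\<lambda>n. y ^ n \<ge> y ^ N) sequentially"
      using eventually_ge_at_top[of N] by eventually_elim (use y(1) in \<open>simp add: power_increasing\<close>)
    ultimately have "eventually (\<lambda>n. y ^ n \<le> growth 0 * exp q \<and> y ^ N \<le> y ^ n) sequentially"
      by (simp add: eventually_conj)
    then obtain n where "y ^ n \<le> growth 0 * exp q" "y ^ N \<le> y ^ n"
      unfolding eventually_sequentially by blast
    then show False using N by linarith
  qed
  then show ?thesis using that by blast
qed

definition translate_overlap :: "real \<Rightarrow> 'g \<Rightarrow> 'g \<Rightarrow> real" where
  "translate_overlap r g h = real (card ({x \<in> carrier G. inv g \<otimes> x \<in> ball_G r} \<inter> {x \<in> carrier G. inv h \<otimes> x \<in> ball_G r}))"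

lemma translate_eq: "g \<in> carrier G \<Longrightarrow> {x \<in> carrier G. inv g \<otimes> x \<in> ball_G r} = (\<lambda>x. g \<otimes> x) ` ball_G r"
proof -
  assume g: "g \<in> carrier G"
  have "x \<in> (\<lambda>x. g \<otimes> x) ` ball_G r" if "x \<in> carrier G" "inv g \<otimes> x \<in> ball_G r" for x
  proof -
    have "x = g \<otimes> (inv g \<otimes> x)" using g that by (simp add: m_assoc[symmetric])
    then show ?thesis using that by blast
  qed
  then show ?thesis using g by (auto simp: ball_G_def inv_mult_cancel)
qed

lemma finite_translate [simp]: "g \<in> carrier G \<Longrightarrow> finite {x \<in> carrier G. inv g \<otimes> x \<in> ball_G r}"
  by (simp add: translate_eq)

lemma translate_overlap_self: "g \<in> carrier G \<Longrightarrow> translate_overlap r g g = growth r"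
  unfolding translate_overlap_def Int_absorb growth_def
  by (simp only: translate_eq, subst card_image) (auto simp: inj_on_def ball_G_def)

lemma translate_overlap_left:
  assumes a: "a \<in> carrier G" and g: "g \<in> carrier G" and h: "h \<in> carrier G"
  shows "translate_overlap r (a \<otimes> g) (a \<otimes> h) = translate_overlap r g h"
proof -
  let ?S = "\<lambda>g. {x \<in> carrier G. inv g \<otimes> x \<in> ball_G r}"
  have "?S (a \<otimes> g) \<inter> ?S (a \<otimes> h) = (\<lambda>x. a \<otimes> x) ` (?S g \<inter> ?S h)"
  proof (intro equalityI subsetI)
    fix x assume x: "x \<in> ?S (a \<otimes> g) \<inter> ?S (a \<otimes> h)"
    then have "x = a \<otimes> (inv a \<otimes> x)" using a by (simp add: m_assoc[symmetric])
    moreover have "inv a \<otimes> x \<in> ?S g \<inter> ?S h" using x a g h by (auto simp: inv_mult_group m_assoc)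
    ultimately show "x \<in> (\<lambda>x. a \<otimes> x) ` (?S g \<inter> ?S h)" by blast
  qed (use a g h in \<open>auto simp: inv_mult_group m_assoc inv_mult_cancel\<close>)
  moreover have "inj_on (\<lambda>x. a \<otimes> x) (?S g \<inter> ?S h)" using a by (auto simp: inj_on_def)
  ultimately show ?thesis by (simp add: translate_overlap_def card_image)
qed

lemma translate_overlap_commute: "translate_overlap r g h = translate_overlap r h g"
  by (simp add: translate_overlap_def Int_commute)

text \<open>
  The overlaps form the Gram matrix of the indicator functions of the translates.
\<close>

lemma translate_overlap_pos_def:
  fixes n :: nat
  assumes "\<And>i. i < n \<Longrightarrow> \<gamma> i \<in> carrier G"
  shows "(\<Sum>i<n. \<Sum>j<n. c i * c j * translate_overlap r (\<gamma> i) (\<gamma> j)) \<ge> 0"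
proof -
  let ?S = "\<lambda>g. {x \<in> carrier G. inv g \<otimes> x \<in> ball_G r}"
  define T where "T = (\<Union>i<n. ?S (\<gamma> i))"
  have T: "finite T" unfolding T_def by (rule finite_UN_I) (use assms in auto)
  have "translate_overlap r (\<gamma> i) (\<gamma> j) = (\<Sum>x\<in>T. indicator (?S (\<gamma> i)) x * indicator (?S (\<gamma> j)) x)" if "i < n" "j < n" for i j
  proof -
    have "translate_overlap r (\<gamma> i) (\<gamma> j) = (\<Sum>x\<in>T. indicator (?S (\<gamma> i) \<inter> ?S (\<gamma> j)) x)"
    proof -
      let ?I = "?S (\<gamma> i) \<inter> ?S (\<gamma> j)"
      have "?I \<subseteq> T" using that by (auto simp: T_def)
      then have "(\<Sum>x\<in>T. indicator ?I x) = (\<Sum>x\<in>?I. 1 :: real)"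
        by (intro sum.mono_neutral_cong_right T) auto
      then show ?thesis by (simp add: translate_overlap_def)
    qed
    then show ?thesis by (simp add: indicator_inter_arith)
  qed
  then have "(\<Sum>i<n. \<Sum>j<n. c i * c j * translate_overlap r (\<gamma> i) (\<gamma> j)) =
      (\<Sum>i<n. \<Sum>j<n. \<Sum>x\<in>T. (c i * indicator (?S (\<gamma> i)) x) * (c j * indicator (?S (\<gamma> j)) x))"
    by (intro sum.cong refl) (simp add: sum_distrib_left mult_ac)
  also have "\<dots> = (\<Sum>i<n. \<Sum>x\<in>T. \<Sum>j<n. (c i * indicator (?S (\<gamma> i)) x) * (c j * indicator (?S (\<gamma> j)) x))"
    by (intro sum.cong refl) (rule sum.swap)
  also have "\<dots> = (\<Sum>x\<in>T. \<Sum>i<n. \<Sum>j<n. (c i * indicator (?S (\<gamma> i)) x) * (c j * indicator (?S (\<gamma> j)) x))"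
    by (rule sum.swap)
  also have "\<dots> = (\<Sum>x\<in>T. (\<Sum>i<n. c i * indicator (?S (\<gamma> i)) x)\<^sup>2)"
    by (simp only: power2_eq_square sum_product)
  also have "\<dots> \<ge> 0" by (intro sum_nonneg) simp
  finally show ?thesis .
qed

lemma translate_overlap_one:
  assumes g: "g \<in> carrier G"
  shows "growth r - translate_overlap r \<one> g \<le> growth (r + len g) - growth r" "translate_overlap r \<one> g \<le> growth r"
    "len g > 2 * r \<Longrightarrow> translate_overlap r \<one> g = 0"
proof -
  let ?A = "ball_G r" and ?B = "(\<lambda>x. g \<otimes> x) ` ball_G r"
  have A: "{x \<in> carrier G. inv \<one> \<otimes> x \<in> ball_G r} = ?A" by (auto simp: ball_G_def)
  have eq: "translate_overlap r \<one> g = real (card (?A \<inter> ?B))"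
    unfolding translate_overlap_def A translate_eq[OF g] ..
  have cB: "card ?B = card ?A" using g by (intro card_image) (auto simp: inj_on_def ball_G_def)
  have AB: "?A \<union> ?B \<subseteq> ball_G (r + len g)"
  proof
    fix y assume "y \<in> ?A \<union> ?B"
    then obtain x where x: "x \<in> ?A" "y = x \<or> y = g \<otimes> x" by blast
    then show "y \<in> ball_G (r + len g)"
      using g len_mult_le[of g x] len_nonneg[of g] by (auto simp: ball_G_def add_increasing2)
  qed
  have "card (?A \<union> ?B) + card (?A \<inter> ?B) = card ?A + card ?B"
    by (rule card_Un_Int[symmetric]) auto
  moreover have "card (?A \<union> ?B) \<le> card (ball_G (r + len g))" using AB by (intro card_mono) auto
  ultimately have "card ?A + card ?A \<le> card (ball_G (r + len g)) + card (?A \<inter> ?B)" using cB by simp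
  then show "growth r - translate_overlap r \<one> g \<le> growth (r + len g) - growth r"
    unfolding eq growth_def by linarith
  show "translate_overlap r \<one> g \<le> growth r"
    unfolding eq growth_def by (simp add: card_mono)
  assume far: "len g > 2 * r"
  have "?A \<inter> ?B = {}"
  proof (rule ccontr)
    assume "?A \<inter> ?B \<noteq> {}"
    then obtain x where x: "x \<in> carrier G" "len x \<le> r" "len (g \<otimes> x) \<le> r" by (auto simp: ball_G_def)
    have "g = (g \<otimes> x) \<otimes> inv x" using g x by (simp add: m_assoc)
    then have "len g \<le> len (g \<otimes> x) + len (inv x)" using len_mult_le[of "g \<otimes> x" "inv x"] g x by simp
    then show False using far x by simp
  qed
  then show "translate_overlap r \<one> g = 0" by (simp add: eq)
qed

text \<open>
  When the growth is subexponential, the balls contain a Foelner sequence, and a weighted sum of the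
  relative sizes of the symmetric differences of \<open>g B\<close> and \<open>B\<close>, over Foelner balls \<open>B\<close>, is proper
  and conditionally negative.
\<close>

theorem haagerup_if_subexponential:
  assumes Q0: "Q = 0"
  shows "haagerup G"
proof -
  have "\<exists>r\<ge>0. growth (r + (real k + 1)) \<le> (1 + (1/4) ^ k) * growth r" for k :: nat
    using slow_growth_step[OF Q0, of "real k + 1" "(1/4) ^ k"] by force
  then obtain r where r: "\<And>k. r k \<ge> 0" "\<And>k. growth (r k + (real k + 1)) \<le> (1 + (1/4) ^ k) * growth (r k)"
    by metis
  have gpos: "growth (r k) > 0" for k using growth_ge_1[OF r(1)[of k]] by linarith
  \<comment> \<open>The weight \<open>2\<^sup>k\<close> makes the sum unbounded on distant elements, and the defect \<open>4\<^sup>-\<^sup>k\<close> keeps it finite.\<close>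
  define a where "a k g = 2 ^ k * (2 * (growth (r k) - translate_overlap (r k) \<one> g) / growth (r k))" for k g
  have a_nonneg: "a k g \<ge> 0" if "g \<in> carrier G" for k g
    unfolding a_def using translate_overlap_one(2)[OF that] gpos[of k] by simp
  have a_summable: "summable (\<lambda>k. a k g)" if g: "g \<in> carrier G" for g
  proof (rule summable_comparison_test_ev)
    show "summable (\<lambda>k. 2 * (1/2 :: real) ^ k)" by (intro summable_mult summable_geometric) simp
    show "\<forall>\<^sub>F k in sequentially. norm (a k g) \<le> 2 * (1/2) ^ k"
      using eventually_ge_at_top[of "nat \<lceil>len g\<rceil>"]
    proof eventually_elim
      case (elim k)
      then have "len g \<le> real k + 1" by linarith
      then have "growth (r k + len g) \<le> (1 + (1/4) ^ k) * growth (r k)"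
        using r(2)[of k] growth_mono[of "r k + len g" "r k + (real k + 1)"] by linarith
      then have "growth (r k) - translate_overlap (r k) \<one> g \<le> (1/4) ^ k * growth (r k)"
        using translate_overlap_one(1)[OF g, of "r k"] by (simp add: algebra_simps)
      then have "2 * (growth (r k) - translate_overlap (r k) \<one> g) / growth (r k) \<le> 2 * (1/4) ^ k"
        using gpos[of k] by (simp add: field_simps)
      then have "a k g \<le> 2 ^ k * (2 * (1/4) ^ k)" unfolding a_def by (intro mult_left_mono) auto
      also have "\<dots> = 2 * (1/2) ^ k" by (simp flip: power_mult_distrib)
      finally show ?case using a_nonneg[OF g, of k] by simp
    qed
  qed
  define \<psi> where "\<psi> g = (\<Sum>k. a k g)" for g
  have \<psi>_ge: "a k g \<le> \<psi> g" if g: "g \<in> carrier G" for k g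
    unfolding \<psi>_def using sum_le_suminf[OF a_summable[OF g], of "{k}"] a_nonneg[OF g] by simp
  have "\<psi> g \<ge> 0" if "g \<in> carrier G" for g
    using \<psi>_ge[OF that] a_nonneg[OF that] order_trans by blast
  moreover have "finite {g \<in> carrier G. \<psi> g \<le> R}" for R
  proof -
    obtain k :: nat where k: "R < 2 ^ k" using real_arch_pow[of 2 R] by auto
    have "{g \<in> carrier G. \<psi> g \<le> R} \<subseteq> ball_G (2 * r k)"
    proof (rule ccontr)
      assume "\<not> {g \<in> carrier G. \<psi> g \<le> R} \<subseteq> ball_G (2 * r k)"
      then obtain g where g: "g \<in> carrier G" "\<psi> g \<le> R" "len g > 2 * r k" by (force simp: ball_G_def)
      have "a k g = 2 ^ k * 2"
        unfolding a_def using translate_overlap_one(3)[OF g(1,3)] gpos[of k] by simp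
      then have "2 ^ k * 2 \<le> R" using \<psi>_ge[OF g(1), of k] g(2) by simp
      moreover have "(2::real) ^ k > 0" by simp
      ultimately show False using k by linarith
    qed
    then show ?thesis using finite_subset finite_ball_G by blast
  qed
  moreover have "conditionally_negative G \<psi>"
    unfolding conditionally_negative_def
  proof (intro allI impI)
    fix n :: nat and \<gamma> :: "nat \<Rightarrow> 'g" and c :: "nat \<Rightarrow> real"
    assume n: "n \<ge> 1" and \<gamma>: "\<forall>i<n. \<gamma> i \<in> carrier G" and c: "(\<Sum>i<n. c i) = 0"
    have cn: "conditionally_negative G (a k)" for k
    proof (rule conditionally_negative_cocycle_form)
      let ?E = "\<lambda>g h. 2 ^ k / growth (r k) * translate_overlap (r k) g h"
      show "a k (inv h \<otimes> g) = ?E g g + ?E h h - ?E g h - ?E h g" if g: "g \<in> carrier G" "h \<in> carrier G" for g h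
        using translate_overlap_left[of "inv h" h g "r k"] translate_overlap_commute[of "r k" g h] g gpos[of k]
        by (simp add: a_def translate_overlap_self field_simps)
      show "0 \<le> (\<Sum>i<n. \<Sum>j<n. c i * c j * ?E (\<gamma> i) (\<gamma> j))" if "\<And>i. i < n \<Longrightarrow> \<gamma> i \<in> carrier G" for n and \<gamma> :: "nat \<Rightarrow> 'g" and c :: "nat \<Rightarrow> real"
      proof -
        have "(\<Sum>i<n. \<Sum>j<n. c i * c j * ?E (\<gamma> i) (\<gamma> j)) =
            2 ^ k / growth (r k) * (\<Sum>i<n. \<Sum>j<n. c i * c j * translate_overlap (r k) (\<gamma> i) (\<gamma> j))"
          unfolding sum_distrib_left by (intro sum.cong refl) simp
        then show ?thesis using translate_overlap_pos_def[of n \<gamma> c "r k"] that gpos[of k] by simp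
      qed
    qed
    have G: "inv (\<gamma> j) \<otimes> \<gamma> i \<in> carrier G" if "i < n" "j < n" for i j using \<gamma> that by simp
    have "(\<lambda>k. \<Sum>i<n. \<Sum>j<n. c i * c j * a k (inv (\<gamma> j) \<otimes> \<gamma> i)) sums
        (\<Sum>i<n. \<Sum>j<n. c i * c j * \<psi> (inv (\<gamma> j) \<otimes> \<gamma> i))"
      unfolding \<psi>_def by (intro sums_sum sums_mult summable_sums a_summable G) auto
    moreover have le: "(\<Sum>i<n. \<Sum>j<n. c i * c j * a k (inv (\<gamma> j) \<otimes> \<gamma> i)) \<le> 0" for k
      by (rule cn[unfolded conditionally_negative_def, rule_format]) (use n \<gamma> c in auto)
    ultimately show "(\<Sum>i<n. \<Sum>j<n. c i * c j * \<psi> (inv (\<gamma> j) \<otimes> \<gamma> i)) \<le> 0"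
      by (intro sums_le[OF le _ sums_zero])
  qed
  ultimately show ?thesis unfolding haagerup_def by blast
qed

end

section \<open>The Gromov boundary\<close>

lemma filterlim_prod_sequentially_at_top:
  fixes f :: "nat \<Rightarrow> nat \<Rightarrow> real"
  shows "(LIM (i, j) (sequentially \<times>\<^sub>F sequentially). f i j :> at_top) \<longleftrightarrow>
    (\<forall>R. \<exists>N. \<forall>i\<ge>N. \<forall>j\<ge>N. R \<le> f i j)"
  unfolding filterlim_at_top eventually_prod_sequentially by (auto; meson)

locale good_hyperbolic_action = geometric_hyperbolic_action G \<phi> x0 \<delta>
  for G :: "('g, 'm) monoid_scheme" (structure) and \<phi> :: "'g \<Rightarrow> 'a::metric_space \<Rightarrow> 'a" and x0 \<delta> +
  fixes \<epsilon> :: real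
  assumes eps: "\<epsilon> > 0" and good: "good_space x0 \<epsilon>"
begin

abbreviation bd :: "(nat \<Rightarrow> 'a) set set" where "bd \<equiv> gromov_boundary x0"

abbreviation vd :: "(nat \<Rightarrow> 'a) set \<Rightarrow> (nat \<Rightarrow> 'a) set \<Rightarrow> real" where "vd \<equiv> visual_dist x0 \<epsilon> x0"

abbreviation D :: real where "D \<equiv> boundary_dim G \<phi> x0 \<epsilon>"

lemma eps_D: "\<epsilon> * D = Q" using eps by (simp add: boundary_dim_def Q_def)

lemma D_pos: "Q > 0 \<Longrightarrow> D > 0" using eps eps_D by (metis zero_less_mult_pos)

lemma exp_eps_powr_D: "exp (- \<epsilon> * m) powr D = exp (- Q * m)"
  by (simp add: powr_def eps_D[symmetric] mult_ac)

subsection \<open>Sequences\<close>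

lemma gromov_sequences_iff:
  "x \<in> gromov_sequences x0 \<longleftrightarrow> (\<forall>R. \<exists>N. \<forall>i\<ge>N. \<forall>j\<ge>N. R \<le> gprod x0 (x i) (x j))"
  by (simp add: gromov_sequences_def filterlim_prod_sequentially_at_top)

lemma gromov_equiv_iff:
  "(x, y) \<in> gromov_equiv x0 \<longleftrightarrow> x \<in> gromov_sequences x0 \<and> y \<in> gromov_sequences x0 \<and>
    (\<forall>R. \<exists>N. \<forall>i\<ge>N. \<forall>j\<ge>N. R \<le> gprod x0 (x i) (y j))"
  by (simp add: gromov_equiv_def filterlim_prod_sequentially_at_top)

lemma gromov_equiv_trans:
  assumes "(x, y) \<in> gromov_equiv x0" "(y, z) \<in> gromov_equiv x0"
  shows "(x, z) \<in> gromov_equiv x0"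
proof -
  have "\<exists>N. \<forall>i\<ge>N. \<forall>j\<ge>N. R \<le> gprod x0 (x i) (z j)" for R
  proof -
    obtain N N' where "\<forall>i\<ge>N. \<forall>j\<ge>N. R + \<delta> \<le> gprod x0 (x i) (y j)"
      "\<forall>i\<ge>N'. \<forall>j\<ge>N'. R + \<delta> \<le> gprod x0 (y i) (z j)"
      using assms unfolding gromov_equiv_iff by meson
    then have "R \<le> gprod x0 (x i) (z j)" if "i \<ge> max N N'" "j \<ge> max N N'" for i j
      using that hyp_ge[of "R + \<delta>" "x i" "y (max N N')" "z j"] by simp
    then show ?thesis by blast
  qed
  then show ?thesis using assms by (simp add: gromov_equiv_iff)
qed

lemma equiv_gromov: "equiv (gromov_sequences x0) (gromov_equiv x0)"
proof (rule equivI)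
  show "gromov_equiv x0 \<subseteq> gromov_sequences x0 \<times> gromov_sequences x0"
    by (auto simp: gromov_equiv_def)
  show "refl_on (gromov_sequences x0) (gromov_equiv x0)"
    unfolding refl_on_def gromov_equiv_iff by (auto simp: gromov_sequences_iff)
  show "sym (gromov_equiv x0)"
    unfolding sym_def gromov_equiv_iff by (metis gprod_commute)
  show "trans (gromov_equiv x0)" unfolding trans_def using gromov_equiv_trans by blast
qed

lemma boundary_repr: "\<xi> \<in> bd \<Longrightarrow> \<exists>x. x \<in> \<xi>"
  unfolding gromov_boundary_def using equiv_gromov by (metis ex_in_conv in_quotient_imp_non_empty)

lemma boundary_equiv: "\<xi> \<in> bd \<Longrightarrow> x \<in> \<xi> \<Longrightarrow> y \<in> \<xi> \<Longrightarrow> (x, y) \<in> gromov_equiv x0"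
  unfolding gromov_boundary_def using equiv_gromov by (metis in_quotient_imp_in_rel empty_subsetI insert_subset)

lemma boundary_closed: "\<xi> \<in> bd \<Longrightarrow> x \<in> \<xi> \<Longrightarrow> (x, y) \<in> gromov_equiv x0 \<Longrightarrow> y \<in> \<xi>"
  unfolding gromov_boundary_def by (rule in_quotient_imp_closed[OF equiv_gromov])

lemma boundary_sequence: "\<xi> \<in> bd \<Longrightarrow> x \<in> \<xi> \<Longrightarrow> x \<in> gromov_sequences x0"
  using boundary_equiv[of \<xi> x x] by (simp add: gromov_equiv_iff)

lemma boundary_class:
  assumes "x \<in> gromov_sequences x0"
  shows "gromov_equiv x0 `` {x} \<in> bd" "x \<in> gromov_equiv x0 `` {x}"
  unfolding gromov_boundary_def using assms equiv_class_self[OF equiv_gromov] by (auto intro: quotientI)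

subsection \<open>Limits of Gromov products\<close>

text \<open>
  In the definition of the basic neighbourhoods, the sequence \<open>x\<close> itself approximates \<open>\<xi>\<close> and a constant
  sequence approximates the point \<open>x n\<close>.
\<close>

lemma tendsto_bord:
  assumes \<xi>: "\<xi> \<in> bd" "x \<in> \<xi>"
  shows "limitin (bord_topology x0) (\<lambda>i. Inl (x i)) (Inr \<xi>) sequentially"
  unfolding limitin_def
proof (intro conjI allI impI)
  have top: "openin (bord_topology x0) (bordification x0)"
    unfolding openin_bord_topology by (auto simp: bordification_def boundary_nhd_def vimage_def Plus_def)
  then show "Inr \<xi> \<in> topspace (bord_topology x0)"
    using \<xi> openin_subset by (fastforce simp: bordification_def)
  fix U assume "openin (bord_topology x0) U \<and> Inr \<xi> \<in> U"
  then obtain R where R: "boundary_nhd x0 \<xi> R \<subseteq> U" unfolding openin_bord_topology by blast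
  obtain N where N: "\<And>i j. i \<ge> N \<Longrightarrow> j \<ge> N \<Longrightarrow> R + 1 \<le> gprod x0 (x i) (x j)"
    using boundary_sequence[OF \<xi>] unfolding gromov_sequences_iff by meson
  have "Inl (x n) \<in> boundary_nhd x0 \<xi> R" if n: "n \<ge> N" for n
  proof -
    have "ereal (R + 1) \<le> Liminf (sequentially \<times>\<^sub>F sequentially) (\<lambda>(i, j). ereal (gprod x0 (x i) (x n)))"
      by (rule Liminf_bounded) (use N n in \<open>auto simp: eventually_prod_sequentially\<close>)
    then have "ereal R < Liminf (sequentially \<times>\<^sub>F sequentially) (\<lambda>(i, j). ereal (gprod x0 (x i) (x n)))"
      by (rule less_le_trans[rotated]) simp
    moreover have "seq_tends_to (\<lambda>_. x n) (Inl (x n))" "seq_tends_to x (Inr \<xi>)"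
      using \<xi> by (simp_all add: seq_tends_to_def)
    ultimately have "\<exists>x' y. seq_tends_to x' (Inr \<xi>) \<and> seq_tends_to y (Inl (x n)) \<and>
        ereal R < Liminf (sequentially \<times>\<^sub>F sequentially) (\<lambda>(i, j). ereal (gprod x0 (x' i) (y j)))"
      by (intro exI[of _ x] exI[of _ "\<lambda>_. x n"]) simp
    then show ?thesis by (simp add: boundary_nhd_def bordification_def Plus_def)
  qed
  then show "\<forall>\<^sub>F n in sequentially. Inl (x n) \<in> U"
    using R by (auto simp: eventually_sequentially)
qed

lemma tendsto_bord_const: "limitin (bord_topology x0) (\<lambda>i. Inl z) (Inl z) sequentially"
proof -
  have "openin (bord_topology x0) (bordification x0)"
    unfolding openin_bord_topology by (auto simp: bordification_def boundary_nhd_def vimage_def Plus_def)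
  then have "Inl z \<in> topspace (bord_topology x0)"
    using openin_subset by (fastforce simp: bordification_def)
  then show ?thesis by (simp add: limitin_def)
qed

lemma continuous_extension_extended_gprod:
  "continuous_extension x0 q (\<lambda>(c, c'). extended_gprod x0 q c c')"
proof -
  have "\<exists>F. continuous_extension x0 q F" using good by (simp add: good_space_def)
  then have "continuous_extension x0 q (SOME F. continuous_extension x0 q F)" by (rule someI_ex)
  then show ?thesis unfolding extended_gprod_def by simp
qed

lemma extended_gprod_tendsto:
  assumes "limitin (bord_topology x0) (\<lambda>i. Inl (x i)) c sequentially"
    and "limitin (bord_topology x0) (\<lambda>i. Inl (y i)) c' sequentially"
  shows "(\<lambda>n. ereal (gprod q (x n) (y n))) \<longlonglongrightarrow> extended_gprod x0 q c c'"
proof -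
  let ?F = "\<lambda>(c, c'). extended_gprod x0 q c c'"
  have F: "continuous_map (prod_topology (bord_topology x0) (bord_topology x0)) euclidean ?F"
    "\<And>x y. extended_gprod x0 q (Inl x) (Inl y) = ereal (gprod q x y)"
    using continuous_extension_extended_gprod[of q] unfolding continuous_extension_def by auto
  have "limitin (prod_topology (bord_topology x0) (bord_topology x0)) (\<lambda>i. (Inl (x i), Inl (y i))) (c, c') sequentially"
    using assms by (simp add: limitin_pairwise o_def)
  from continuous_map_limit[OF F(1) this] show ?thesis by (simp add: o_def F(2))
qed

lemma gprod_tendsto:
  "\<xi> \<in> bd \<Longrightarrow> x \<in> \<xi> \<Longrightarrow> \<eta> \<in> bd \<Longrightarrow> y \<in> \<eta> \<Longrightarrow>
    (\<lambda>n. ereal (gprod q (x n) (y n))) \<longlonglongrightarrow> extended_gprod x0 q (Inr \<xi>) (Inr \<eta>)"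
  by (intro extended_gprod_tendsto tendsto_bord)

text \<open>
  The Gromov product of a boundary point and a point of the space. Where it is large, \<open>\<xi>\<close> lies in the
  shadow that \<open>z\<close> casts on the boundary from \<open>x0\<close>.
\<close>

definition shadow_depth :: "'a \<Rightarrow> (nat \<Rightarrow> 'a) set \<Rightarrow> real" where
  "shadow_depth z \<xi> = real_of_ereal (extended_gprod x0 x0 (Inr \<xi>) (Inl z))"

lemma shadow_depth_tendsto:
  assumes "\<xi> \<in> bd" "x \<in> \<xi>"
  shows "(\<lambda>n. gprod x0 (x n) z) \<longlonglongrightarrow> shadow_depth z \<xi>"
proof -
  let ?g = "extended_gprod x0 x0 (Inr \<xi>) (Inl z)"
  have lim: "(\<lambda>n. ereal (gprod x0 (x n) z)) \<longlonglongrightarrow> ?g"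
    using assms by (intro extended_gprod_tendsto tendsto_bord tendsto_bord_const)
  have "0 \<le> ?g" by (rule LIMSEQ_le_const[OF lim]) (simp add: gprod_nonneg)
  moreover have "?g \<le> ereal (dist x0 z)" by (rule LIMSEQ_le_const2[OF lim]) (simp add: gprod_le_dist')
  ultimately have "\<bar>?g\<bar> \<noteq> \<infinity>" by auto
  then have "ereal (real_of_ereal ?g) = ?g" by (rule ereal_real')
  then show ?thesis using lim unfolding shadow_depth_def by (metis lim_ereal)
qed

lemma shadow_depth_bounds:
  assumes "\<xi> \<in> bd" shows "0 \<le> shadow_depth z \<xi>" "shadow_depth z \<xi> \<le> dist x0 z"
proof -
  obtain x where x: "x \<in> \<xi>" using boundary_repr assms by blast
  note lim = shadow_depth_tendsto[OF assms x, of z]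
  show "0 \<le> shadow_depth z \<xi>" by (rule LIMSEQ_le_const[OF lim]) (simp add: gprod_nonneg)
  show "shadow_depth z \<xi> \<le> dist x0 z" by (rule LIMSEQ_le_const2[OF lim]) (simp add: gprod_le_dist')
qed

text \<open>
  Any representatives compute the visual metric as a limit, so that every estimate of it is inherited from
  the space.
\<close>

lemma visual_dist_tendsto:
  assumes "\<xi> \<in> bd" "x \<in> \<xi>" "\<eta> \<in> bd" "y \<in> \<eta>"
  shows "(\<lambda>n. exp (- \<epsilon> * gprod q (x n) (y n))) \<longlonglongrightarrow> visual_dist x0 \<epsilon> q \<xi> \<eta>"
proof -
  let ?g = "extended_gprod x0 q (Inr \<xi>) (Inr \<eta>)"
  have lim: "(\<lambda>n. ereal (gprod q (x n) (y n))) \<longlonglongrightarrow> ?g" using gprod_tendsto assms by blast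
  have g0: "0 \<le> ?g" by (rule LIMSEQ_le_const[OF lim]) (simp add: gprod_nonneg)
  show ?thesis
  proof (cases "?g = \<infinity>")
    case True
    then have "filterlim (\<lambda>n. gprod q (x n) (y n)) at_top sequentially"
      using lim by (simp add: tendsto_PInfty_eq_at_top)
    then have "filterlim (\<lambda>n. - \<epsilon> * gprod q (x n) (y n)) at_bot sequentially"
      using eps by (intro filterlim_tendsto_neg_mult_at_bot[of _ "- \<epsilon>"]) auto
    then have "(\<lambda>n. exp (- \<epsilon> * gprod q (x n) (y n))) \<longlonglongrightarrow> 0"
      by (rule filterlim_compose[OF exp_at_bot])
    then show ?thesis using assms True by (simp add: visual_dist_def)
  next
    case False
    then have "ereal (real_of_ereal ?g) = ?g" using g0 by (intro ereal_real') auto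
    then have "(\<lambda>n. gprod q (x n) (y n)) \<longlonglongrightarrow> real_of_ereal ?g" using lim by (metis lim_ereal)
    then have "(\<lambda>n. exp (- \<epsilon> * gprod q (x n) (y n))) \<longlonglongrightarrow> exp (- \<epsilon> * real_of_ereal ?g)"
      by (intro tendsto_intros)
    then show ?thesis using assms False by (simp add: visual_dist_def Let_def)
  qed
qed

sublocale vis: Metric_space bd vd
  using good by (simp add: good_space_def)

lemma vd_le_1:
  assumes "\<xi> \<in> bd" "\<eta> \<in> bd" shows "vd \<xi> \<eta> \<le> 1"
proof -
  obtain x y where "x \<in> \<xi>" "y \<in> \<eta>" using boundary_repr assms by blast
  from visual_dist_tendsto[OF assms(1) this(1) assms(2) this(2), of x0] show ?thesis
    by (rule LIMSEQ_le_const2) (use eps in \<open>simp add: gprod_nonneg\<close>)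
qed

lemma vd_le_shadow_depth:
  assumes \<xi>: "\<xi> \<in> bd" and \<eta>: "\<eta> \<in> bd"
  shows "vd \<xi> \<eta> \<le> exp (- \<epsilon> * (min (shadow_depth z \<xi>) (shadow_depth z \<eta>) - \<delta>))"
proof -
  obtain x y where xy: "x \<in> \<xi>" "y \<in> \<eta>" using boundary_repr \<xi> \<eta> by blast
  have "(\<lambda>n. exp (- \<epsilon> * (min (gprod x0 (x n) z) (gprod x0 (y n) z) - \<delta>))) \<longlonglongrightarrow>
      exp (- \<epsilon> * (min (shadow_depth z \<xi>) (shadow_depth z \<eta>) - \<delta>))"
    by (intro tendsto_intros shadow_depth_tendsto \<xi> \<eta> xy)
  moreover have "exp (- \<epsilon> * gprod x0 (x n) (y n)) \<le> exp (- \<epsilon> * (min (gprod x0 (x n) z) (gprod x0 (y n) z) - \<delta>))" for n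
    using hyp[of "x n" z "y n"] eps by (simp add: gprod_commute[of x0 z])
  ultimately show ?thesis
    using visual_dist_tendsto[OF \<xi> xy(1) \<eta> xy(2), of x0] by (blast intro: LIMSEQ_le)
qed

lemma eventually_gprod_ge:
  assumes "\<xi> \<in> bd" "x \<in> \<xi>" "\<eta> \<in> bd" "y \<in> \<eta>" and "vd \<xi> \<eta> < exp (- \<epsilon> * m)"
  shows "eventually (\<lambda>n. gprod x0 (x n) (y n) \<ge> m) sequentially"
proof -
  have "eventually (\<lambda>n. exp (- \<epsilon> * gprod x0 (x n) (y n)) < exp (- \<epsilon> * m)) sequentially"
    using order_tendstoD(2)[OF visual_dist_tendsto[OF assms(1-4), of x0] assms(5)] .
  then show ?thesis by eventually_elim (use eps in auto)
qed

lemma shadow_depth_ge: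
  assumes \<xi>: "\<xi> \<in> bd" and \<eta>: "\<eta> \<in> bd" and vd: "vd \<xi> \<eta> \<le> exp (- \<epsilon> * m)" and m: "shadow_depth z \<eta> \<ge> m"
  shows "shadow_depth z \<xi> \<ge> m - \<delta>"
proof (rule field_le_epsilon)
  fix e :: real assume e: "e > 0"
  obtain x y where xy: "x \<in> \<xi>" "y \<in> \<eta>" using boundary_repr \<xi> \<eta> by blast
  have "vd \<xi> \<eta> < exp (- \<epsilon> * (m - e))" using vd by (rule le_less_trans) (use e eps in \<open>simp add: algebra_simps\<close>)
  then have 1: "eventually (\<lambda>n. gprod x0 (x n) (y n) \<ge> m - e) sequentially"
    using eventually_gprod_ge \<xi> \<eta> xy by blast
  have 2: "eventually (\<lambda>n. gprod x0 (y n) z > m - e) sequentially"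
    using order_tendstoD(1)[OF shadow_depth_tendsto[OF \<eta> xy(2), of z]] m e by simp
  have "eventually (\<lambda>n. m - e - \<delta> \<le> gprod x0 (x n) z) sequentially"
    using 1 2 by eventually_elim (rule hyp_ge, auto)
  then have "m - e - \<delta> \<le> shadow_depth z \<xi>"
    by (rule tendsto_lowerbound[OF shadow_depth_tendsto[OF \<xi> xy(1)]]) simp
  then show "m - \<delta> \<le> shadow_depth z \<xi> + e" by simp
qed

text \<open>Every boundary point lies in the shadow of an orbit point at any prescribed distance.\<close>

lemma ex_shadow:
  assumes \<xi>: "\<xi> \<in> bd" and n: "n \<ge> 0"
  obtains g where "g \<in> ball_G (n + rc)" "shadow_depth (pt g) \<xi> \<ge> n - rc - \<delta>"
proof -
  obtain x where x: "x \<in> \<xi>" using boundary_repr \<xi> by blast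
  obtain N where N: "\<And>i j. i \<ge> N \<Longrightarrow> j \<ge> N \<Longrightarrow> n \<le> gprod x0 (x i) (x j)"
    using boundary_sequence[OF \<xi> x] unfolding gromov_sequences_iff by meson
  have "n \<le> dist x0 (x N)" using N[of N N] gprod_le_dist[of x0 "x N" "x N"] by simp
  then obtain g where g: "g \<in> carrier G" "\<bar>len g - n\<bar> \<le> rc" "gprod x0 (pt g) (x N) \<ge> n - rc"
    using between[OF n] by blast
  have "eventually (\<lambda>i. n - rc - \<delta> \<le> gprod x0 (x i) (pt g)) sequentially"
    unfolding eventually_sequentially
  proof (intro exI allI impI)
    fix i assume "N \<le> i"
    then show "n - rc - \<delta> \<le> gprod x0 (x i) (pt g)"
      using N[of i N] g(3) rc_ge_1 by (intro hyp_ge[of _ _ "x N"]) (auto simp: gprod_commute)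
  qed
  then have "n - rc - \<delta> \<le> shadow_depth (pt g) \<xi>"
    by (rule tendsto_lowerbound[OF shadow_depth_tendsto[OF \<xi> x]]) simp
  moreover have "g \<in> ball_G (n + rc)" using g(1,2) by (simp add: ball_G_def)
  ultimately show ?thesis using that by blast
qed

text \<open>
  Finitely many depths are compared with \<open>m\<close> at the same time, so a single far member \<open>z\<close> of a sequence
  representing \<open>\<xi>\<close> replaces \<open>\<xi>\<close>, at the price of lowering \<open>m\<close> by one.
\<close>

lemma boundary_shadow_count:
  assumes Q: "Q > 0"
  obtains C where "C > 0" "\<And>n m \<xi>. n \<ge> 0 \<Longrightarrow> \<xi> \<in> bd \<Longrightarrow>
    real (card {g \<in> ball_G n. shadow_depth (pt g) \<xi> \<ge> m}) \<le> C * exp (Q * (n - m))"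
proof -
  obtain C where C: "C > 0" "\<And>n m z. n \<ge> 0 \<Longrightarrow>
    real (card {g \<in> ball_G n. gprod x0 (pt g) z \<ge> m}) \<le> C * exp (Q * (n - m))"
    by (rule shadow_count[OF Q]) (rule that; blast)
  have "real (card {g \<in> ball_G n. shadow_depth (pt g) \<xi> \<ge> m}) \<le> C * exp Q * exp (Q * (n - m))"
    if n: "n \<ge> 0" and \<xi>: "\<xi> \<in> bd" for n m \<xi>
  proof -
    let ?Z = "{g \<in> ball_G n. shadow_depth (pt g) \<xi> \<ge> m}"
    obtain x where x: "x \<in> \<xi>" using boundary_repr \<xi> by blast
    have "eventually (\<lambda>i. \<forall>g\<in>?Z. gprod x0 (x i) (pt g) \<ge> m - 1) sequentially"
    proof (rule eventually_ball_finite)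
      show "\<forall>g\<in>?Z. eventually (\<lambda>i. gprod x0 (x i) (pt g) \<ge> m - 1) sequentially"
      proof
        fix g assume "g \<in> ?Z"
        then have "m - 1 < shadow_depth (pt g) \<xi>" by simp
        from order_tendstoD(1)[OF shadow_depth_tendsto[OF \<xi> x] this]
        show "eventually (\<lambda>i. gprod x0 (x i) (pt g) \<ge> m - 1) sequentially"
          by eventually_elim simp
      qed
    qed simp
    then obtain i where i: "\<forall>g\<in>?Z. gprod x0 (x i) (pt g) \<ge> m - 1"
      unfolding eventually_sequentially by blast
    have "card ?Z \<le> card {g \<in> ball_G n. gprod x0 (pt g) (x i) \<ge> m - 1}"
      by (rule card_mono) (use i in \<open>auto simp: gprod_commute\<close>)
    then have "real (card ?Z) \<le> C * exp (Q * (n - (m - 1)))" using C(2)[OF n, of "m - 1" "x i"] by simp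
    also have "\<dots> = C * exp Q * exp (Q * (n - m))" by (simp add: algebra_simps flip: exp_add)
    finally show ?thesis .
  qed
  then show ?thesis using that[of "C * exp Q"] C(1) by simp
qed

subsection \<open>Size of the Hausdorff measure\<close>

text \<open>
  For \<open>r = e\<^sup>-\<^sup>\<epsilon>\<^sup>m\<close>, the ball is covered by the shadows of the orbit points at distance about \<open>n\<close> whose
  shadow has depth about \<open>m\<close> at the centre. There are \<open>O(e\<^sup>Q\<^sup>(\<^sup>n\<^sup>-\<^sup>m\<^sup>))\<close> of them, and the diameters are
  \<open>O(e\<^sup>-\<^sup>\<epsilon>\<^sup>n)\<close>, with \<open>D\<close>-th power \<open>O(e\<^sup>-\<^sup>Q\<^sup>n)\<close>.
\<close>

theorem hausdorff_ball_upper: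
  assumes Q: "Q > 0"
  obtains C where "C > 0" "\<And>\<xi> r. \<xi> \<in> bd \<Longrightarrow> r > 0 \<Longrightarrow>
    hausdorff_outer bd vd D {\<eta> \<in> bd. vd \<xi> \<eta> \<le> r} \<le> ennreal (C * r powr D)"
proof -
  obtain C where C: "C > 0" "\<And>n m \<xi>. n \<ge> 0 \<Longrightarrow> \<xi> \<in> bd \<Longrightarrow>
    real (card {g \<in> ball_G n. shadow_depth (pt g) \<xi> \<ge> m}) \<le> C * exp (Q * (n - m))"
    by (rule boundary_shadow_count[OF Q]) (rule that; blast)
  define C' where "C' = C * exp (Q * (2 * rc + 3 * \<delta>))"
  have "hausdorff_outer bd vd D {\<eta> \<in> bd. vd \<xi> \<eta> \<le> r} \<le> ennreal (C' * r powr D)"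
    if \<xi>: "\<xi> \<in> bd" and r: "r > 0" for \<xi> r
    unfolding vis.hausdorff_outer_content
  proof (rule SUP_least)
    fix t0 :: real assume "t0 \<in> {0<..}"
    then have t0: "t0 > 0" by simp
    define m where "m = - ln r / \<epsilon>"
    have r_m: "r = exp (- \<epsilon> * m)" using r eps by (simp add: m_def)
    define n where "n = max (max 0 (m + rc + \<delta>)) (- ln t0 / \<epsilon> + rc + 2 * \<delta>)"
    define t where "t = exp (- \<epsilon> * (n - rc - 2 * \<delta>))"
    have n: "n \<ge> 0" "n - rc - \<delta> \<ge> m" "n - rc - 2 * \<delta> \<ge> - ln t0 / \<epsilon>" by (auto simp: n_def)
    have "- \<epsilon> * (n - rc - 2 * \<delta>) \<le> - \<epsilon> * (- ln t0 / \<epsilon>)"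
      using n(3) eps by (intro mult_left_mono_neg) auto
    then have "t \<le> exp (ln t0)" unfolding t_def using eps by simp
    then have t: "t \<le> t0" using t0 by simp
    define Z where "Z = {g \<in> ball_G (n + rc). shadow_depth (pt g) \<xi> \<ge> m - \<delta>}"
    define B where "B g = {\<eta> \<in> bd. shadow_depth (pt g) \<eta> \<ge> n - rc - \<delta>}" for g
    have "vis.hausdorff_content D t0 {\<eta> \<in> bd. vd \<xi> \<eta> \<le> r} \<le> ennreal (real (card Z) * t powr D)"
    proof (rule vis.hausdorff_content_finite_cover)
      show "finite Z" by (simp add: Z_def)
      show "{\<eta> \<in> bd. vd \<xi> \<eta> \<le> r} \<subseteq> (\<Union>g\<in>Z. B g)"
      proof clarify
        fix \<eta> assume \<eta>: "\<eta> \<in> bd" "vd \<xi> \<eta> \<le> r"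
        obtain g where g: "g \<in> ball_G (n + rc)" "shadow_depth (pt g) \<eta> \<ge> n - rc - \<delta>"
          using ex_shadow[OF \<eta>(1) n(1)] by blast
        have "shadow_depth (pt g) \<xi> \<ge> m - \<delta>"
          using shadow_depth_ge[OF \<xi> \<eta>(1), of m "pt g"] \<eta>(2) g(2) n(2) r_m by simp
        then show "\<eta> \<in> (\<Union>g\<in>Z. B g)" using g \<eta> by (auto simp: Z_def B_def)
      qed
      show "B g \<subseteq> bd" for g by (auto simp: B_def)
      show "vd \<eta> \<eta>' \<le> t" if "\<eta> \<in> B g" "\<eta>' \<in> B g" for g \<eta> \<eta>'
      proof -
        have "vd \<eta> \<eta>' \<le> exp (- \<epsilon> * (min (shadow_depth (pt g) \<eta>) (shadow_depth (pt g) \<eta>') - \<delta>))"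
          using that by (intro vd_le_shadow_depth) (auto simp: B_def)
        also have "\<dots> \<le> t" unfolding t_def using that eps by (auto simp: B_def)
        finally show ?thesis .
      qed
      show "0 \<le> t" "t \<le> t0" "0 < D" using t D_pos[OF Q] by (auto simp: t_def)
    qed
    also have "\<dots> \<le> ennreal (C' * r powr D)"
    proof (rule ennreal_leI)
      have "real (card Z) * t powr D \<le> C * exp (Q * (n + rc - (m - \<delta>))) * exp (- Q * (n - rc - 2 * \<delta>))"
        unfolding Z_def t_def exp_eps_powr_D using n(1) rc_ge_1 \<xi> by (intro mult_right_mono C) auto
      also have "\<dots> = C' * exp (- Q * m)"
        by (simp add: C'_def mult.assoc flip: exp_add) (simp add: algebra_simps)
      also have "\<dots> = C' * r powr D" unfolding r_m exp_eps_powr_D ..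
      finally show "real (card Z) * t powr D \<le> C' * r powr D" .
    qed
    finally show "vis.hausdorff_content D t0 {\<eta> \<in> bd. vd \<xi> \<eta> \<le> r} \<le> ennreal (C' * r powr D)" .
  qed
  then show ?thesis using that[of C'] C(1) by (simp add: C'_def)
qed


text \<open>Far away orbit points accumulate on the boundary, because only finitely many orbit points lie
  at any given distance and each of the given points is seen through one of them.\<close>

lemma ex_gromov_subsequence:
  fixes x :: "nat \<Rightarrow> 'a"
  assumes far: "\<And>n. dist x0 (x n) \<ge> real n"
  obtains s where "strict_mono s" "x \<circ> s \<in> gromov_sequences x0"
proof -
  define P where "P k s = (\<forall>i j. gprod x0 (x (s i)) (x (s j)) \<ge> real k)" for k :: nat and s :: "nat \<Rightarrow> nat"
  interpret subseqs P
  proof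
    fix k :: nat and s :: "nat \<Rightarrow> nat" assume s: "strict_mono s"
    define n where "n = real k + rc + \<delta>"
    have n0: "n \<ge> 0" using rc_ge_1 delta_nonneg by (simp add: n_def)
    define i0 where "i0 = nat \<lceil>n\<rceil>"
    have "\<exists>h. h \<in> ball_G (n + rc) \<and> gprod x0 (pt h) (x (s i)) \<ge> n - rc" if i: "i \<in> {i0..}" for i
    proof -
      have "n \<le> real i" using i by (simp add: i0_def nat_ceiling_le_eq)
      also have "real i \<le> real (s i)" using strict_mono_imp_increasing[OF s, of i] by simp
      also have "\<dots> \<le> dist x0 (x (s i))" by (rule far)
      finally obtain h where "h \<in> carrier G" "\<bar>len h - n\<bar> \<le> rc" "gprod x0 (pt h) (x (s i)) \<ge> n - rc"
        using between[OF n0] by blast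
      then show ?thesis by (intro exI[of _ h]) (auto simp: ball_G_def)
    qed
    then obtain h where h: "\<And>i. i \<in> {i0..} \<Longrightarrow> h i \<in> ball_G (n + rc) \<and> gprod x0 (pt (h i)) (x (s i)) \<ge> n - rc"
      by metis
    have "finite (h ` {i0..})" by (rule finite_subset[OF _ finite_ball_G[of "n + rc"]]) (use h in blast)
    then obtain a where a: "a \<in> {i0..}" "infinite {i \<in> {i0..}. h i = h a}"
      using pigeonhole_infinite[OF infinite_Ici] by blast
    let ?I = "{i \<in> {i0..}. h i = h a}"
    have "P k (s \<circ> enumerate ?I)"
      unfolding P_def
    proof (intro allI)
      fix i j
      have "enumerate ?I i \<in> ?I" "enumerate ?I j \<in> ?I" by (rule enumerate_in_set[OF a(2)])+
      then have "gprod x0 (pt (h a)) (x (s (enumerate ?I i))) \<ge> n - rc"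
        "gprod x0 (pt (h a)) (x (s (enumerate ?I j))) \<ge> n - rc" using h by force+
      then have "n - rc - \<delta> \<le> gprod x0 (x (s (enumerate ?I i))) (x (s (enumerate ?I j)))"
        by (intro hyp_ge[of _ _ "pt (h a)"]) (simp_all add: gprod_commute)
      then show "real k \<le> gprod x0 (x ((s \<circ> enumerate ?I) i)) (x ((s \<circ> enumerate ?I) j))"
        by (simp add: n_def)
    qed
    then show "\<exists>r'. strict_mono r' \<and> P k (s \<circ> r')" using strict_mono_enumerate[OF a(2)] by blast
  qed
  have diag: "P k (diagseq \<circ> ((+) (Suc k)))" for k
    by (rule diagseq_holds) (simp add: P_def)
  have le: "gprod x0 (x (diagseq i)) (x (diagseq j)) \<ge> real k" if "i \<ge> Suc k" "j \<ge> Suc k" for i j k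
  proof -
    have "real k \<le> gprod x0 (x (diagseq (Suc k + (i - Suc k)))) (x (diagseq (Suc k + (j - Suc k))))"
      using diag[of k] unfolding P_def o_def by blast
    then show ?thesis using that by simp
  qed
  have "x \<circ> diagseq \<in> gromov_sequences x0"
    unfolding gromov_sequences_iff o_def
  proof
    fix R :: real
    show "\<exists>N. \<forall>i\<ge>N. \<forall>j\<ge>N. R \<le> gprod x0 (x (diagseq i)) (x (diagseq j))"
      by (rule exI[of _ "Suc (nat \<lceil>R\<rceil>)"]) (blast intro: order_trans[OF real_nat_ceiling_ge] le)
  qed
  then show ?thesis using that subseq_diagseq by blast
qed

text \<open>
  The mass distribution principle, without a measure: if the sets \<open>U i\<close> had small total content,
  then for each \<open>n\<close> the shadow count would leave an element \<open>g n\<close> that is long and does not lie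
  in the direction of any of the first \<open>n\<close> sets. A boundary point which is a limit of the \<open>g n x0\<close> then
  lies in none of the sets, so that they do not form a cover.
\<close>

theorem hausdorff_boundary_pos:
  assumes Q: "Q > 0"
  shows "hausdorff_outer bd vd D bd > 0"
proof -
  obtain C where C: "C > 0" "\<And>n m \<xi>. n \<ge> 0 \<Longrightarrow> \<xi> \<in> bd \<Longrightarrow>
    real (card {g \<in> ball_G n. shadow_depth (pt g) \<xi> \<ge> m}) \<le> C * exp (Q * (n - m))"
    by (rule boundary_shadow_count[OF Q]) (rule that; blast)
  obtain C1 where C1: "C1 > 0" "\<And>r. r \<ge> 0 \<Longrightarrow> growth r \<le> C1 * exp (Q * r)"
    using growth_upper[OF Q] by metis
  define c where "c = exp (- Q * (2 * rc))"
  have c: "c > 0" "\<And>r. r \<ge> 0 \<Longrightarrow> growth r \<ge> c * exp (Q * r)"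
    using growth_lower by (auto simp: c_def algebra_simps simp flip: exp_add)
  \<comment> \<open>At most a quarter of the lower bound \<open>c exp (Q r)\<close> for a ball of radius \<open>r\<close> is taken up by elements of length below \<open>r - L\<close>.\<close>
  define L where "L = max 0 (ln (4 * C1 / c) / Q)"
  have L: "L \<ge> 0" "C1 * exp (- Q * L) \<le> c / 4"
  proof -
    show "L \<ge> 0" by (simp add: L_def)
    have "ln (4 * C1 / c) \<le> Q * L" using Q by (simp add: L_def max_def field_simps)
    then have "exp (ln (4 * C1 / c)) \<le> exp (Q * L)" by simp
    then have "4 * C1 / c \<le> exp (Q * L)" using C1(1) c(1) by simp
    then show "C1 * exp (- Q * L) \<le> c / 4" using c(1) by (simp add: exp_minus field_simps)
  qed
  define K where "K = C * exp (Q * \<delta>)"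
  have K: "K > 0" using C(1) by (simp add: K_def)
  define c0 where "c0 = c / (8 * K)"
  have c0: "c0 > 0" "K * (2 * c0) = c / 4" using c K by (auto simp: c0_def)
  have "ennreal c0 \<le> vis.hausdorff_content D 1 bd"
  proof (rule vis.le_hausdorff_content, rule ccontr)
    fix U :: "nat \<Rightarrow> (nat \<Rightarrow> 'a) set set"
    assume U: "bd \<subseteq> (\<Union>i. U i)" "\<And>i. U i \<subseteq> bd" "\<And>i \<xi> \<eta>. \<xi> \<in> U i \<Longrightarrow> \<eta> \<in> U i \<Longrightarrow> vd \<xi> \<eta> \<le> 1"
    assume "\<not> ennreal c0 \<le> (\<Sum>i. ennreal (set_diam vd (U i) powr D))"
    then have small: "(\<Sum>i. ennreal (set_diam vd (U i) powr D)) \<le> ennreal c0" by simp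
    have small_fin: "(\<Sum>i<n. set_diam vd (U i) powr D) \<le> c0" for n
    proof -
      have "(\<Sum>i<n. ennreal (set_diam vd (U i) powr D)) \<le> (\<Sum>i. ennreal (set_diam vd (U i) powr D))"
        by (rule sum_le_suminf) auto
      also note small
      also have "(\<Sum>i<n. ennreal (set_diam vd (U i) powr D)) = ennreal (\<Sum>i<n. set_diam vd (U i) powr D)"
        by (rule sum_ennreal) simp
      finally show ?thesis using c0(1) by (simp add: ennreal_le_iff)
    qed
    \<comment> \<open>The summand with total \<open>c0\<close> gives a positive size also to the sets of diameter zero.\<close>
    define w where "w i = set_diam vd (U i) powr D + c0 * (1/2) ^ Suc i" for i
    have w_sum: "(\<Sum>i<n. w i) \<le> 2 * c0" for n
    proof -
      have "(\<Sum>i<n. (1/2::real) ^ Suc i) \<le> 1"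
        using sum_le_suminf[OF sums_summable[OF power_half_series], of "{..<n}"] sums_unique[OF power_half_series]
        by simp
      then have "c0 * (\<Sum>i<n. (1/2::real) ^ Suc i) \<le> c0 * 1" using c0(1) by (intro mult_left_mono) auto
      then show ?thesis using small_fin[of n] by (simp add: w_def sum.distrib sum_distrib_left)
    qed
    have w_pos: "w i > 0" for i unfolding w_def using c0(1) by (intro add_nonneg_pos) auto
    define m where "m i = - ln (w i) / Q" for i
    have w_m: "exp (- Q * m i) = w i" for i using w_pos[of i] Q by (simp add: m_def)
    have diam: "set_diam vd (U i) < exp (- \<epsilon> * m i)" for i
    proof (rule ccontr)
      assume "\<not> set_diam vd (U i) < exp (- \<epsilon> * m i)"
      then have "exp (- \<epsilon> * m i) powr D \<le> set_diam vd (U i) powr D"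
        using D_pos[OF Q] by (intro powr_mono2) auto
      then have "w i \<le> set_diam vd (U i) powr D" unfolding exp_eps_powr_D w_m .
      moreover have "c0 * (1/2) ^ Suc i > 0" using c0(1) by simp
      ultimately show False unfolding w_def by linarith
    qed
    have "\<exists>\<xi>. U i \<noteq> {} \<longrightarrow> \<xi> \<in> U i" for i by blast
    then obtain \<xi> where \<xi>: "\<And>i. U i \<noteq> {} \<Longrightarrow> \<xi> i \<in> U i" by metis
    define Z where "Z i k = (if U i = {} then {} else {g \<in> ball_G k. shadow_depth (pt g) (\<xi> i) \<ge> m i - \<delta>})" for i k
    have Z_card: "real (card (Z i k)) \<le> K * exp (Q * k) * w i" if k: "k \<ge> 0" for i k
    proof (cases "U i = {}")
      case True
      then show ?thesis using K w_pos[of i] by (simp add: Z_def)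
    next
      case False
      then have "\<xi> i \<in> bd" using \<xi> U(2) by blast
      then have "real (card (Z i k)) \<le> C * exp (Q * (k - (m i - \<delta>)))" using C(2)[OF k] False by (simp add: Z_def)
      also have "\<dots> = K * exp (Q * k) * exp (- Q * m i)"
        by (simp add: K_def mult.assoc flip: exp_add) (simp add: algebra_simps)
      finally show ?thesis unfolding w_m .
    qed
    have Zfin: "finite (Z i k)" for i k by (simp add: Z_def)
    have "\<exists>g\<in>ball_G (real n + L). len g > real n \<and> (\<forall>i<n. g \<notin> Z i (real n + L))" for n
    proof (rule ccontr)
      let ?k = "real n + L"
      assume "\<not> (\<exists>g\<in>ball_G ?k. len g > real n \<and> (\<forall>i<n. g \<notin> Z i ?k))"
      then have "ball_G ?k \<subseteq> ball_G (real n) \<union> (\<Union>i<n. Z i ?k)" by (force simp: ball_G_def)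
      then have "card (ball_G ?k) \<le> card (ball_G (real n) \<union> (\<Union>i<n. Z i ?k))"
        using Zfin by (intro card_mono) auto
      also have "\<dots> \<le> card (ball_G (real n)) + card (\<Union>i<n. Z i ?k)" by (rule card_Un_le)
      also have "\<dots> \<le> card (ball_G (real n)) + (\<Sum>i<n. card (Z i ?k))" by (intro add_left_mono card_UN_le) simp
      finally have "real (card (ball_G ?k)) \<le> real (card (ball_G (real n)) + (\<Sum>i<n. card (Z i ?k)))"
        by (rule of_nat_mono)
      then have "growth ?k \<le> growth (real n) + (\<Sum>i<n. real (card (Z i ?k)))" by (simp add: growth_def)
      also have "\<dots> \<le> C1 * exp (Q * real n) + (\<Sum>i<n. K * exp (Q * ?k) * w i)"
        using L by (intro add_mono sum_mono C1 Z_card) auto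
      also have "(\<Sum>i<n. K * exp (Q * ?k) * w i) = exp (Q * ?k) * (K * (\<Sum>i<n. w i))"
        by (simp only: sum_distrib_left) (simp only: mult_ac)
      also have "\<dots> \<le> exp (Q * ?k) * (K * (2 * c0))"
        using K w_sum by (intro mult_left_mono) auto
      also have "C1 * exp (Q * real n) = exp (Q * ?k) * (C1 * exp (- Q * L))"
        by (simp add: algebra_simps flip: exp_add)
      also have "exp (Q * ?k) * (C1 * exp (- Q * L)) \<le> exp (Q * ?k) * (c / 4)"
        using L(2) by (intro mult_left_mono) auto
      finally have "growth ?k \<le> exp (Q * ?k) * (c / 4) + exp (Q * ?k) * (K * (2 * c0))" by simp
      then have "growth ?k \<le> exp (Q * ?k) * (c / 2)" unfolding c0(2) by (simp add: field_simps)
      moreover have "exp (Q * ?k) * c \<le> growth ?k" using c(2)[of ?k] L(1) by (simp add: mult.commute)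
      moreover have "exp (Q * ?k) * (c / 2) < exp (Q * ?k) * c" using c(1) by simp
      ultimately show False by linarith
    qed
    then obtain g where g: "\<And>n. g n \<in> ball_G (real n + L)" "\<And>n. len (g n) > real n"
      "\<And>n i. i < n \<Longrightarrow> g n \<notin> Z i (real n + L)" by metis
    have far: "dist x0 (pt (g n)) \<ge> real n" for n using g(2)[of n] by (simp add: len_def)
    obtain s where s: "strict_mono s" "(\<lambda>n. pt (g n)) \<circ> s \<in> gromov_sequences x0"
      using ex_gromov_subsequence[of "\<lambda>n. pt (g n)"] far by blast
    define x where "x = (\<lambda>n. pt (g (s n)))"
    have x: "x \<in> gromov_sequences x0" using s(2) by (simp add: x_def o_def)
    define \<zeta> where "\<zeta> = gromov_equiv x0 `` {x}"
    have \<zeta>: "\<zeta> \<in> bd" "x \<in> \<zeta>" unfolding \<zeta>_def using boundary_class[OF x] by auto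
    then obtain i where i: "\<zeta> \<in> U i" using U(1) by blast
    then have \<xi>i: "\<xi> i \<in> U i" "\<xi> i \<in> bd" using \<xi> U(2) by blast+
    obtain y where y: "y \<in> \<xi> i" using boundary_repr \<xi>i by blast
    have "vd (\<xi> i) \<zeta> \<le> set_diam vd (U i)" by (rule vis.dist_le_set_diam[of _ _ _ 1]) (use i \<xi>i U in auto)
    then have "vd (\<xi> i) \<zeta> < exp (- \<epsilon> * m i)" using diam[of i] by linarith
    then have ev: "eventually (\<lambda>j. gprod x0 (y j) (x j) \<ge> m i) sequentially"
      using eventually_gprod_ge \<xi>i(2) y \<zeta> by blast
    obtain N where N: "\<And>j l. j \<ge> N \<Longrightarrow> l \<ge> N \<Longrightarrow> m i \<le> gprod x0 (x j) (x l)"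
      using x unfolding gromov_sequences_iff by meson
    define l where "l = max N (Suc i)"
    have "eventually (\<lambda>j. m i - \<delta> \<le> gprod x0 (y j) (x l)) sequentially"
      using ev eventually_ge_at_top[of N]
      by eventually_elim (rule hyp_ge, auto intro: N simp: l_def)
    then have "m i - \<delta> \<le> shadow_depth (x l) (\<xi> i)"
      by (rule tendsto_lowerbound[OF shadow_depth_tendsto[OF \<xi>i(2) y]]) simp
    moreover have "i < s l" using strict_mono_imp_increasing[OF s(1), of l] by (simp add: l_def)
    ultimately show False using g(1)[of "s l"] g(3)[of i "s l"] \<xi>i(1) by (auto simp: Z_def x_def split: if_splits)
  qed
  also have "\<dots> \<le> hausdorff_outer bd vd D bd" by (rule vis.hausdorff_content_le_outer) simp
  finally show ?thesis using c0(1) by (metis ennreal_less_zero_iff less_le_trans)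
qed


subsection \<open>The action on the boundary\<close>

definition boundary_act :: "'g \<Rightarrow> (nat \<Rightarrow> 'a) set \<Rightarrow> (nat \<Rightarrow> 'a) set" where
  "boundary_act g \<xi> = (\<lambda>x. \<phi> g \<circ> x) ` \<xi>"

lemma boundary_act_mult:
  "g \<in> carrier G \<Longrightarrow> h \<in> carrier G \<Longrightarrow> boundary_act (g \<otimes> h) \<xi> = boundary_act g (boundary_act h \<xi>)"
  unfolding boundary_act_def image_image by (intro image_cong) (auto simp: act_mult)

lemma boundary_act_one [simp]: "boundary_act \<one> \<xi> = \<xi>"
  by (simp add: boundary_act_def o_def)

lemma gprod_act_eq:
  "g \<in> carrier G \<Longrightarrow> gprod x0 (\<phi> g x) (\<phi> g y) =
    gprod x0 x y + len g - gprod x0 x (pt (inv g)) - gprod x0 y (pt (inv g))"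
  using gprod_act[of g "pt (inv g)" x y] gprod_change_base[of "pt (inv g)" x y x0] len_inv[of g]
  by (simp add: len_def)

lemma gromov_equiv_act:
  assumes g: "g \<in> carrier G" and xy: "(x, y) \<in> gromov_equiv x0"
  shows "(\<phi> g \<circ> x, \<phi> g \<circ> y) \<in> gromov_equiv x0"
proof -
  have ge: "gprod x0 (\<phi> g u) (\<phi> g v) \<ge> gprod x0 u v - len g" for u v
    using gprod_act_eq[OF g, of u v] gprod_le_dist'[of x0 u "pt (inv g)"] gprod_le_dist'[of x0 v "pt (inv g)"]
      len_inv[OF g] by (simp add: len_def)
  have *: "\<exists>N. \<forall>i\<ge>N. \<forall>j\<ge>N. R \<le> gprod x0 ((\<phi> g \<circ> u) i) ((\<phi> g \<circ> v) j)"
    if uv: "\<forall>R. \<exists>N. \<forall>i\<ge>N. \<forall>j\<ge>N. R \<le> gprod x0 (u i) (v j)" for u v R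
  proof -
    from uv have "\<exists>N. \<forall>i\<ge>N. \<forall>j\<ge>N. R + len g \<le> gprod x0 (u i) (v j)" by (rule spec)
    then obtain N where N: "\<forall>i\<ge>N. \<forall>j\<ge>N. R + len g \<le> gprod x0 (u i) (v j)" ..
    have "R \<le> gprod x0 ((\<phi> g \<circ> u) i) ((\<phi> g \<circ> v) j)" if "i \<ge> N" "j \<ge> N" for i j
    proof -
      have "R + len g \<le> gprod x0 (u i) (v j)" using N that by simp
      then show ?thesis using ge[of "u i" "v j"] by simp
    qed
    then show ?thesis by (intro exI[of _ N]) simp
  qed
  show ?thesis using xy * unfolding gromov_equiv_iff gromov_sequences_iff by blast
qed

lemma boundary_act_mem: "x \<in> \<xi> \<Longrightarrow> \<phi> g \<circ> x \<in> boundary_act g \<xi>"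
  by (simp add: boundary_act_def)

lemma boundary_act_closed:
  assumes g: "g \<in> carrier G" and \<xi>: "\<xi> \<in> bd"
  shows "boundary_act g \<xi> \<in> bd"
proof -
  obtain x where x: "x \<in> \<xi>" using boundary_repr \<xi> by blast
  have gx: "\<phi> g \<circ> x \<in> gromov_sequences x0"
    using gromov_equiv_act[OF g boundary_equiv[OF \<xi> x x]] by (simp add: gromov_equiv_iff)
  have "boundary_act g \<xi> = gromov_equiv x0 `` {\<phi> g \<circ> x}"
  proof (intro equalityI subsetI)
    fix z assume "z \<in> boundary_act g \<xi>"
    then show "z \<in> gromov_equiv x0 `` {\<phi> g \<circ> x}"
      using gromov_equiv_act[OF g boundary_equiv[OF \<xi> x]] by (auto simp: boundary_act_def)
  next
    fix z assume "z \<in> gromov_equiv x0 `` {\<phi> g \<circ> x}"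
    then have "(\<phi> (inv g) \<circ> (\<phi> g \<circ> x), \<phi> (inv g) \<circ> z) \<in> gromov_equiv x0"
      using gromov_equiv_act[of "inv g"] g by blast
    moreover have "\<phi> (inv g) \<circ> (\<phi> g \<circ> x) = x" "\<phi> g \<circ> (\<phi> (inv g) \<circ> z) = z" using g by (simp_all add: fun_eq_iff)
    ultimately show "z \<in> boundary_act g \<xi>"
      using boundary_closed[OF \<xi> x] boundary_act_mem by metis
  qed
  then show ?thesis using boundary_class(1)[OF gx] by simp
qed

lemma boundary_act_inv:
  "g \<in> carrier G \<Longrightarrow> boundary_act (inv g) (boundary_act g \<xi>) = \<xi>"
  "g \<in> carrier G \<Longrightarrow> boundary_act g (boundary_act (inv g) \<xi>) = \<xi>"
  by (simp_all flip: boundary_act_mult)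

text \<open>
  This is minus the logarithm of the conformal factor of \<open>g\<close> at \<open>\<xi>\<close>.
\<close>

definition log_conformal :: "'g \<Rightarrow> (nat \<Rightarrow> 'a) set \<Rightarrow> real" where
  "log_conformal g \<xi> = \<epsilon> * (len g / 2 - shadow_depth (pt (inv g)) \<xi>)"

lemma vd_boundary_act:
  assumes g: "g \<in> carrier G" and \<xi>: "\<xi> \<in> bd" and \<eta>: "\<eta> \<in> bd"
  shows "vd (boundary_act g \<xi>) (boundary_act g \<eta>) = vd \<xi> \<eta> * exp (- (log_conformal g \<xi> + log_conformal g \<eta>))"
proof -
  obtain x y where xy: "x \<in> \<xi>" "y \<in> \<eta>" using boundary_repr \<xi> \<eta> by blast
  let ?p = "pt (inv g)"
  have "(\<lambda>n. exp (- \<epsilon> * gprod x0 (x n) (y n)) *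
      exp (- (\<epsilon> * (len g / 2 - gprod x0 (x n) ?p) + \<epsilon> * (len g / 2 - gprod x0 (y n) ?p))))
     \<longlonglongrightarrow> vd \<xi> \<eta> * exp (- (log_conformal g \<xi> + log_conformal g \<eta>))"
    unfolding log_conformal_def
    by (intro tendsto_intros shadow_depth_tendsto visual_dist_tendsto \<xi> \<eta> xy)
  moreover have "exp (- \<epsilon> * gprod x0 (x n) (y n)) *
      exp (- (\<epsilon> * (len g / 2 - gprod x0 (x n) ?p) + \<epsilon> * (len g / 2 - gprod x0 (y n) ?p))) =
     exp (- \<epsilon> * gprod x0 ((\<phi> g \<circ> x) n) ((\<phi> g \<circ> y) n))" for n
    by (simp add: gprod_act_eq[OF g] flip: exp_add) (simp add: algebra_simps)
  ultimately have "(\<lambda>n. exp (- \<epsilon> * gprod x0 ((\<phi> g \<circ> x) n) ((\<phi> g \<circ> y) n)))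
     \<longlonglongrightarrow> vd \<xi> \<eta> * exp (- (log_conformal g \<xi> + log_conformal g \<eta>))" by simp
  moreover have "(\<lambda>n. exp (- \<epsilon> * gprod x0 ((\<phi> g \<circ> x) n) ((\<phi> g \<circ> y) n)))
     \<longlonglongrightarrow> vd (boundary_act g \<xi>) (boundary_act g \<eta>)"
    by (intro visual_dist_tendsto boundary_act_closed boundary_act_mem g \<xi> \<eta> xy)
  ultimately show ?thesis by (rule LIMSEQ_unique[rotated])
qed

lemma log_conformal_bounds:
  assumes g: "g \<in> carrier G" and \<xi>: "\<xi> \<in> bd"
  shows "\<bar>log_conformal g \<xi>\<bar> \<le> \<epsilon> * len g / 2"
proof -
  have "\<bar>len g / 2 - shadow_depth (pt (inv g)) \<xi>\<bar> \<le> len g / 2"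
  proof -
    have "0 \<le> shadow_depth (pt (inv g)) \<xi>" "shadow_depth (pt (inv g)) \<xi> \<le> len g"
      using shadow_depth_bounds[OF \<xi>, of "pt (inv g)"] len_inv[OF g] by (simp_all add: len_def)
    then show ?thesis by linarith
  qed
  then have "\<epsilon> * \<bar>len g / 2 - shadow_depth (pt (inv g)) \<xi>\<bar> \<le> \<epsilon> * (len g / 2)"
    using eps by (intro mult_left_mono) auto
  then show ?thesis using eps by (simp add: log_conformal_def abs_mult)
qed

lemma vd_boundary_act_Lipschitz:
  assumes g: "g \<in> carrier G" and \<xi>: "\<xi> \<in> bd" and \<eta>: "\<eta> \<in> bd"
  shows "vd (boundary_act g \<xi>) (boundary_act g \<eta>) \<le> exp (\<epsilon> * len g) * vd \<xi> \<eta>"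
proof -
  have "exp (- (log_conformal g \<xi> + log_conformal g \<eta>)) \<le> exp (\<epsilon> * len g)"
    using log_conformal_bounds[OF g \<xi>] log_conformal_bounds[OF g \<eta>] by (simp add: abs_le_iff)
  then show ?thesis
    unfolding vd_boundary_act[OF assms] using vis.nonneg[of \<xi> \<eta>] by (metis mult.commute mult_left_mono)
qed

text \<open>
  Only the boundary points close to a single point \<open>\<zeta>\<close>, one that is nearly deepest in the shadow of
  \<open>g\<^sup>-\<^sup>1 x0\<close>, fail to be contracted by \<open>g\<close> at the full rate.
\<close>

lemma log_conformal_lower:
  assumes g: "g \<in> carrier G" and ne: "bd \<noteq> {}"
  obtains \<zeta> where "\<zeta> \<in> bd" "\<And>\<xi>. \<xi> \<in> bd \<Longrightarrow> \<xi> \<noteq> \<zeta> \<Longrightarrow>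
    log_conformal g \<xi> \<ge> \<epsilon> * len g / 2 - \<epsilon> * (\<delta> + 1) + ln (vd \<xi> \<zeta>)"
proof -
  let ?H = "shadow_depth (pt (inv g))"
  have bdd: "bdd_above (?H ` bd)"
    using shadow_depth_bounds(2)[of _ "pt (inv g)"] by (auto intro!: bdd_aboveI)
  obtain \<zeta> where \<zeta>: "\<zeta> \<in> bd" "(SUP \<xi>\<in>bd. ?H \<xi>) - 1 < ?H \<zeta>"
    using less_cSUP_iff[OF ne bdd, of "(SUP \<xi>\<in>bd. ?H \<xi>) - 1"] by auto
  have "log_conformal g \<xi> \<ge> \<epsilon> * len g / 2 - \<epsilon> * (\<delta> + 1) + ln (vd \<xi> \<zeta>)" if \<xi>: "\<xi> \<in> bd" "\<xi> \<noteq> \<zeta>" for \<xi>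
  proof -
    have "?H \<xi> \<le> (SUP \<xi>\<in>bd. ?H \<xi>)" using \<xi>(1) bdd by (rule cSUP_upper)
    then have "?H \<xi> - 1 \<le> min (?H \<xi>) (?H \<zeta>)" using \<zeta>(2) by simp
    then have "exp (- \<epsilon> * (min (?H \<xi>) (?H \<zeta>) - \<delta>)) \<le> exp (- \<epsilon> * (?H \<xi> - 1 - \<delta>))"
      using eps by simp
    then have "vd \<xi> \<zeta> \<le> exp (- \<epsilon> * (?H \<xi> - 1 - \<delta>))"
      using vd_le_shadow_depth[OF \<xi>(1) \<zeta>(1), of "pt (inv g)"] by linarith
    moreover have "vd \<xi> \<zeta> > 0" using \<xi> \<zeta>(1) vis.nonneg[of \<xi> \<zeta>] vis.zero[of \<xi> \<zeta>] by linarith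
    ultimately have "ln (vd \<xi> \<zeta>) \<le> - \<epsilon> * (?H \<xi> - 1 - \<delta>)" by (metis ln_exp ln_mono)
    then show ?thesis by (simp add: log_conformal_def algebra_simps)
  qed
  then show ?thesis using that \<zeta>(1) by blast
qed

end

section \<open>Logarithmic energy\<close>

text \<open>
  A density above \<open>c + 1/(n+1)\<close> on a set of positive measure would violate the domination on that set.
\<close>

lemma (in finite_measure) bounded_density:
  assumes M: "finite_measure M'" "sets M' = sets M" and c: "c \<ge> 0"
    and le: "\<And>A. A \<in> sets M \<Longrightarrow> emeasure M' A \<le> ennreal c * emeasure M A"
  obtains f :: "'a \<Rightarrow> real" where "f \<in> borel_measurable M" "\<And>x. 0 \<le> f x" "\<And>x. f x \<le> c"
    "M' = density M (\<lambda>x. ennreal (f x))"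
proof -
  have "absolutely_continuous M M'"
    unfolding absolutely_continuous_def
  proof
    fix A assume A: "A \<in> null_sets M"
    then have "emeasure M' A \<le> ennreal c * 0" using le[OF null_setsD2[OF A]] null_setsD1[OF A] by simp
    then show "A \<in> null_sets M'" using A M(2) by (auto simp: null_sets_def)
  qed
  from Radon_Nikodym[OF this M(2)] obtain f where f: "f \<in> borel_measurable M" "density M f = M'" by auto
  have "AE x in M. f x \<le> ennreal c"
  proof -
    have "AE x in M. \<not> (f x \<ge> ennreal (c + 1 / (real n + 1)))" for n
    proof -
      let ?B = "{x \<in> space M. f x \<ge> ennreal (c + 1 / (real n + 1))}"
      have B: "?B \<in> sets M" using f(1) by measurable
      have "ennreal (c + 1 / (real n + 1)) * emeasure M ?B = (\<integral>\<^sup>+x. ennreal (c + 1 / (real n + 1)) * indicator ?B x \<partial>M)"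
        using B by (simp add: nn_integral_cmult_indicator)
      also have "\<dots> \<le> (\<integral>\<^sup>+x. f x * indicator ?B x \<partial>M)"
        by (intro nn_integral_mono) (auto split: split_indicator)
      also have "\<dots> = emeasure M' ?B" using f B by (simp add: emeasure_density flip: f(2))
      also have "\<dots> \<le> ennreal c * emeasure M ?B" using le[OF B] .
      finally have "ennreal (c + 1 / (real n + 1)) * emeasure M ?B \<le> ennreal c * emeasure M ?B" .
      moreover have "ennreal (a * measure M ?B) = ennreal a * emeasure M ?B" if "a \<ge> 0" for a
        using that unfolding emeasure_eq_measure by (intro ennreal_mult) auto
      ultimately have "ennreal ((c + 1 / (real n + 1)) * measure M ?B) \<le> ennreal (c * measure M ?B)"
        using c by simp
      then have "(c + 1 / (real n + 1)) * measure M ?B \<le> c * measure M ?B"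
        using c by (subst (asm) ennreal_le_iff) auto
      then have "measure M ?B \<le> 0" by (simp add: field_simps)
      then have "emeasure M ?B = 0" by (simp add: emeasure_eq_measure measure_le_0_iff)
      then show ?thesis using B by (intro AE_I[of _ _ ?B]) auto
    qed
    then have "AE x in M. \<forall>n. \<not> (f x \<ge> ennreal (c + 1 / (real n + 1)))" by (simp add: AE_all_countable)
    then show ?thesis
    proof eventually_elim
      case (elim x)
      show ?case
      proof (rule ccontr)
        assume a: "\<not> f x \<le> ennreal c"
        show False
        proof (cases "f x")
          case (real r)
          then have "c < r" using a c by (simp add: ennreal_le_iff2 not_le)
          then obtain n where "1 / (real n + 1) < r - c"
            using reals_Archimedean[of "r - c"] by (auto simp: inverse_eq_divide add.commute)
          then have "ennreal (c + 1 / (real n + 1)) \<le> f x" using real by (simp add: ennreal_leI)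
          then show False using elim by blast
        next
          case top
          then show False using elim[rule_format, of 0] by simp
        qed
      qed
    qed
  qed
  then have "AE x in M. f x = ennreal (enn2real (min (f x) (ennreal c)))"
    by eventually_elim (auto simp: min_absorb1 ennreal_enn2real_if top_unique)
  then have "density M f = density M (\<lambda>x. ennreal (enn2real (min (f x) (ennreal c))))"
    using f(1) by (intro density_cong) auto
  moreover have "enn2real (min (f x) (ennreal c)) \<le> c" for x
    using c by (intro enn2real_leI) auto
  ultimately show ?thesis
    using that[of "\<lambda>x. enn2real (min (f x) (ennreal c))"] f by auto
qed

text \<open>
  The ball condition excludes atoms and makes the potentials of all exponents below \<open>D\<close> bounded.
\<close>

locale log_energy = prob_space N for N :: "'x measure" +
  fixes d :: "'x \<Rightarrow> 'x \<Rightarrow> real" and C D :: real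
  assumes d_measurable [measurable]: "(\<lambda>p. d (fst p) (snd p)) \<in> borel_measurable (N \<Otimes>\<^sub>M N)"
    and d_nonneg: "\<And>x y. d x y \<ge> 0" and d_le_1: "\<And>x y. x \<in> space N \<Longrightarrow> y \<in> space N \<Longrightarrow> d x y \<le> 1"
    and d_commute: "\<And>x y. d x y = d y x"
    and d_zero: "\<And>x y. x \<in> space N \<Longrightarrow> y \<in> space N \<Longrightarrow> d x y = 0 \<longleftrightarrow> x = y"
    and C_pos: "C > 0" and D_pos: "D > 0"
    and ball: "\<And>x r. x \<in> space N \<Longrightarrow> r > 0 \<Longrightarrow> emeasure N {y \<in> space N. d x y \<le> r} \<le> ennreal (C * r powr D)"
begin

sublocale P: pair_prob_space N N ..

lemma d_measurable2 [measurable]: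
  assumes "f \<in> measurable M N" "g \<in> measurable M N"
  shows "(\<lambda>x. d (f x) (g x)) \<in> borel_measurable M"
  using measurable_compose[OF measurable_Pair[OF assms] d_measurable] by simp

definition log_kernel :: "'x \<Rightarrow> 'x \<Rightarrow> real" where "log_kernel x y = - ln (d x y)"

lemma log_kernel_measurable [measurable]:
  assumes "f \<in> measurable M N" "g \<in> measurable M N"
  shows "(\<lambda>x. log_kernel (f x) (g x)) \<in> borel_measurable M"
  unfolding log_kernel_def using assms by measurable

lemma log_kernel_nonneg: "x \<in> space N \<Longrightarrow> y \<in> space N \<Longrightarrow> log_kernel x y \<ge> 0"
  unfolding log_kernel_def using d_le_1[of x y] d_nonneg[of x y] by (cases "d x y = 0") auto

lemma log_kernel_commute: "log_kernel x y = log_kernel y x" by (simp add: log_kernel_def d_commute)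

lemma log_kernel_le:
  assumes "x \<in> space N" "y \<in> space N" "s > 0"
  shows "log_kernel x y \<le> d x y powr (- s) / s"
proof (cases "d x y = 0")
  case False
  then have "d x y > 0" using d_nonneg[of x y] by simp
  then have "s * log_kernel x y = ln (d x y powr (- s))" by (simp add: log_kernel_def ln_powr)
  also have "\<dots> \<le> d x y powr (- s)" using ln_le_minus_one[of "d x y powr (- s)"] \<open>d x y > 0\<close> by simp
  finally show ?thesis using assms(3) by (simp add: field_simps)
qed (simp add: log_kernel_def)

definition potential_const :: real where "potential_const = C * exp (D / 2) / (1 - exp (- D / 2))"

text \<open>Summing over the annuli \<open>e\<^sup>-\<^sup>n\<^sup>-\<^sup>1 < d x y \<le> e\<^sup>-\<^sup>n\<close> bounds the potentials of exponent below \<open>D\<close>.\<close>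

lemma potential_bound:
  assumes x: "x \<in> space N"
  shows "(\<integral>\<^sup>+y. ennreal (d x y powr (- (D / 2))) \<partial>N) \<le> ennreal potential_const"
proof -
  let ?s = "D / 2"
  let ?A = "\<lambda>n::nat. {y \<in> space N. d x y \<le> exp (- real n)}"
  have [measurable]: "(\<lambda>y. d x y) \<in> borel_measurable N" using x by measurable
  have A[measurable]: "?A n \<in> sets N" for n by measurable
  have "(\<integral>\<^sup>+y. ennreal (d x y powr (- ?s)) \<partial>N) \<le>
      (\<integral>\<^sup>+y. (\<Sum>n. ennreal (exp (?s * (real n + 1))) * indicator (?A n) y) \<partial>N)"
  proof (rule nn_integral_mono)
    fix y assume y: "y \<in> space N"
    show "ennreal (d x y powr (- ?s)) \<le> (\<Sum>n. ennreal (exp (?s * (real n + 1))) * indicator (?A n) y)"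
    proof (cases "d x y = 0")
      case False
      then have d: "d x y > 0" using d_nonneg[of x y] by simp
      define n where "n = nat \<lfloor>log_kernel x y\<rfloor>"
      have n: "real n \<le> log_kernel x y" "log_kernel x y \<le> real n + 1" using log_kernel_nonneg[OF x y] by (auto simp: n_def)
      have "d x y = exp (- log_kernel x y)" using d by (simp add: log_kernel_def)
      then have "d x y \<le> exp (- real n)" using n by simp
      moreover have "d x y powr (- ?s) = exp (?s * log_kernel x y)" using d by (simp add: powr_def log_kernel_def)
      moreover define g where "g n = ennreal (exp (?s * (real n + 1))) * indicator (?A n) y" for n
      ultimately have "ennreal (d x y powr (- ?s)) \<le> g n"
        using n y D_pos by (auto intro!: ennreal_leI)
      also have "\<dots> \<le> (\<Sum>n. g n)" using sum_le_suminf[of g "{n}"] by simp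
      also have "\<dots> = (\<Sum>n. ennreal (exp (?s * (real n + 1))) * indicator (?A n) y)" by (simp add: g_def)
      finally show ?thesis .
    qed simp
  qed
  also have "\<dots> = (\<Sum>n. ennreal (exp (?s * (real n + 1))) * emeasure N (?A n))"
    by (subst nn_integral_suminf) (auto simp: nn_integral_cmult_indicator)
  also have "\<dots> \<le> (\<Sum>n. ennreal (C * exp ?s * exp (- ?s) ^ n))"
  proof (intro suminf_le summableI)
    fix n :: nat
    have "ennreal (exp (?s * (real n + 1))) * emeasure N (?A n) \<le>
        ennreal (exp (?s * (real n + 1))) * ennreal (C * exp (- real n) powr D)"
      using x by (intro mult_left_mono ball) auto
    also have "\<dots> = ennreal (exp (?s * (real n + 1)) * (C * exp (- real n) powr D))"
      using C_pos by (simp add: ennreal_mult)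
    also have "exp (?s * (real n + 1)) * (C * exp (- real n) powr D) = C * exp ?s * exp (- ?s) ^ n"
    proof -
      have "exp (- real n) powr D = exp (- (D * real n))" by (simp add: powr_def)
      moreover have "exp (- ?s) ^ n = exp (- (?s * real n))" by (simp add: exp_of_nat_mult[symmetric] mult.commute)
      moreover have "exp (?s * (real n + 1)) * exp (- (D * real n)) = exp ?s * exp (- (?s * real n))"
        by (simp add: algebra_simps add_divide_distrib diff_divide_distrib flip: exp_add)
      ultimately show ?thesis by (simp add: mult_ac)
    qed
    finally show "ennreal (exp (?s * (real n + 1))) * emeasure N (?A n) \<le> ennreal (C * exp ?s * exp (- ?s) ^ n)" .
  qed
  also have "\<dots> = ennreal potential_const"
  proof (rule suminf_ennreal_eq)
    have "(\<lambda>n. exp (- ?s) ^ n) sums (1 / (1 - exp (- ?s)))" using D_pos by (intro geometric_sums) simp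
    from sums_mult[OF this, of "C * exp ?s"] show "(\<lambda>n. C * exp ?s * exp (- ?s) ^ n) sums potential_const"
      by (simp add: potential_const_def)
  qed (use C_pos in auto)
  finally show ?thesis .
qed

lemma potential_const_nonneg: "potential_const \<ge> 0" using C_pos D_pos by (simp add: potential_const_def)

lemma emeasure_singleton:
  assumes x: "x \<in> space N"
  shows "{x} \<in> sets N" "emeasure N {x} = 0"
proof -
  have [measurable]: "(\<lambda>y. d x y) \<in> borel_measurable N" using x by measurable
  have "{x} = {y \<in> space N. d x y = 0}" using x d_zero[of x] by auto
  also have "\<dots> \<in> sets N" by measurable
  finally show "{x} \<in> sets N" .
  have "emeasure N {x} \<le> ennreal (C * exp (- real n) powr D)" for n
    by (rule order_trans[OF emeasure_mono ball[OF x]]) (use x d_zero[of x x] in auto)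
  moreover have "(\<lambda>n. ennreal (C * exp (- real n) powr D)) \<longlonglongrightarrow> ennreal (C * 0)"
  proof (intro tendsto_ennrealI tendsto_mult tendsto_const)
    have "exp (- real n) powr D = exp (- D) ^ n" for n
      by (simp add: powr_def exp_of_nat_mult[symmetric] mult.commute)
    then show "(\<lambda>n. exp (- real n) powr D) \<longlonglongrightarrow> 0" using D_pos by (simp add: LIMSEQ_realpow_zero)
  qed
  ultimately have "emeasure N {x} \<le> ennreal (C * 0)" by (intro LIMSEQ_le_const) auto
  then show "emeasure N {x} = 0" by simp
qed

definition log_potential_const :: real where "log_potential_const = potential_const * (2 / D)"

lemma log_potential_bound:
  assumes x: "x \<in> space N"
  shows "(\<integral>\<^sup>+y. ennreal (log_kernel x y) \<partial>N) \<le> ennreal log_potential_const"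
proof -
  have [measurable]: "(\<lambda>y. d x y) \<in> borel_measurable N" using x by measurable
  have "(\<integral>\<^sup>+y. ennreal (log_kernel x y) \<partial>N) \<le> (\<integral>\<^sup>+y. ennreal (d x y powr (- (D / 2))) * ennreal (2 / D) \<partial>N)"
    using log_kernel_le[OF x, of _ "D / 2"] D_pos
    by (intro nn_integral_mono) (auto simp flip: ennreal_mult intro!: ennreal_leI)
  also have "\<dots> = (\<integral>\<^sup>+y. ennreal (d x y powr (- (D / 2))) \<partial>N) * ennreal (2 / D)"
    by (rule nn_integral_multc) measurable
  also have "\<dots> \<le> ennreal potential_const * ennreal (2 / D)" by (intro mult_right_mono potential_bound x) simp
  also have "\<dots> = ennreal log_potential_const" using potential_const_nonneg D_pos unfolding log_potential_const_def by (intro ennreal_mult[symmetric]) auto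
  finally show ?thesis .
qed

lemma log_potential_const_nonneg: "log_potential_const \<ge> 0" using potential_const_nonneg D_pos by (simp add: log_potential_const_def)

lemma AE_off_diagonal: "AE p in N \<Otimes>\<^sub>M N. fst p \<noteq> snd p"
proof -
  have "AE p in N \<Otimes>\<^sub>M N. d (fst p) (snd p) \<noteq> 0"
  proof (rule P.AE_pair_measure)
    show "{p \<in> space (N \<Otimes>\<^sub>M N). d (fst p) (snd p) \<noteq> 0} \<in> sets (N \<Otimes>\<^sub>M N)" by measurable
    show "AE x in N. AE y in N. d (fst (x, y)) (snd (x, y)) \<noteq> 0"
    proof (rule AE_I2, rule AE_I)
      fix x assume x: "x \<in> space N"
      show "{y \<in> space N. \<not> d (fst (x, y)) (snd (x, y)) \<noteq> 0} \<subseteq> {x}" using x d_zero by auto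
    qed (use emeasure_singleton in auto)
  qed
  then show ?thesis
    by (rule AE_mp) (rule AE_I2, auto simp: space_pair_measure d_zero)
qed

lemma potential_integrable:
  assumes [measurable]: "v \<in> borel_measurable N" "w \<in> borel_measurable N"
    and v: "\<And>x. \<bar>v x\<bar> \<le> B" and w: "\<And>x. \<bar>w x\<bar> \<le> B'"
  shows "integrable (N \<Otimes>\<^sub>M N) (\<lambda>p. v (fst p) * w (snd p) * d (fst p) (snd p) powr (- (D / 2)))"
proof (rule integrableI_bounded)
  have B: "B \<ge> 0" "B' \<ge> 0" using v w by (meson abs_ge_zero order_trans)+
  have "(\<integral>\<^sup>+p. ennreal (norm (v (fst p) * w (snd p) * d (fst p) (snd p) powr (- (D / 2)))) \<partial>(N \<Otimes>\<^sub>M N))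
      \<le> (\<integral>\<^sup>+p. ennreal (B * B') * ennreal (d (fst p) (snd p) powr (- (D / 2))) \<partial>(N \<Otimes>\<^sub>M N))"
  proof (rule nn_integral_mono)
    fix p
    have "norm (v (fst p) * w (snd p) * d (fst p) (snd p) powr (- (D / 2))) \<le> B * B' * d (fst p) (snd p) powr (- (D / 2))"
      using v w B by (auto simp: abs_mult intro!: mult_mono mult_nonneg_nonneg)
    then show "ennreal (norm (v (fst p) * w (snd p) * d (fst p) (snd p) powr (- (D / 2)))) \<le>
        ennreal (B * B') * ennreal (d (fst p) (snd p) powr (- (D / 2)))"
      using B by (simp add: ennreal_leI flip: ennreal_mult)
  qed
  also have "\<dots> = ennreal (B * B') * (\<integral>\<^sup>+p. ennreal (d (fst p) (snd p) powr (- (D / 2))) \<partial>(N \<Otimes>\<^sub>M N))"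
    by (rule nn_integral_cmult) measurable
  also have "(\<integral>\<^sup>+p. ennreal (d (fst p) (snd p) powr (- (D / 2))) \<partial>(N \<Otimes>\<^sub>M N)) =
      (\<integral>\<^sup>+x. \<integral>\<^sup>+y. ennreal (d x y powr (- (D / 2))) \<partial>N \<partial>N)"
    by (subst nn_integral_fst[symmetric]) auto
  also have "\<dots> \<le> (\<integral>\<^sup>+x. ennreal potential_const \<partial>N)" by (intro nn_integral_mono potential_bound)
  also have "\<dots> = ennreal potential_const" by (simp add: emeasure_space_1)
  finally have "(\<integral>\<^sup>+p. ennreal (norm (v (fst p) * w (snd p) * d (fst p) (snd p) powr (- (D / 2)))) \<partial>(N \<Otimes>\<^sub>M N))
      \<le> ennreal (B * B') * ennreal potential_const" by (simp add: mult_left_mono)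
  then show "(\<integral>\<^sup>+p. ennreal (norm (v (fst p) * w (snd p) * d (fst p) (snd p) powr (- (D / 2)))) \<partial>(N \<Otimes>\<^sub>M N)) < \<infinity>"
    by (rule le_less_trans) (simp add: ennreal_mult_less_top)
qed measurable

lemma potential_integrable_le:
  assumes [measurable]: "v \<in> borel_measurable N" "w \<in> borel_measurable N"
    and v: "\<And>x. \<bar>v x\<bar> \<le> B" and w: "\<And>x. \<bar>w x\<bar> \<le> B'" and s: "s \<le> D / 2"
  shows "integrable (N \<Otimes>\<^sub>M N) (\<lambda>p. v (fst p) * w (snd p) * d (fst p) (snd p) powr (- s))"
proof (rule Bochner_Integration.integrable_bound)
  show "integrable (N \<Otimes>\<^sub>M N) (\<lambda>p. v (fst p) * w (snd p) * d (fst p) (snd p) powr (- (D / 2)))"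
    by (rule potential_integrable[OF assms(1-4)])
  show "AE p in N \<Otimes>\<^sub>M N. norm (v (fst p) * w (snd p) * d (fst p) (snd p) powr (- s)) \<le>
      norm (v (fst p) * w (snd p) * d (fst p) (snd p) powr (- (D / 2)))"
  proof (rule AE_I2)
    fix p assume "p \<in> space (N \<Otimes>\<^sub>M N)"
    then have p: "fst p \<in> space N" "snd p \<in> space N" by (auto simp: space_pair_measure)
    have "d (fst p) (snd p) powr (- s) \<le> d (fst p) (snd p) powr (- (D / 2))"
      using d_nonneg d_le_1[OF p] s by (intro powr_mono') auto
    then show "norm (v (fst p) * w (snd p) * d (fst p) (snd p) powr (- s)) \<le>
        norm (v (fst p) * w (snd p) * d (fst p) (snd p) powr (- (D / 2)))"
      by (simp add: abs_mult mult_left_mono)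
  qed
qed measurable

lemma log_integrable:
  assumes [measurable]: "v \<in> borel_measurable N" "w \<in> borel_measurable N"
    and v: "\<And>x. \<bar>v x\<bar> \<le> B" and w: "\<And>x. \<bar>w x\<bar> \<le> B'"
  shows "integrable (N \<Otimes>\<^sub>M N) (\<lambda>p. v (fst p) * w (snd p) * log_kernel (fst p) (snd p))"
proof (rule Bochner_Integration.integrable_bound)
  show "integrable (N \<Otimes>\<^sub>M N) (\<lambda>p. (2 / D) * (v (fst p) * w (snd p) * d (fst p) (snd p) powr (- (D / 2))))"
    by (intro integrable_mult_right potential_integrable[OF assms])
  show "AE p in N \<Otimes>\<^sub>M N. norm (v (fst p) * w (snd p) * log_kernel (fst p) (snd p)) \<le>
      norm ((2 / D) * (v (fst p) * w (snd p) * d (fst p) (snd p) powr (- (D / 2))))"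
  proof (rule AE_I2)
    fix p assume "p \<in> space (N \<Otimes>\<^sub>M N)"
    then have p: "fst p \<in> space N" "snd p \<in> space N" by (auto simp: space_pair_measure)
    have "\<bar>log_kernel (fst p) (snd p)\<bar> \<le> (2 / D) * d (fst p) (snd p) powr (- (D / 2))"
      using log_kernel_le[OF p, of "D / 2"] log_kernel_nonneg[OF p] D_pos by (simp add: mult.commute)
    then have "\<bar>v (fst p) * w (snd p)\<bar> * \<bar>log_kernel (fst p) (snd p)\<bar> \<le>
        \<bar>v (fst p) * w (snd p)\<bar> * ((2 / D) * d (fst p) (snd p) powr (- (D / 2)))"
      by (rule mult_left_mono) simp
    then show "norm (v (fst p) * w (snd p) * log_kernel (fst p) (snd p)) \<le>
        norm ((2 / D) * (v (fst p) * w (snd p) * d (fst p) (snd p) powr (- (D / 2))))"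
      using D_pos by (simp add: abs_mult mult_ac)
  qed
qed measurable

text \<open>
  The bound does not depend on \<open>s\<close> and provides the dominating function for the limit \<open>s \<rightarrow> 0\<close>.
\<close>

lemma difference_quotient_bounds:
  assumes xy: "x \<in> space N" "y \<in> space N" "x \<noteq> y" and s: "0 < s" "s \<le> D / 4"
  shows "0 \<le> (d x y powr (- s) - 1) / s" "(d x y powr (- s) - 1) / s \<le> 4 / D * d x y powr (- (D / 2))"
proof -
  have d: "d x y > 0" using d_nonneg[of x y] d_zero[OF xy(1,2)] xy(3) by simp
  have e: "d x y powr (- a) = exp (a * log_kernel x y)" for a using d by (simp add: powr_def log_kernel_def)
  have L0: "log_kernel x y \<ge> 0" using log_kernel_nonneg xy by simp
  show "0 \<le> (d x y powr (- s) - 1) / s" unfolding e using s L0 by simp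
  have "1 - exp (- (s * log_kernel x y)) \<le> s * log_kernel x y" using exp_ge_add_one_self[of "- (s * log_kernel x y)"] by linarith
  then have "exp (s * log_kernel x y) * (1 - exp (- (s * log_kernel x y))) \<le> exp (s * log_kernel x y) * (s * log_kernel x y)" by (rule mult_left_mono) simp
  then have "exp (s * log_kernel x y) - 1 \<le> s * (log_kernel x y * exp (s * log_kernel x y))" by (simp add: algebra_simps flip: exp_add)
  then have "(d x y powr (- s) - 1) / s \<le> log_kernel x y * exp (s * log_kernel x y)" unfolding e using s by (simp add: field_simps)
  also have "\<dots> \<le> (d x y powr (- (D / 4)) / (D / 4)) * exp (D / 4 * log_kernel x y)"
  proof (rule mult_mono)
    show "log_kernel x y \<le> d x y powr (- (D / 4)) / (D / 4)" using log_kernel_le[OF xy(1,2), of "D / 4"] D_pos by simp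
    show "exp (s * log_kernel x y) \<le> exp (D / 4 * log_kernel x y)" using mult_right_mono[OF s(2) L0] by simp
  qed (use D_pos in auto)
  also have "\<dots> = 4 / D * d x y powr (- (D / 2))" unfolding e by (simp flip: exp_add)
  finally show "(d x y powr (- s) - 1) / s \<le> 4 / D * d x y powr (- (D / 2))" .
qed

text \<open>
  Positivity of the kernels \<open>d\<^sup>-\<^sup>s\<close> for small \<open>s\<close> passes to their derivative \<open>-ln d\<close> at \<open>s = 0\<close>, on
  functions of mean zero, where the constant kernel \<open>d\<^sup>0\<close> vanishes.
\<close>

lemma log_kernel_positive:
  assumes pos: "\<And>s. 0 < s \<Longrightarrow> s \<le> D / 2 \<Longrightarrow> 0 \<le> (\<integral>p. v (fst p) * v (snd p) * d (fst p) (snd p) powr (- s) \<partial>(N \<Otimes>\<^sub>M N))"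
    and [measurable]: "v \<in> borel_measurable N" and v: "\<And>x. \<bar>v x\<bar> \<le> B" and mean: "(\<integral>x. v x \<partial>N) = 0"
  shows "0 \<le> (\<integral>p. v (fst p) * v (snd p) * log_kernel (fst p) (snd p) \<partial>(N \<Otimes>\<^sub>M N))"
proof -
  let ?P = "N \<Otimes>\<^sub>M N"
  \<comment> \<open>Exponents up to \<open>D / 4\<close>, because bounding the difference quotient doubles the exponent.\<close>
  define s where "s n = D / (4 * (real n + 1))" for n :: nat
  have s: "0 < s n" "s n \<le> D / 4" "s n \<le> D / 2" for n
    using D_pos by (auto simp: s_def field_simps add_pos_nonneg)
  have s0: "s \<longlonglongrightarrow> 0" unfolding s_def by real_asymp
  define u where "u n p = v (fst p) * v (snd p) * ((d (fst p) (snd p) powr (- s n) - 1) / s n)" for n p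
  have [measurable]: "u n \<in> borel_measurable ?P" for n unfolding u_def by measurable
  let ?w = "\<lambda>p. (4 / D) * (\<bar>v (fst p)\<bar> * \<bar>v (snd p)\<bar> * d (fst p) (snd p) powr (- (D / 2)))"
  have w: "integrable ?P ?w"
    by (intro integrable_mult_right potential_integrable[of "\<lambda>x. \<bar>v x\<bar>" "\<lambda>x. \<bar>v x\<bar>" B B]) (use v in auto)
  have uw: "AE p in ?P. norm (u n p) \<le> ?w p" for n
    using AE_off_diagonal AE_space
  proof eventually_elim
    case (elim p)
    then have "fst p \<in> space N" "snd p \<in> space N" by (auto simp: space_pair_measure)
    note le = difference_quotient_bounds[OF this elim(1) s(1,2)[of n]]
    then have "\<bar>v (fst p) * v (snd p)\<bar> * \<bar>(d (fst p) (snd p) powr (- s n) - 1) / s n\<bar> \<le>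
        \<bar>v (fst p) * v (snd p)\<bar> * (4 / D * d (fst p) (snd p) powr (- (D / 2)))"
      by (intro mult_left_mono) auto
    then show ?case by (simp add: u_def abs_mult mult_ac)
  qed
  have lim: "AE p in ?P. (\<lambda>n. u n p) \<longlonglongrightarrow> v (fst p) * v (snd p) * log_kernel (fst p) (snd p)"
    using AE_off_diagonal AE_space
  proof eventually_elim
    case (elim p)
    then have p: "fst p \<in> space N" "snd p \<in> space N" by (auto simp: space_pair_measure)
    then have d: "d (fst p) (snd p) > 0" using d_nonneg[of "fst p" "snd p"] d_zero[OF p] elim by simp
    have "((\<lambda>s. d (fst p) (snd p) powr (- s)) has_real_derivative log_kernel (fst p) (snd p)) (at 0)"
      using d by (auto intro!: derivative_eq_intros simp: log_kernel_def)
    from DERIV_D[OF this] have "((\<lambda>h. (d (fst p) (snd p) powr (- h) - 1) / h) \<longlongrightarrow> log_kernel (fst p) (snd p)) (at 0)"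
      using d by simp
    then have "(\<lambda>n. (d (fst p) (snd p) powr (- s n) - 1) / s n) \<longlonglongrightarrow> log_kernel (fst p) (snd p)"
      by (rule filterlim_compose) (use s0 s(1) in \<open>auto simp: filterlim_at less_imp_neq[symmetric]\<close>)
    then show ?case unfolding u_def by (intro tendsto_mult tendsto_const)
  qed
  have "(\<lambda>n. \<integral>p. u n p \<partial>?P) \<longlonglongrightarrow> (\<integral>p. v (fst p) * v (snd p) * log_kernel (fst p) (snd p) \<partial>?P)"
    by (rule integral_dominated_convergence[OF _ _ w lim uw]) measurable
  moreover have "0 \<le> (\<integral>p. u n p \<partial>?P)" for n
  proof -
    have vv: "integrable ?P (\<lambda>p. v (fst p) * v (snd p))"
      using v by (intro P.integrable_const_bound[of _ "B * B"]) (auto simp: abs_mult intro!: mult_mono order_trans[OF abs_ge_zero v])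
    have vv0: "(\<integral>p. v (fst p) * v (snd p) \<partial>?P) = 0"
      using P.integral_fst'[OF vv] mean by simp
    have vd: "integrable ?P (\<lambda>p. v (fst p) * v (snd p) * d (fst p) (snd p) powr (- s n))"
      by (rule potential_integrable_le[of v v B B]) (use v s[of n] in auto)
    have "u n p = v (fst p) * v (snd p) * d (fst p) (snd p) powr (- s n) / s n - v (fst p) * v (snd p) / s n" for p
      using s(1)[of n] by (simp add: u_def field_simps)
    then have "(\<integral>p. u n p \<partial>?P) = (\<integral>p. v (fst p) * v (snd p) * d (fst p) (snd p) powr (- s n) \<partial>?P) / s n"
      using vv vd vv0 by simp
    then show ?thesis using pos[of "s n"] s[of n] by simp
  qed
  ultimately show ?thesis by (intro LIMSEQ_le_const) auto
qed


end

text \<open>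
  The functions \<open>exp (- \<kappa> g)\<close> are the conformal factors of the action. By \<open>expanding\<close>, most points are
  contracted by \<open>g\<close> by a factor that is exponentially small in the length \<open>\<rho> g\<close>.
\<close>

locale conformal_action = log_energy N d C D + group G
  for N :: "'x measure" and d C D and G :: "('g, 'm) monoid_scheme" (structure) +
  fixes act :: "'g \<Rightarrow> 'x \<Rightarrow> 'x" and \<kappa> :: "'g \<Rightarrow> 'x \<Rightarrow> real" and \<rho> :: "'g \<Rightarrow> real"
    and bd_density bd_factor :: "'g \<Rightarrow> real" and rate loss :: real
  assumes act_measurable: "\<And>g. g \<in> carrier G \<Longrightarrow> act g \<in> measurable N N"
    and act_mult: "\<And>g h x. g \<in> carrier G \<Longrightarrow> h \<in> carrier G \<Longrightarrow> x \<in> space N \<Longrightarrow> act (g \<otimes> h) x = act g (act h x)"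
    and quasi_invariant: "\<And>g A. g \<in> carrier G \<Longrightarrow> A \<in> sets N \<Longrightarrow>
      emeasure N (act g -` A \<inter> space N) \<le> ennreal (bd_density g) * emeasure N A"
    and conformal: "\<And>g x y. g \<in> carrier G \<Longrightarrow> x \<in> space N \<Longrightarrow> y \<in> space N \<Longrightarrow>
      d (act g x) (act g y) = d x y * exp (- (\<kappa> g x + \<kappa> g y))"
    and \<kappa>_bounded: "\<And>g x. g \<in> carrier G \<Longrightarrow> x \<in> space N \<Longrightarrow> \<bar>\<kappa> g x\<bar> \<le> bd_factor g"
    and rate_pos: "rate > 0"
    and expanding: "\<And>g. g \<in> carrier G \<Longrightarrow> \<exists>z\<in>space N. \<forall>x\<in>space N. x \<noteq> z \<longrightarrow> \<kappa> g x \<ge> rate * \<rho> g - loss + ln (d x z)"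
    and proper_length: "\<And>R. finite {g \<in> carrier G. \<rho> g \<le> R}"
    and positive: "\<And>s v B. 0 < s \<Longrightarrow> s \<le> D / 2 \<Longrightarrow> v \<in> borel_measurable N \<Longrightarrow> (\<And>x. \<bar>v x\<bar> \<le> B) \<Longrightarrow>
      0 \<le> (\<integral>p. v (fst p) * v (snd p) * d (fst p) (snd p) powr (- s) \<partial>(N \<Otimes>\<^sub>M N))"
begin

lemma act_in_space: "g \<in> carrier G \<Longrightarrow> x \<in> space N \<Longrightarrow> act g x \<in> space N"
  using act_measurable by (rule measurable_space)

lemma act_one: "x \<in> space N \<Longrightarrow> act \<one> x = x"
proof -
  assume x: "x \<in> space N"
  have "d (act \<one> x) (act \<one> (act \<one> x)) = 0"
    using act_mult[of \<one> \<one> x] x act_in_space d_zero by simp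
  then have "d x (act \<one> x) = 0" using conformal[of \<one> x "act \<one> x"] x act_in_space by simp
  then show "act \<one> x = x" using d_zero[of x "act \<one> x"] x act_in_space by simp
qed

lemma log_kernel_act:
  assumes g: "g \<in> carrier G" and x: "x \<in> space N" "y \<in> space N" "x \<noteq> y"
  shows "log_kernel (act g x) (act g y) = log_kernel x y + \<kappa> g x + \<kappa> g y"
proof -
  have "d x y > 0" using d_nonneg[of x y] d_zero[of x y] x by simp
  then show ?thesis unfolding log_kernel_def conformal[OF g x(1,2)] by (simp add: ln_mult)
qed

text \<open>
  Away from a fixed point \<open>z\<close>, conformality expresses \<open>\<kappa> g\<close> through the measurable kernel.
\<close>

lemma \<kappa>_measurable:
  assumes g: "g \<in> carrier G" shows "\<kappa> g \<in> borel_measurable N"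
proof -
  note [measurable] = act_measurable[OF g]
  obtain z where z: "z \<in> space N" using not_empty by blast
  have gz: "act g z \<in> space N" using act_in_space g z by blast
  have [measurable]: "{z} \<in> sets N" using emeasure_singleton z by blast
  have [measurable]: "(\<lambda>x. z) \<in> measurable N N" "(\<lambda>x. act g z) \<in> measurable N N" using z gz by auto
  have "(\<lambda>x. if x \<in> {z} then \<kappa> g z else log_kernel (act g x) (act g z) - log_kernel x z - \<kappa> g z) \<in> borel_measurable N"
    by measurable
  then show ?thesis
  proof (rule measurable_cong[THEN iffD1, rotated])
    fix x assume "x \<in> space N"
    then show "(if x \<in> {z} then \<kappa> g z else log_kernel (act g x) (act g z) - log_kernel x z - \<kappa> g z) = \<kappa> g x"
      using log_kernel_act[OF g _ z] by auto
  qed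
qed

lemma density_exists:
  assumes g: "g \<in> carrier G"
  shows "\<exists>f B. f \<in> borel_measurable N \<and> (\<forall>x. 0 \<le> f x \<and> f x \<le> B) \<and> distr N N (act g) = density N (\<lambda>x. ennreal (f x))"
proof -
  note [measurable] = act_measurable[OF g]
  have fin: "finite_measure (distr N N (act g))" by (rule finite_measure_distr) measurable
  have le: "emeasure (distr N N (act g)) A \<le> ennreal (max 0 (bd_density g)) * emeasure N A" if A: "A \<in> sets N" for A
  proof -
    have "emeasure (distr N N (act g)) A \<le> ennreal (bd_density g) * emeasure N A"
      using quasi_invariant[OF g A] A by (simp add: emeasure_distr)
    also have "\<dots> \<le> ennreal (max 0 (bd_density g)) * emeasure N A" by (intro mult_right_mono ennreal_leI) auto
    finally show ?thesis .
  qed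
  show ?thesis
  proof (rule bounded_density[OF fin _ _ le])
    fix f :: "'x \<Rightarrow> real"
    assume f: "f \<in> borel_measurable N" "\<And>x. 0 \<le> f x" "\<And>x. f x \<le> max 0 (bd_density g)"
      "distr N N (act g) = density N (\<lambda>x. ennreal (f x))"
    then show ?thesis by blast
  qed auto
qed

definition act_density :: "'g \<Rightarrow> 'x \<Rightarrow> real" where
  "act_density g = (SOME f. \<exists>B. f \<in> borel_measurable N \<and> (\<forall>x. 0 \<le> f x \<and> f x \<le> B) \<and>
     distr N N (act g) = density N (\<lambda>x. ennreal (f x)))"

lemma act_density:
  assumes g: "g \<in> carrier G"
  shows "act_density g \<in> borel_measurable N" "\<And>x. 0 \<le> act_density g x" "\<exists>B. \<forall>x. act_density g x \<le> B"
    "distr N N (act g) = density N (\<lambda>x. ennreal (act_density g x))"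
proof -
  have "\<exists>B. act_density g \<in> borel_measurable N \<and> (\<forall>x. 0 \<le> act_density g x \<and> act_density g x \<le> B) \<and>
     distr N N (act g) = density N (\<lambda>x. ennreal (act_density g x))"
    unfolding act_density_def by (rule someI_ex[OF density_exists[OF g]])
  then show "act_density g \<in> borel_measurable N" "\<And>x. 0 \<le> act_density g x" "\<exists>B. \<forall>x. act_density g x \<le> B"
    "distr N N (act g) = density N (\<lambda>x. ennreal (act_density g x))" by auto
qed

lemma act_density_abs_bound:
  assumes g: "g \<in> carrier G" shows "\<exists>B. \<forall>x. \<bar>act_density g x\<bar> \<le> B"
  using act_density(2,3)[OF g] by simp

lemma act_density_mean: "g \<in> carrier G \<Longrightarrow> (\<integral>x. act_density g x \<partial>N) = 1"
proof -
  assume g: "g \<in> carrier G"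
  note [measurable] = act_measurable[OF g] act_density(1)[OF g]
  have "(\<integral>x. 1 \<partial>distr N N (act g)) = (1 :: real)"
    by (subst integral_distr) (auto simp: prob_space)
  also have "(\<integral>x. 1 \<partial>distr N N (act g)) = (\<integral>x. act_density g x \<partial>N)"
    unfolding act_density(4)[OF g] using act_density(2)[OF g] by (subst integral_density) auto
  finally show "(\<integral>x. act_density g x \<partial>N) = 1" by simp
qed

definition energy :: "'g \<Rightarrow> 'g \<Rightarrow> real" where
  "energy g h = (\<integral>p. log_kernel (act g (fst p)) (act h (snd p)) \<partial>(N \<Otimes>\<^sub>M N))"

text \<open>
  The translates of the measure have bounded densities. This makes the energy an integral of the kernel
  against densities, to which its positivity applies.
\<close>

lemma energy_props:
  assumes g: "g \<in> carrier G" and h: "h \<in> carrier G"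
  shows energy_integrable: "integrable (N \<Otimes>\<^sub>M N) (\<lambda>p. log_kernel (act g (fst p)) (act h (snd p)))"
    and energy_density: "energy g h = (\<integral>p. act_density g (fst p) * act_density h (snd p) * log_kernel (fst p) (snd p) \<partial>(N \<Otimes>\<^sub>M N))"
proof -
  note [measurable] = act_measurable[OF g] act_measurable[OF h] act_density(1)[OF g] act_density(1)[OF h]
  let ?P = "N \<Otimes>\<^sub>M N"
  have pr: "prob_space (distr N N (act h))" by (rule prob_space_distr) measurable
  then have sf: "sigma_finite_measure (distr N N (act h))"
    by (simp add: prob_space_def finite_measure_def)
  have "distr ?P ?P (\<lambda>(x, y). (act g x, act h y)) = distr N N (act g) \<Otimes>\<^sub>M distr N N (act h)"
    by (rule pair_measure_distr[symmetric]) (use sf in measurable)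
  also have "\<dots> = density ?P (\<lambda>(x, y). ennreal (act_density g x) * ennreal (act_density h y))"
    unfolding act_density(4)[OF g] act_density(4)[OF h]
    by (rule pair_measure_density) (use sf act_density(4)[OF h] sigma_finite_measure_axioms in auto)
  also have "\<dots> = density ?P (\<lambda>p. ennreal (act_density g (fst p) * act_density h (snd p)))"
    using act_density(2)[OF g] act_density(2)[OF h] by (simp add: split_def ennreal_mult)
  finally have eq: "distr ?P ?P (\<lambda>p. (act g (fst p), act h (snd p))) = density ?P (\<lambda>p. ennreal (act_density g (fst p) * act_density h (snd p)))"
    by (simp add: split_def)
  obtain B B' where B: "\<And>x. \<bar>act_density g x\<bar> \<le> B" "\<And>x. \<bar>act_density h x\<bar> \<le> B'"
    using act_density_abs_bound[OF g] act_density_abs_bound[OF h] by blast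
  have int: "integrable ?P (\<lambda>p. act_density g (fst p) * act_density h (snd p) * log_kernel (fst p) (snd p))"
    by (rule log_integrable) (use B in auto)
  have [measurable]: "(\<lambda>p. (act g (fst p), act h (snd p))) \<in> measurable ?P ?P" by measurable
  have "integrable (density ?P (\<lambda>p. ennreal (act_density g (fst p) * act_density h (snd p)))) (\<lambda>p. log_kernel (fst p) (snd p))"
    using int act_density(2)[OF g] act_density(2)[OF h] by (subst integrable_density) auto
  then have "integrable (distr ?P ?P (\<lambda>p. (act g (fst p), act h (snd p)))) (\<lambda>p. log_kernel (fst p) (snd p))"
    by (simp add: eq)
  then show "integrable ?P (\<lambda>p. log_kernel (act g (fst p)) (act h (snd p)))"
    by (subst (asm) integrable_distr_eq) auto
  have "energy g h = (\<integral>p. log_kernel (fst p) (snd p) \<partial>distr ?P ?P (\<lambda>p. (act g (fst p), act h (snd p))))"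
    unfolding energy_def by (subst integral_distr) auto
  also have "\<dots> = (\<integral>p. act_density g (fst p) * act_density h (snd p) * log_kernel (fst p) (snd p) \<partial>?P)"
    unfolding eq using act_density(2)[OF g] act_density(2)[OF h] by (subst integral_density) auto
  finally show "energy g h = (\<integral>p. act_density g (fst p) * act_density h (snd p) * log_kernel (fst p) (snd p) \<partial>?P)" .
qed

lemma energy_nonneg: "g \<in> carrier G \<Longrightarrow> h \<in> carrier G \<Longrightarrow> energy g h \<ge> 0"
  unfolding energy_def by (rule integral_nonneg_AE, rule AE_I2)
    (auto simp: space_pair_measure intro!: log_kernel_nonneg act_in_space)

definition mean_factor :: "'g \<Rightarrow> 'g \<Rightarrow> real" where "mean_factor g h = (\<integral>x. \<kappa> g (act h x) \<partial>N)"

lemma mean_factor_integrable: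
  assumes g: "g \<in> carrier G" and h: "h \<in> carrier G"
  shows "integrable N (\<lambda>x. \<kappa> g (act h x))"
proof (rule integrable_const_bound[of _ "bd_factor g"])
  show "AE x in N. norm (\<kappa> g (act h x)) \<le> bd_factor g"
    using \<kappa>_bounded[OF g] act_in_space[OF h] by (intro AE_I2) auto
  note [measurable] = act_measurable[OF h] \<kappa>_measurable[OF g]
  show "(\<lambda>x. \<kappa> g (act h x)) \<in> borel_measurable N" by measurable
qed

lemma AE_act_neq:
  assumes g: "g \<in> carrier G" and h: "h \<in> carrier G"
  shows "AE p in N \<Otimes>\<^sub>M N. act g (fst p) \<noteq> act h (snd p)"
proof -
  note [measurable] = act_measurable[OF g] act_measurable[OF h]
  have "AE p in N \<Otimes>\<^sub>M N. d (act g (fst p)) (act h (snd p)) \<noteq> 0"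
  proof (rule P.AE_pair_measure)
    show "{p \<in> space (N \<Otimes>\<^sub>M N). d (act g (fst p)) (act h (snd p)) \<noteq> 0} \<in> sets (N \<Otimes>\<^sub>M N)" by measurable
    show "AE x in N. AE y in N. d (act g (fst (x, y))) (act h (snd (x, y))) \<noteq> 0"
    proof (rule AE_I2)
      fix x assume x: "x \<in> space N"
      have gx: "act g x \<in> space N" using act_in_space g x .
      let ?A = "act h -` {act g x} \<inter> space N"
      show "AE y in N. d (act g (fst (x, y))) (act h (snd (x, y))) \<noteq> 0"
      proof (rule AE_I[of _ _ ?A])
        show "{y \<in> space N. \<not> d (act g (fst (x, y))) (act h (snd (x, y))) \<noteq> 0} \<subseteq> ?A"
          using gx d_zero act_in_space[OF h] by auto
        show "emeasure N ?A = 0"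
          using quasi_invariant[OF h emeasure_singleton(1)[OF gx]] emeasure_singleton(2)[OF gx] by simp
        show "?A \<in> sets N" using emeasure_singleton(1)[OF gx] by measurable
      qed
    qed
  qed
  with AE_space show ?thesis
    by eventually_elim (use g h act_in_space d_zero in \<open>auto simp: space_pair_measure\<close>)
qed

text \<open>
  Almost every pair of points is mapped to two different points, where conformality adds functions of one
  variable to the kernel.
\<close>

lemma energy_left:
  assumes c: "c \<in> carrier G" and g: "g \<in> carrier G" and h: "h \<in> carrier G"
  shows "energy (c \<otimes> g) (c \<otimes> h) = energy g h + mean_factor c g + mean_factor c h"
proof -
  let ?P = "N \<Otimes>\<^sub>M N"
  note [measurable] = act_measurable[OF g] act_measurable[OF h] \<kappa>_measurable[OF c]
    act_measurable[OF m_closed[OF c g]] act_measurable[OF m_closed[OF c h]]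
  have i1: "integrable ?P (\<lambda>p. \<kappa> c (act g (fst p)))"
    by (rule P.integrable_const_bound[of _ "bd_factor c"])
      (use \<kappa>_bounded[OF c] act_in_space[OF g] in \<open>auto intro!: AE_I2 simp: space_pair_measure\<close>)
  have i2: "integrable ?P (\<lambda>p. \<kappa> c (act h (snd p)))"
    by (rule P.integrable_const_bound[of _ "bd_factor c"])
      (use \<kappa>_bounded[OF c] act_in_space[OF h] in \<open>auto intro!: AE_I2 simp: space_pair_measure\<close>)
  have k1: "(\<integral>p. \<kappa> c (act g (fst p)) \<partial>?P) = mean_factor c g"
    using P.integral_fst'[OF i1] by (simp add: mean_factor_def prob_space)
  have k2: "(\<integral>p. \<kappa> c (act h (snd p)) \<partial>?P) = mean_factor c h"
    using P.integral_fst'[OF i2] by (simp add: mean_factor_def prob_space)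
  have "energy (c \<otimes> g) (c \<otimes> h) = (\<integral>p. log_kernel (act g (fst p)) (act h (snd p)) + \<kappa> c (act g (fst p)) + \<kappa> c (act h (snd p)) \<partial>?P)"
    unfolding energy_def
  proof (rule integral_cong_AE)
    show "AE p in ?P. log_kernel (act (c \<otimes> g) (fst p)) (act (c \<otimes> h) (snd p)) =
        log_kernel (act g (fst p)) (act h (snd p)) + \<kappa> c (act g (fst p)) + \<kappa> c (act h (snd p))"
      using AE_act_neq[OF g h] AE_space
    proof eventually_elim
      case (elim p)
      then have p: "fst p \<in> space N" "snd p \<in> space N" by (auto simp: space_pair_measure)
      then show ?case using log_kernel_act[OF c act_in_space[OF g p(1)] act_in_space[OF h p(2)] elim(1)] c g h
        by (simp add: act_mult)
    qed
  qed measurable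
  also have "\<dots> = energy g h + mean_factor c g + mean_factor c h"
    using i1 i2 energy_integrable[OF g h] by (simp add: energy_def k1 k2)
  finally show ?thesis .
qed

text \<open>
  The combination of densities with the coefficients \<open>c\<close> has mean \<open>\<Sum> c = 0\<close>.
\<close>

lemma energy_positive:
  fixes n :: nat
  assumes \<gamma>: "\<And>i. i < n \<Longrightarrow> \<gamma> i \<in> carrier G" and c: "(\<Sum>i<n. c i) = 0"
  shows "(\<Sum>i<n. \<Sum>j<n. c i * c j * energy (\<gamma> i) (\<gamma> j)) \<ge> 0"
proof -
  let ?P = "N \<Otimes>\<^sub>M N"
  define v where "v x = (\<Sum>i<n. c i * act_density (\<gamma> i) x)" for x
  have "\<exists>B. \<forall>x. i < n \<longrightarrow> \<bar>act_density (\<gamma> i) x\<bar> \<le> B" for i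
  proof (cases "i < n")
    case True
    then show ?thesis using act_density_abs_bound[OF \<gamma>[OF True]] by simp
  qed simp
  then have "\<exists>B. \<forall>i. \<forall>x. i < n \<longrightarrow> \<bar>act_density (\<gamma> i) x\<bar> \<le> B i" by (intro choice allI)
  then obtain B where B: "\<And>i x. i < n \<Longrightarrow> \<bar>act_density (\<gamma> i) x\<bar> \<le> B i" by blast
  have dm[measurable]: "act_density (\<gamma> i) \<in> borel_measurable N" if "i < n" for i using act_density(1) \<gamma> that by blast
  have v[measurable]: "v \<in> borel_measurable N"
    unfolding v_def by (intro borel_measurable_sum borel_measurable_times) (auto intro: dm)
  have vB: "\<bar>v x\<bar> \<le> (\<Sum>i<n. \<bar>c i\<bar> * B i)" for x
    unfolding v_def by (rule order_trans[OF sum_abs]) (auto simp: abs_mult intro!: sum_mono mult_left_mono B)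
  have di: "integrable N (act_density (\<gamma> i))" if "i < n" for i
    by (rule integrable_const_bound[of _ "B i"]) (use B dm that in auto)
  have "(\<integral>x. v x \<partial>N) = (\<Sum>i<n. c i * (\<integral>x. act_density (\<gamma> i) x \<partial>N))"
    unfolding v_def by (subst Bochner_Integration.integral_sum) (auto intro: di)
  also have "\<dots> = (\<Sum>i<n. c i)" using \<gamma> by (intro sum.cong refl) (simp add: act_density_mean)
  finally have mean: "(\<integral>x. v x \<partial>N) = 0" using c by simp
  have ii: "integrable ?P (\<lambda>p. act_density (\<gamma> i) (fst p) * act_density (\<gamma> j) (snd p) * log_kernel (fst p) (snd p))" if "i < n" "j < n" for i j
    by (rule log_integrable[of _ _ "B i" "B j"]) (use B dm that in auto)
  have "0 \<le> (\<integral>p. v (fst p) * v (snd p) * log_kernel (fst p) (snd p) \<partial>?P)"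
    by (rule log_kernel_positive[OF positive v vB mean]) (use v vB in auto)
  also have "(\<lambda>p. v (fst p) * v (snd p) * log_kernel (fst p) (snd p)) =
      (\<lambda>p. \<Sum>i<n. \<Sum>j<n. c i * c j * (act_density (\<gamma> i) (fst p) * act_density (\<gamma> j) (snd p) * log_kernel (fst p) (snd p)))"
    by (rule ext, simp only: v_def sum_product, simp only: sum_distrib_right, simp only: mult_ac)
  also have "(\<integral>p. (\<Sum>i<n. \<Sum>j<n. c i * c j * (act_density (\<gamma> i) (fst p) * act_density (\<gamma> j) (snd p) * log_kernel (fst p) (snd p))) \<partial>?P) =
      (\<Sum>i<n. \<Sum>j<n. c i * c j * (\<integral>p. act_density (\<gamma> i) (fst p) * act_density (\<gamma> j) (snd p) * log_kernel (fst p) (snd p) \<partial>?P))"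
  proof -
    have "(\<integral>p. (\<Sum>j<n. c i * c j * (act_density (\<gamma> i) (fst p) * act_density (\<gamma> j) (snd p) * log_kernel (fst p) (snd p))) \<partial>?P) =
      (\<Sum>j<n. c i * c j * (\<integral>p. act_density (\<gamma> i) (fst p) * act_density (\<gamma> j) (snd p) * log_kernel (fst p) (snd p) \<partial>?P))" if "i < n" for i
      using that by (subst Bochner_Integration.integral_sum) (auto intro: ii)
    then show ?thesis
      by (subst Bochner_Integration.integral_sum)
        (auto intro!: Bochner_Integration.integrable_sum integrable_mult_right ii)
  qed
  also have "\<dots> = (\<Sum>i<n. \<Sum>j<n. c i * c j * energy (\<gamma> i) (\<gamma> j))"
    by (intro sum.cong refl) (simp add: energy_density \<gamma>)
  finally show ?thesis .
qed

lemma energy_one_le: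
  assumes g: "g \<in> carrier G"
  shows "energy \<one> g \<le> log_potential_const" "energy g \<one> \<le> log_potential_const"
proof -
  note [measurable] = act_measurable[OF g]
  let ?P = "N \<Otimes>\<^sub>M N"
  have *: "(\<integral>p. f p \<partial>?P) \<le> log_potential_const" if f: "integrable ?P f" "AE p in ?P. 0 \<le> f p" "(\<integral>\<^sup>+p. ennreal (f p) \<partial>?P) \<le> ennreal log_potential_const" for f
    using f log_potential_const_nonneg nn_integral_eq_integral[OF f(1,2)] by (simp add: ennreal_le_iff)
  have one: "act \<one> \<in> measurable N N" using act_measurable by simp
  note [measurable] = one
  show "energy g \<one> \<le> log_potential_const" unfolding energy_def
  proof (rule *[OF energy_integrable])
    have "(\<integral>\<^sup>+p. ennreal (log_kernel (act g (fst p)) (act \<one> (snd p))) \<partial>?P) = (\<integral>\<^sup>+x. \<integral>\<^sup>+y. ennreal (log_kernel (act g x) (act \<one> y)) \<partial>N \<partial>N)"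
      by (subst nn_integral_fst[symmetric]) auto
    also have "\<dots> = (\<integral>\<^sup>+x. \<integral>\<^sup>+y. ennreal (log_kernel (act g x) y) \<partial>N \<partial>N)"
      by (intro nn_integral_cong) (simp add: act_one)
    also have "\<dots> \<le> (\<integral>\<^sup>+x. ennreal log_potential_const \<partial>N)"
      using g by (intro nn_integral_mono log_potential_bound act_in_space)
    finally show "(\<integral>\<^sup>+p. ennreal (log_kernel (act g (fst p)) (act \<one> (snd p))) \<partial>?P) \<le> ennreal log_potential_const"
      by (simp add: emeasure_space_1)
  qed (use g in \<open>auto intro!: AE_I2 log_kernel_nonneg act_in_space simp: space_pair_measure\<close>)
  show "energy \<one> g \<le> log_potential_const" unfolding energy_def
  proof (rule *[OF energy_integrable])
    have "(\<integral>\<^sup>+p. ennreal (log_kernel (act \<one> (fst p)) (act g (snd p))) \<partial>?P) = (\<integral>\<^sup>+y. \<integral>\<^sup>+x. ennreal (log_kernel (act \<one> x) (act g y)) \<partial>N \<partial>N)"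
      by (subst P.nn_integral_snd[symmetric]) auto
    also have "\<dots> = (\<integral>\<^sup>+y. \<integral>\<^sup>+x. ennreal (log_kernel (act g y) x) \<partial>N \<partial>N)"
      by (intro nn_integral_cong) (simp add: act_one log_kernel_commute)
    also have "\<dots> \<le> (\<integral>\<^sup>+x. ennreal log_potential_const \<partial>N)"
      using g by (intro nn_integral_mono log_potential_bound act_in_space)
    finally show "(\<integral>\<^sup>+p. ennreal (log_kernel (act \<one> (fst p)) (act g (snd p))) \<partial>?P) \<le> ennreal log_potential_const"
      by (simp add: emeasure_space_1)
  qed (use g in \<open>auto intro!: AE_I2 log_kernel_nonneg act_in_space simp: space_pair_measure\<close>)
qed

text \<open>
  Integrating the expansion estimate over the space loses only a logarithmic potential.
\<close>

lemma mean_factor_lower: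
  assumes g: "g \<in> carrier G"
  shows "mean_factor g \<one> \<ge> rate * \<rho> g - loss - log_potential_const"
proof -
  obtain z where z: "z \<in> space N" "\<And>x. x \<in> space N \<Longrightarrow> x \<noteq> z \<Longrightarrow> \<kappa> g x \<ge> rate * \<rho> g - loss + ln (d x z)"
    using expanding[OF g] by blast
  have [measurable]: "(\<lambda>x. z) \<in> measurable N N" using z by auto
  have Lf: "(\<integral>\<^sup>+x. ennreal (log_kernel z x) \<partial>N) \<le> ennreal log_potential_const" by (rule log_potential_bound[OF z(1)])
  have Lnn: "AE x in N. 0 \<le> log_kernel z x" using z(1) log_kernel_nonneg by (intro AE_I2)
  have Li: "integrable N (\<lambda>x. log_kernel z x)"
    using Lf Lnn by (intro integrableI_nonneg) (auto intro: le_less_trans)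
  have LK: "(\<integral>x. log_kernel z x \<partial>N) \<le> log_potential_const"
    using Lf nn_integral_eq_integral[OF Li Lnn] log_potential_const_nonneg by (simp add: ennreal_le_iff)
  have ki: "integrable N (\<lambda>x. \<kappa> g (act \<one> x))" by (rule mean_factor_integrable) (use g in auto)
  have "(\<integral>x. rate * \<rho> g - loss - log_kernel z x \<partial>N) \<le> mean_factor g \<one>"
    unfolding mean_factor_def
  proof (rule integral_mono_AE)
    have "AE x in N. x \<noteq> z"
      by (rule AE_I[of _ _ "{z}"]) (use emeasure_singleton z in auto)
    with AE_space show "AE x in N. rate * \<rho> g - loss - log_kernel z x \<le> \<kappa> g (act \<one> x)"
    proof eventually_elim
      case (elim x)
      then show ?case using z(2)[of x] by (simp add: act_one log_kernel_def d_commute[of z])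
    qed
  qed (use Li ki in auto)
  then show ?thesis using Li LK by (simp add: prob_space)
qed

text \<open>
  The function \<open>\<psi> g\<close> is the energy of \<open>N - g N\<close>. Of its four terms, \<open>energy g g\<close> grows with the length
  because it exceeds \<open>energy \<one> \<one>\<close> by twice the mean factor, and the mixed ones are bounded by the
  logarithmic potential.
\<close>

theorem haagerup_conformal_action: "haagerup G"
proof -
  define \<psi> where "\<psi> g = energy \<one> \<one> + energy g g - energy \<one> g - energy g \<one>" for g
  have lower: "\<psi> g \<ge> 2 * (rate * \<rho> g - loss) - 4 * log_potential_const" if g: "g \<in> carrier G" for g
    using energy_left[OF g one_closed one_closed] mean_factor_lower[OF g] energy_one_le[OF g] energy_nonneg[OF one_closed one_closed] g
    by (simp add: \<psi>_def)
  have "\<psi> g \<ge> 0" if g: "g \<in> carrier G" for g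
  proof -
    define \<gamma> where "\<gamma> i = (if i = 0 then \<one> else g)" for i :: nat
    define c where "c i = (if i = 0 then 1 else - 1 :: real)" for i :: nat
    have "0 \<le> (\<Sum>i<2. \<Sum>j<2. c i * c j * energy (\<gamma> i) (\<gamma> j))"
      by (rule energy_positive) (use g in \<open>auto simp: \<gamma>_def c_def numeral_2_eq_2\<close>)
    then show ?thesis by (simp add: \<psi>_def \<gamma>_def c_def numeral_2_eq_2)
  qed
  moreover have "finite {g \<in> carrier G. \<psi> g \<le> R}" for R
  proof (rule finite_subset[OF _ proper_length])
    show "{g \<in> carrier G. \<psi> g \<le> R} \<subseteq> {g \<in> carrier G. \<rho> g \<le> (R + 4 * log_potential_const + 2 * loss) / (2 * rate)}"
      using lower rate_pos by (force simp: field_simps)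
  qed
  moreover have "conditionally_negative G \<psi>"
  proof (rule conditionally_negative_cocycle_form[where E = energy])
    fix g h assume g: "g \<in> carrier G" and h: "h \<in> carrier G"
    have ih: "inv h \<in> carrier G" using h by simp
    show "\<psi> (inv h \<otimes> g) = energy g g + energy h h - energy g h - energy h g"
      using energy_left[OF ih g g] energy_left[OF ih h h] energy_left[OF ih g h] energy_left[OF ih h g] g h by (simp add: \<psi>_def)
  qed (rule energy_positive)
  ultimately show ?thesis unfolding haagerup_def by blast
qed

end

section \<open>The Hausdorff measure of the boundary\<close>

context good_hyperbolic_action
begin

abbreviation \<nu> :: "(nat \<Rightarrow> 'a) set measure" where "\<nu> \<equiv> boundary_measure G \<phi> x0 \<epsilon>"

abbreviation Hm :: "(nat \<Rightarrow> 'a) set measure" where "Hm \<equiv> hausdorff_measure bd vd D"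

lemma sets_nu [simp]: "sets \<nu> = sets Hm" by (simp add: boundary_measure_def)

lemma space_nu [simp]: "space \<nu> = bd" by (simp add: boundary_measure_def)

lemma open_in_sets: "openin vis.mtopology U \<Longrightarrow> U \<in> sets Hm"
  unfolding vis.sets_hausdorff_measure by (rule sigma_sets.Basic) simp

lemma bd_nonempty: "Q > 0 \<Longrightarrow> bd \<noteq> {}"
  using hausdorff_boundary_pos vis.hausdorff_outer_content[of D "{}"] by auto

lemma Hm_finite:
  assumes Q: "Q > 0" shows "emeasure Hm bd \<noteq> 0" "emeasure Hm bd \<noteq> \<infinity>"
proof -
  have bd: "bd \<in> sets Hm" using sets.top[of Hm] by simp
  note em = vis.emeasure_hausdorff_measure[OF bd]
  show "emeasure Hm bd \<noteq> 0" using hausdorff_boundary_pos[OF Q] em by simp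
  obtain C where C: "\<And>\<xi> r. \<xi> \<in> bd \<Longrightarrow> r > 0 \<Longrightarrow>
    hausdorff_outer bd vd D {\<eta> \<in> bd. vd \<xi> \<eta> \<le> r} \<le> ennreal (C * r powr D)"
    by (rule hausdorff_ball_upper[OF Q]) (rule that; blast)
  obtain \<xi> where \<xi>: "\<xi> \<in> bd" using bd_nonempty[OF Q] by blast
  have "{\<eta> \<in> bd. vd \<xi> \<eta> \<le> 1} = bd" using vd_le_1[OF \<xi>] by auto
  then show "emeasure Hm bd \<noteq> \<infinity>" using C[OF \<xi>, of 1] em by (auto simp: top_unique)
qed

lemma prob_space_nu: "Q > 0 \<Longrightarrow> prob_space \<nu>"
  unfolding boundary_measure_def by (rule prob_space_uniform_measure) (use Hm_finite in auto)

lemma emeasure_nu: "A \<in> sets Hm \<Longrightarrow> emeasure \<nu> A = hausdorff_outer bd vd D A / emeasure Hm bd"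
proof -
  assume A: "A \<in> sets Hm"
  then have "bd \<inter> A = A" using sets.sets_into_space[OF A] by auto
  then show ?thesis
    unfolding boundary_measure_def using A sets.top[of Hm]
    by (simp add: emeasure_uniform_measure vis.emeasure_hausdorff_measure)
qed

lemma nu_ball:
  assumes Q: "Q > 0"
  shows "\<exists>C>0. \<forall>\<xi> r. \<xi> \<in> bd \<longrightarrow> r > 0 \<longrightarrow> emeasure \<nu> {\<eta> \<in> bd. vd \<xi> \<eta> \<le> r} \<le> ennreal (C * r powr D)"
proof -
  obtain C where C: "C > 0" "\<And>\<xi> r. \<xi> \<in> bd \<Longrightarrow> r > 0 \<Longrightarrow>
    hausdorff_outer bd vd D {\<eta> \<in> bd. vd \<xi> \<eta> \<le> r} \<le> ennreal (C * r powr D)"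
    by (rule hausdorff_ball_upper[OF Q]) (rule that; blast)
  define h where "h = enn2real (emeasure Hm bd)"
  have h: "emeasure Hm bd = ennreal h" "h > 0"
    using Hm_finite[OF Q] by (auto simp: h_def enn2real_positive_iff less_top zero_less_iff_neq_zero)
  have "emeasure \<nu> {\<eta> \<in> bd. vd \<xi> \<eta> \<le> r} \<le> ennreal (C / h * r powr D)" if \<xi>: "\<xi> \<in> bd" and r: "r > 0" for \<xi> r
  proof -
    have eq: "{\<eta> \<in> bd. vd \<xi> \<eta> \<le> r} = vis.mcball \<xi> r" using \<xi> by (auto simp: vis.mcball_def)
    have "openin vis.mtopology (bd - vis.mcball \<xi> r)"
      using vis.closedin_mcball[of \<xi> r] unfolding closedin_def by simp
    then have "bd - (bd - vis.mcball \<xi> r) \<in> sets Hm"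
      using open_in_sets sets.compl_sets[of _ Hm] by (metis vis.space_hausdorff_measure)
    moreover have "bd - (bd - vis.mcball \<xi> r) = vis.mcball \<xi> r" by (auto simp: vis.mcball_def)
    ultimately have m: "{\<eta> \<in> bd. vd \<xi> \<eta> \<le> r} \<in> sets Hm" using eq by simp
    have "emeasure \<nu> {\<eta> \<in> bd. vd \<xi> \<eta> \<le> r} \<le> ennreal (C * r powr D) / ennreal h"
      unfolding emeasure_nu[OF m] h(1) by (intro divide_right_mono_ennreal C \<xi> r)
    also have "\<dots> = ennreal (C / h * r powr D)" using C(1) h(2) by (subst divide_ennreal) auto
    finally show ?thesis .
  qed
  then show ?thesis using C(1) h(2) by (intro exI[of _ "C / h"]) auto
qed

text \<open>
  A dense set arises by choosing a point in every nonempty shadow of an orbit point. Separability is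
  what makes the distance measurable for the product of the Borel structures.
\<close>

lemma separable_boundary:
  "\<exists>S. countable S \<and> S \<subseteq> bd \<and> (\<forall>\<xi>\<in>bd. \<forall>r>0. \<exists>z\<in>S. vd \<xi> z < r)"
proof -
  have "carrier G = (\<Union>n::nat. ball_G (real n))"
    using real_arch_simple by (fastforce simp: ball_G_def)
  then have count: "countable (carrier G)" by (simp add: countable_finite)
  define B where "B g n = {\<eta> \<in> bd. shadow_depth (pt g) \<eta> \<ge> real n - rc - \<delta>}" for g n
  define S where "S = (\<lambda>(g, n). SOME \<eta>. \<eta> \<in> B g n) ` {(g, n). g \<in> carrier G \<and> B g n \<noteq> {}}"
  have pick: "(SOME \<eta>. \<eta> \<in> B g n) \<in> B g n" if "B g n \<noteq> {}" for g n
    using that by (simp add: some_in_eq)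
  have "countable {(g, n). g \<in> carrier G \<and> B g n \<noteq> {}}"
    by (rule countable_subset[of _ "carrier G \<times> UNIV"]) (use count in auto)
  then have "countable S" unfolding S_def by (rule countable_image)
  moreover have "S \<subseteq> bd" using pick by (fastforce simp: S_def B_def)
  moreover have "\<exists>z\<in>S. vd \<xi> z < r" if \<xi>: "\<xi> \<in> bd" and r: "r > 0" for \<xi> r
  proof -
    obtain n :: nat where n: "- ln r / \<epsilon> + rc + 2 * \<delta> < real n" using reals_Archimedean2 by blast
    then have "- \<epsilon> * (real n - rc - 2 * \<delta>) < ln r" using eps by (simp add: field_simps)
    then have small: "exp (- \<epsilon> * (real n - rc - 2 * \<delta>)) < r" using r by (metis exp_less_cancel_iff exp_ln)
    obtain g where g: "g \<in> ball_G (real n + rc)" "shadow_depth (pt g) \<xi> \<ge> real n - rc - \<delta>"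
      using ex_shadow[OF \<xi>, of "real n"] by auto
    then have ne: "B g n \<noteq> {}" and gG: "g \<in> carrier G" using \<xi> by (auto simp: B_def ball_G_def)
    define z where "z = (SOME \<eta>. \<eta> \<in> B g n)"
    have zB: "z \<in> B g n" unfolding z_def by (rule pick[OF ne])
    have "z \<in> S" unfolding S_def z_def using ne gG by (intro image_eqI[of _ _ "(g, n)"]) auto
    moreover have "vd \<xi> z \<le> exp (- \<epsilon> * (min (shadow_depth (pt g) \<xi>) (shadow_depth (pt g) z) - \<delta>))"
      using zB \<xi> by (intro vd_le_shadow_depth) (auto simp: B_def)
    moreover have "\<dots> \<le> exp (- \<epsilon> * (real n - rc - 2 * \<delta>))"
    proof -
      have "real n - rc - \<delta> \<le> min (shadow_depth (pt g) \<xi>) (shadow_depth (pt g) z)"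
        using zB g(2) by (simp add: B_def)
      then have "- \<epsilon> * (min (shadow_depth (pt g) \<xi>) (shadow_depth (pt g) z) - \<delta>) \<le> - \<epsilon> * (real n - rc - 2 * \<delta>)"
        using eps by (intro mult_left_mono_neg) auto
      then show ?thesis by simp
    qed
    ultimately show ?thesis using small by (intro bexI[of _ z], linarith)
  qed
  ultimately show ?thesis by blast
qed

lemma vd_measurable: "(\<lambda>p. vd (fst p) (snd p)) \<in> borel_measurable (\<nu> \<Otimes>\<^sub>M \<nu>)"
proof (rule borel_measurable_iff_less[THEN iffD2], rule allI)
  fix a :: real
  obtain S where S: "countable S" "S \<subseteq> bd" "\<And>\<xi> r. \<xi> \<in> bd \<Longrightarrow> r > 0 \<Longrightarrow> \<exists>z\<in>S. vd \<xi> z < r"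
    using separable_boundary by blast
  have "{w \<in> space (\<nu> \<Otimes>\<^sub>M \<nu>). vd (fst w) (snd w) < a} =
      (\<Union>z\<in>S. \<Union>q\<in>\<rat>. vis.mball z q \<times> vis.mball z (a - q))" (is "?log_kernel = ?R")
  proof (intro equalityI subsetI)
    fix w assume w: "w \<in> ?log_kernel"
    obtain \<xi> \<eta> where w': "w = (\<xi>, \<eta>)" "\<xi> \<in> bd" "\<eta> \<in> bd" "vd \<xi> \<eta> < a" using w by (auto simp: space_pair_measure)
    define e where "e = (a - vd \<xi> \<eta>) / 2"
    have e: "e > 0" using w' by (simp add: e_def)
    obtain z where z: "z \<in> S" "vd \<xi> z < e" using S(3)[OF w'(2) e] by blast
    obtain q where q: "q \<in> \<rat>" "vd \<xi> z < q" "q < e" using Rats_dense_in_real[OF z(2)] by blast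
    have zb: "z \<in> bd" using z S by blast
    have "vd z \<eta> \<le> vd z \<xi> + vd \<xi> \<eta>" by (rule vis.triangle) (use zb w' in auto)
    then have "vd z \<eta> < a - q" using z(2) q(3) vis.commute[of z \<xi>] by (simp add: e_def field_simps)
    then have "w \<in> vis.mball z q \<times> vis.mball z (a - q)"
      using w' zb q vis.commute[of z \<xi>] by simp
    then show "w \<in> ?R" using z(1) q(1) by blast
  next
    fix w assume "w \<in> ?R"
    then obtain z q where zq: "z \<in> S" "w \<in> vis.mball z q \<times> vis.mball z (a - q)" by blast
    then obtain \<xi> \<eta> where w': "w = (\<xi>, \<eta>)" "z \<in> bd" "\<xi> \<in> bd" "\<eta> \<in> bd" "vd z \<xi> < q" "vd z \<eta> < a - q" by auto
    have "vd \<xi> \<eta> \<le> vd \<xi> z + vd z \<eta>" by (rule vis.triangle) (use w' in auto)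
    then show "w \<in> ?log_kernel" using w' vis.commute[of z \<xi>] by (simp add: space_pair_measure)
  qed
  also have "\<dots> \<in> sets (\<nu> \<Otimes>\<^sub>M \<nu>)"
    by (intro sets.countable_UN'' S countable_rat pair_measureI) (auto intro: open_in_sets)
  finally show "{w \<in> space (\<nu> \<Otimes>\<^sub>M \<nu>). vd (fst w) (snd w) < a} \<in> sets (\<nu> \<Otimes>\<^sub>M \<nu>)" .
qed

lemma boundary_act_measurable:
  assumes g: "g \<in> carrier G" shows "boundary_act g \<in> measurable \<nu> \<nu>"
proof -
  have "boundary_act g \<in> measurable Hm Hm"
  proof (rule measurable_sigma_sets[OF vis.sets_hausdorff_measure])
    show "{U. openin vis.mtopology U} \<subseteq> Pow bd" by (auto simp: vis.openin_mtopology)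
    show "boundary_act g \<in> space Hm \<rightarrow> bd" using boundary_act_closed[OF g] by auto
    fix U assume "U \<in> {U. openin vis.mtopology U}"
    then have U: "U \<subseteq> bd" "\<And>x. x \<in> U \<Longrightarrow> \<exists>r>0. vis.mball x r \<subseteq> U" by (auto simp: vis.openin_mtopology)
    have "openin vis.mtopology (boundary_act g -` U \<inter> bd)"
      unfolding vis.openin_mtopology
    proof (intro conjI allI impI)
      fix \<xi> assume \<xi>: "\<xi> \<in> boundary_act g -` U \<inter> bd"
      then obtain r where r: "r > 0" "vis.mball (boundary_act g \<xi>) r \<subseteq> U" using U(2) by blast
      let ?r = "r / exp (\<epsilon> * len g)"
      have "vis.mball \<xi> ?r \<subseteq> boundary_act g -` U \<inter> bd"
      proof
        fix \<eta> assume "\<eta> \<in> vis.mball \<xi> ?r"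
        then have \<eta>: "\<eta> \<in> bd" "vd \<xi> \<eta> < ?r" by auto
        have "vd (boundary_act g \<xi>) (boundary_act g \<eta>) \<le> exp (\<epsilon> * len g) * vd \<xi> \<eta>"
          using vd_boundary_act_Lipschitz[OF g _ \<eta>(1)] \<xi> by blast
        also have "\<dots> < r" using \<eta>(2) by (simp add: field_simps)
        finally have "boundary_act g \<eta> \<in> vis.mball (boundary_act g \<xi>) r"
          using \<xi> \<eta> boundary_act_closed[OF g] by simp
        then show "\<eta> \<in> boundary_act g -` U \<inter> bd" using r(2) \<eta>(1) by blast
      qed
      then show "\<exists>r>0. vis.mball \<xi> r \<subseteq> boundary_act g -` U \<inter> bd" using r(1) by (intro exI[of _ ?r]) simp
    qed auto
    then show "boundary_act g -` U \<inter> space Hm \<in> sets Hm" using open_in_sets by simp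
  qed
  then show ?thesis by (simp cong: measurable_cong_sets)
qed

text \<open>
  The preimage under \<open>g\<close> is the image under \<open>g\<^sup>-\<^sup>1\<close>, which is Lipschitz.
\<close>

lemma nu_quasi_invariant:
  assumes Q: "Q > 0" and g: "g \<in> carrier G" and A: "A \<in> sets \<nu>"
  shows "emeasure \<nu> (boundary_act g -` A \<inter> space \<nu>) \<le> ennreal (exp (\<epsilon> * len g) powr D) * emeasure \<nu> A"
proof -
  have A': "A \<in> sets Hm" "A \<subseteq> bd" using A sets.sets_into_space[OF A] by auto
  have pre: "boundary_act g -` A \<inter> bd \<in> sets Hm"
    using measurable_sets[OF boundary_act_measurable[OF g] A] by simp
  have eq: "boundary_act g -` A \<inter> bd = boundary_act (inv g) ` A"
  proof (intro equalityI subsetI)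
    fix \<xi> assume "\<xi> \<in> boundary_act g -` A \<inter> bd"
    then show "\<xi> \<in> boundary_act (inv g) ` A" using boundary_act_inv(1)[OF g, of \<xi>] by (metis IntD1 imageI vimageD)
  next
    fix \<xi> assume "\<xi> \<in> boundary_act (inv g) ` A"
    then show "\<xi> \<in> boundary_act g -` A \<inter> bd"
      using boundary_act_inv(2)[OF g] boundary_act_closed[of "inv g"] g A'(2) by auto
  qed
  have "hausdorff_outer bd vd D (boundary_act (inv g) ` A) \<le>
      ennreal (exp (\<epsilon> * len (inv g)) powr D) * hausdorff_outer bd vd D A"
  proof (rule vis.hausdorff_outer_Lipschitz_image[OF A'(2)])
    fix \<xi> \<eta> assume "\<xi> \<in> A" "\<eta> \<in> A"
    then have "\<xi> \<in> bd" "\<eta> \<in> bd" using A'(2) by auto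
    then show "vd (boundary_act (inv g) \<xi>) (boundary_act (inv g) \<eta>) \<le> exp (\<epsilon> * len (inv g)) * vd \<xi> \<eta>"
      by (intro vd_boundary_act_Lipschitz inv_closed g)
    show "boundary_act (inv g) \<xi> \<in> bd" using \<open>\<xi> \<in> bd\<close> by (intro boundary_act_closed inv_closed g)
  qed (use D_pos[OF Q] in auto)
  then have "hausdorff_outer bd vd D (boundary_act g -` A \<inter> bd) / emeasure Hm bd \<le>
      ennreal (exp (\<epsilon> * len g) powr D) * hausdorff_outer bd vd D A / emeasure Hm bd"
    unfolding eq using g by (intro divide_right_mono_ennreal) simp
  then show ?thesis
    using emeasure_nu[OF pre] emeasure_nu[OF A'(1)] by (simp add: ennreal_times_divide)
qed

text \<open>
  The kernel \<open>d\<^sup>-\<^sup>s\<close> is the one of the intertwining operator with parameter \<open>t = (1 - s/D) / 2\<close>.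
\<close>

lemma riesz_kernel_nonneg:
  assumes Q: "Q > 0" and s: "0 < s" "s \<le> D / 2"
    and positive: "\<And>t. 0 < t \<Longrightarrow> t \<le> 1 / 2 \<Longrightarrow> positive_operator_L2 \<nu> (riesz_operator G \<phi> x0 \<epsilon> t)"
    and v: "v \<in> borel_measurable \<nu>" "\<And>x. \<bar>v x\<bar> \<le> B"
    and int: "integrable (\<nu> \<Otimes>\<^sub>M \<nu>) (\<lambda>p. v (fst p) * v (snd p) * vd (fst p) (snd p) powr (- s))"
  shows "0 \<le> (\<integral>p. v (fst p) * v (snd p) * vd (fst p) (snd p) powr (- s) \<partial>(\<nu> \<Otimes>\<^sub>M \<nu>))"
proof -
  interpret prob_space \<nu> by (rule prob_space_nu[OF Q])
  interpret P: pair_prob_space \<nu> \<nu> ..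
  define t where "t = (1 - s / D) / 2"
  have D: "D > 0" by (rule D_pos[OF Q])
  have t: "0 < t" "t \<le> 1 / 2" "(1 - 2 * t) * D = s" using s D by (auto simp: t_def field_simps)
  let ?v = "\<lambda>x. complex_of_real (v x)"
  have B: "B \<ge> 0" using order_trans[OF abs_ge_zero v(2)] .
  have "(v x)\<^sup>2 \<le> B\<^sup>2" for x using power_mono[OF v(2)[of x], of 2] by simp
  then have "integrable \<nu> (\<lambda>x. (cmod (?v x))\<^sup>2)"
    using v(1) by (intro integrable_const_bound[of _ "B\<^sup>2"]) auto
  then have "square_integrable \<nu> ?v" using v(1) by (simp add: square_integrable_def)
  then have "(\<integral>x. riesz_operator G \<phi> x0 \<epsilon> t ?v x * cnj (?v x) \<partial>\<nu>) \<in> \<real>\<^sub>\<ge>\<^sub>0"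
    using positive[OF t(1,2)] unfolding positive_operator_L2_def by blast
  also have "(\<lambda>x. riesz_operator G \<phi> x0 \<epsilon> t ?v x * cnj (?v x)) =
      (\<lambda>x. complex_of_real (\<integral>y. v x * v y * vd x y powr (- s) \<partial>\<nu>))"
  proof
    fix x
    have "(\<lambda>y. ?v y / complex_of_real (vd x y powr s)) = (\<lambda>y. complex_of_real (v y * vd x y powr (- s)))"
      by (simp add: powr_minus_divide fun_eq_iff)
    then have "riesz_operator G \<phi> x0 \<epsilon> t ?v x = complex_of_real (\<integral>y. v y * vd x y powr (- s) \<partial>\<nu>)"
      unfolding riesz_operator_def t(3) by (simp only: integral_complex_of_real)
    moreover have "(\<integral>y. v x * v y * vd x y powr (- s) \<partial>\<nu>) = (\<integral>y. v y * vd x y powr (- s) \<partial>\<nu>) * v x"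
      by (simp add: mult.assoc)
    ultimately show "riesz_operator G \<phi> x0 \<epsilon> t ?v x * cnj (?v x) = complex_of_real (\<integral>y. v x * v y * vd x y powr (- s) \<partial>\<nu>)"
      by simp
  qed
  finally have "0 \<le> (\<integral>x. \<integral>y. v x * v y * vd x y powr (- s) \<partial>\<nu> \<partial>\<nu>)"
    by (simp add: nonneg_Reals_of_real_iff)
  then show ?thesis using P.integral_fst'[OF int] by simp
qed

theorem haagerup_if_exponential:
  assumes Q: "Q > 0"
    and positive: "\<And>t. 0 < t \<Longrightarrow> t \<le> 1 / 2 \<Longrightarrow> positive_operator_L2 \<nu> (riesz_operator G \<phi> x0 \<epsilon> t)"
  shows "haagerup G"
proof -
  obtain C where C: "C > 0" "\<And>\<xi> r. \<xi> \<in> bd \<Longrightarrow> r > 0 \<Longrightarrow>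
      emeasure \<nu> {\<eta> \<in> bd. vd \<xi> \<eta> \<le> r} \<le> ennreal (C * r powr D)"
    using nu_ball[OF Q] by blast
  interpret nu: prob_space \<nu> by (rule prob_space_nu[OF Q])
  interpret log: log_energy \<nu> vd C D
    by unfold_locales (use vd_measurable vd_le_1 vis.commute vis.zero C D_pos[OF Q] in auto)
  interpret conformal_action \<nu> vd C D G boundary_act log_conformal len
      "\<lambda>g. exp (\<epsilon> * len g) powr D" "\<lambda>g. \<epsilon> * len g / 2" "\<epsilon> / 2" "\<epsilon> * (\<delta> + 1)"
  proof unfold_locales
    fix g assume g: "g \<in> carrier G"
    obtain \<zeta> where "\<zeta> \<in> bd" "\<And>\<xi>. \<xi> \<in> bd \<Longrightarrow> \<xi> \<noteq> \<zeta> \<Longrightarrow>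
        log_conformal g \<xi> \<ge> \<epsilon> * len g / 2 - \<epsilon> * (\<delta> + 1) + ln (vd \<xi> \<zeta>)"
      using log_conformal_lower[OF g bd_nonempty[OF Q]] by blast
    then show "\<exists>z\<in>space \<nu>. \<forall>x\<in>space \<nu>. x \<noteq> z \<longrightarrow> \<epsilon> / 2 * len g - \<epsilon> * (\<delta> + 1) + ln (vd x z) \<le> log_conformal g x"
      by auto
  next
    fix s :: real and v :: "(nat \<Rightarrow> 'a) set \<Rightarrow> real" and B :: real
    assume s: "0 < s" "s \<le> D / 2" and v: "v \<in> borel_measurable \<nu>" "\<And>x. \<bar>v x\<bar> \<le> B"
    have "integrable (\<nu> \<Otimes>\<^sub>M \<nu>) (\<lambda>p. v (fst p) * v (snd p) * vd (fst p) (snd p) powr (- s))"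
      by (rule log.potential_integrable_le) (use v s in auto)
    then show "0 \<le> (\<integral>p. v (fst p) * v (snd p) * vd (fst p) (snd p) powr (- s) \<partial>(\<nu> \<Otimes>\<^sub>M \<nu>))"
      using riesz_kernel_nonneg[OF Q s positive v] by blast
  qed (use boundary_act_measurable boundary_act_mult nu_quasi_invariant[OF Q] vd_boundary_act
      log_conformal_bounds eps finite_ball_G in \<open>auto simp: ball_G_def\<close>)
  show ?thesis by (rule haagerup_conformal_action)
qed

end

theorem proposition5p4:
  fixes G :: "('g, 'm) monoid_scheme"
    and \<phi> :: "'g \<Rightarrow> 'a::metric_space \<Rightarrow> 'a"
    and x0 :: 'a and \<delta> \<epsilon> :: real
  assumes proper: "\<And>(x::'a) r. compact (cball x r)"
    and hyperbolic: "\<delta> \<ge> 0" "gromov_hyperbolic_at (UNIV :: 'a set) dist x0 \<delta>"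
    and rough: "roughly_geodesic TYPE('a)"
    and good: "\<epsilon> > 0" "good_space x0 \<epsilon>"
    and group: "group G" "hyperbolic_group G" "non_elementary G"
    and action: "group_action G (UNIV :: 'a set) \<phi>"
    and isometric: "\<And>g x y. g \<in> carrier G \<Longrightarrow> dist (\<phi> g x) (\<phi> g y) = dist x y"
    and geometric: "properly_discontinuous G \<phi>" "cocompact G \<phi>"
    and positive: "\<And>t. 0 < t \<Longrightarrow> t \<le> 1 / 2 \<Longrightarrow>
          positive_operator_L2 (boundary_measure G \<phi> x0 \<epsilon>) (riesz_operator G \<phi> x0 \<epsilon> t)"
  shows "haagerup G"
proof -
  interpret group G by (rule group)
  interpret good_hyperbolic_action G \<phi> x0 \<delta> \<epsilon>
    by (intro good_hyperbolic_action.intro geometric_hyperbolic_action.intro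
        geometric_hyperbolic_action_axioms.intro good_hyperbolic_action_axioms.intro) fact+
  show ?thesis
    using haagerup_if_subexponential haagerup_if_exponential[OF _ positive] Q_nonneg by fastforce
qed

end
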